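(* For each $n\in\mathbb{N}^{+}$, let $(q,\theta,m,\varepsilon,\varepsilon',\delta)$ satisfy the following conditions: $(n,m,q,\theta)\in\mathcal{T}$ with $q$ prime, $\varepsilon,\varepsilon',\delta\in[0,1]$, and $\varepsilon^2\ge(1-1/q)^2(1/M+\varepsilon')$, where $M=q^m$. If the $(M,M\theta,(1-\theta)M+1)_M$-generalized Reed-Solomon code $\mathrm{GRS}^{(M,M\theta,M)}$ has a quantum list decoder with bias $\varepsilon'$ and confidence $\delta$ running in time polynomial in $(n,q,1/\varepsilon',1/\delta,1/\theta)$, then the concatenated code $C^{GRS\text{-}H}[n,q,\theta]$ has a quantum list decoder with bias $\varepsilon$ and confidence $\delta$ running in time polynomial in $(n,q,1/\varepsilon',1/\delta,1/\theta)$.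
   Context: Parameters. $\mathcal{T}$ is the collection of all tuples $(n,m,q,\theta)$ with $m,q\in\mathbb{N}^{+}$, $q\ge2$, $\theta\in[0,1]$, $q^m\theta\in\mathbb{N}$, and $n=mq^m\theta$. Codes. A block code with message space $\Sigma_n$, index set $I_n$ and code alphabet $\Gamma_n$ is a function $C:\Sigma_n\times I_n\to\Gamma_n$; the codeword of $x$ is $C_x=C(x,\cdot)$. An $(M,N,d)_Q$-code has block length $M=|I_n|$, message length $N$, minimal Hamming distance $d$ and code alphabet size $Q=|\Gamma_n|$. The $q$-ary Hadamard code ($q$ prime) is $\mathrm{HAD}^{(q,m)}:(\mathbb{F}_q)^m\times(\mathbb{F}_q)^m\to\mathbb{F}_q$, $\mathrm{HAD}^{(q,m)}(x,r)=\sum_{i=1}^m x_ir_i \bmod q$. For a prime power $Q$ and integers $N\le K\le Q$, the generalized Reed-Solomon code is $\mathrm{GRS}^{(K,N,Q)}:(\mathbb{F}_Q)^N\times D_K\to\mathbb{F}_Q$, $\mathrm{GRS}^{(K,N,Q)}(x,r)=\sum_{i=1}^N x_ir^{i-1}$ (computed in $\mathbb{F}_Q$), where $D_K$ is a fixed set of $K$ distinct elements of $\mathbb{F}_Q$ (so $D_K=\mathbb{F}_Q$ when $K=Q$). The concatenated code with outer code $C_1$ and inner code $C_2$ is $(C_2\odot C_1)(x,r,s)=C_2(C_1(x,r),s)$. Identifying $\mathbb{F}_{q^m}$ with $(\mathbb{F}_q)^m$ in the standard way, for $(n,m,q,\theta)\in\mathcal{T}$, $C^{GRS\text{-}H}[n,q,\theta]=\mathrm{HAD}^{(q,m)}\odot\mathrm{GRS}^{(q^m,q^m\theta,q^m)}$;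 it has message length $n$ over $\mathbb{F}_q$, block length $q^{2m}$, code alphabet $\mathbb{F}_q$. Quantumly corrupted codeword. Code symbols are encoded as binary strings of a fixed length $m'$. A quantumly corrupted codeword for a code $C$ is a unitary $O$ such that, for all $r\in I_n$ and $s\in\{0,1\}^{m'}$, $O|r\rangle|s\rangle|0^{\ell}\rangle=\sum_{z\in\{0,1\}^{m'}}\alpha_{r,z}|r\rangle|s\oplus z\rangle|\phi_{r,z}\rangle$, where $|\phi_{r,z}\rangle$ are (unit) $\ell$-qubit states and $\sum_z|\alpha_{r,z}|^2=1$ for every $r$. The presence of $C_x$ in $O$ is $\mathrm{Pre}_O(C_x)=\frac{1}{|I_n|}\sum_{r\in I_n}|\alpha_{r,C_x(r)}|^2$. Quantum list decoder. A quantum list decoder for $C$ with bias $\varepsilon$ and confidence $\delta$ is a quantum algorithm that, given the message length and $1/\varepsilon$ and oracle access (to $O$ and $O^{-1}$, unit cost per query) to an arbitrary quantumly corrupted codeword $O$ for $C$, outputs with probability at least $\delta$ a list of messages including all $x$ with $\mathrm{Pre}_O(C_x)\ge 1/|\Gamma_n|+\varepsilon$. *)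

theory Defs
  imports
    "HOL-Algebra.Ring"
    "HOL-Analysis.Infinite_Sum"
    "HOL-Library.Extended_Nonnegative_Real"
    "HOL-Computational_Algebra.Primes"
begin

section \<open>Codes\<close>

definition param_tuples :: "(nat \<times> nat \<times> nat \<times> real) set" where
  "param_tuples = {(n, m, q, \<theta>). m \<ge> 1 \<and> q \<ge> 2 \<and> 0 \<le> \<theta> \<and> \<theta> \<le> 1 \<and>
     real (q ^ m) * \<theta> \<in> \<nat> \<and> real n = real m * (real (q ^ m) * \<theta>)}"

text \<open>
  A block code on the message set, index set and alphabet given by the first three components.
  The bit-string components fix how these objects are written on qubits; the widths are the
  lengths of these strings.
\<close>

record ('x, 'i, 's) block_code =
  messages :: "'x set"
  indices :: "'i set"
  alphabet :: "'s set"
  codeword :: "'x \<Rightarrow> 'i \<Rightarrow> 's"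
  message_bits :: "'x \<Rightarrow> bool list"
  index_bits :: "'i \<Rightarrow> bool list"
  symbol_bits :: "'s \<Rightarrow> bool list"
  message_width :: nat
  index_width :: nat
  symbol_width :: nat

definition digit_vectors :: "nat \<Rightarrow> nat \<Rightarrow> nat list set" where
  "digit_vectors q m = {v. length v = m \<and> (\<forall>d \<in> set v. d < q)}"

definition digit_width :: "nat \<Rightarrow> nat" where
  "digit_width q = (LEAST b. q \<le> 2 ^ b)"

definition digit_bits :: "nat \<Rightarrow> nat \<Rightarrow> bool list" where
  "digit_bits q d = map (bit d) [0..<digit_width q]"

definition vector_bits :: "nat \<Rightarrow> nat list \<Rightarrow> bool list" where
  "vector_bits q v = concat (map (digit_bits q) v)"

definition hadamard_code :: "nat \<Rightarrow> nat \<Rightarrow> (nat list, nat list, nat) block_code" where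
  "hadamard_code q m =
    \<lparr> messages = digit_vectors q m,
      indices = digit_vectors q m,
      alphabet = {..<q},
      codeword = (\<lambda>x r. (\<Sum>i<m. x ! i * r ! i) mod q),
      message_bits = vector_bits q,
      index_bits = vector_bits q,
      symbol_bits = digit_bits q,
      message_width = m * digit_width q,
      index_width = m * digit_width q,
      symbol_width = digit_width q \<rparr>"

text \<open>
  The field with \<open>q ^ m\<close> elements on the set of coefficient vectors over the integers modulo
  \<open>q\<close>: addition is componentwise, and the unit vectors are the powers
  \<open>1, X, \<dots>, X ^ (m - 1)\<close> of one element \<open>X\<close>. For prime \<open>q\<close> these are exactly the quotients of the
  polynomial ring by a monic irreducible polynomial of degree \<open>m\<close>, each residue class being
  written as its coefficient vector.
\<close>

definition is_extension_field :: "nat \<Rightarrow> nat \<Rightarrow> nat list ring \<Rightarrow> bool" where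
  "is_extension_field q m F \<longleftrightarrow>
     field F \<and> carrier F = digit_vectors q m \<and>
     (\<forall>u \<in> carrier F. \<forall>v \<in> carrier F. u \<oplus>\<^bsub>F\<^esub> v = map2 (\<lambda>a b. (a + b) mod q) u v) \<and>
     (\<exists>X \<in> carrier F. \<forall>i<m. X [^]\<^bsub>F\<^esub> i = (replicate m 0)[i := 1])"

definition grs_code ::
  "nat \<Rightarrow> nat \<Rightarrow> nat list ring \<Rightarrow> nat list set \<Rightarrow> nat \<Rightarrow> (nat list list, nat list, nat list) block_code"
  where
  "grs_code q m F D N =
    \<lparr> messages = {x. length x = N \<and> set x \<subseteq> carrier F},
      indices = D,
      alphabet = carrier F,
      codeword = (\<lambda>x r. \<Oplus>\<^bsub>F\<^esub> i \<in> {..<N}. x ! i \<otimes>\<^bsub>F\<^esub> r [^]\<^bsub>F\<^esub> i),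
      message_bits = (\<lambda>x. concat (map (vector_bits q) x)),
      index_bits = vector_bits q,
      symbol_bits = vector_bits q,
      message_width = N * (m * digit_width q),
      index_width = m * digit_width q,
      symbol_width = m * digit_width q \<rparr>"

definition concatenated_code ::
  "('y, 'j, 's) block_code \<Rightarrow> ('x, 'i, 'y) block_code \<Rightarrow> ('x, 'i \<times> 'j, 's) block_code"
  where
  "concatenated_code C2 C1 =
    \<lparr> messages = messages C1,
      indices = indices C1 \<times> indices C2,
      alphabet = alphabet C2,
      codeword = (\<lambda>x (r, s). codeword C2 (codeword C1 x r) s),
      message_bits = message_bits C1,
      index_bits = (\<lambda>(r, s). index_bits C1 r @ index_bits C2 s),
      symbol_bits = symbol_bits C2,
      message_width = message_width C1,
      index_width = index_width C1 + index_width C2,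
      symbol_width = symbol_width C2 \<rparr>"

definition grs_length :: "nat \<Rightarrow> nat \<Rightarrow> real \<Rightarrow> nat" where
  "grs_length q m \<theta> = nat \<lfloor>real (q ^ m) * \<theta>\<rfloor>"

definition full_grs_code ::
  "nat \<Rightarrow> nat \<Rightarrow> real \<Rightarrow> nat list ring \<Rightarrow> (nat list list, nat list, nat list) block_code"
  where
  "full_grs_code q m \<theta> F = grs_code q m F (carrier F) (grs_length q m \<theta>)"

text \<open>
  A message is kept as the list of its \<open>q ^ m * \<theta>\<close> blocks in the extension field. Its
  concatenation is the vector of length \<open>n = m * q ^ m * \<theta>\<close> over the prime field.
\<close>

definition grs_h_code ::
  "nat \<Rightarrow> nat \<Rightarrow> real \<Rightarrow> nat list ring \<Rightarrow> (nat list list, nat list \<times> nat list, nat) block_code"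
  where
  "grs_h_code q m \<theta> F = concatenated_code (hadamard_code q m) (full_grs_code q m \<theta> F)"


section \<open>Quantumly corrupted codewords\<close>

definition bitstrings :: "nat \<Rightarrow> bool list set" where
  "bitstrings k = {b. length b = k}"

definition xor_bits :: "bool list \<Rightarrow> bool list \<Rightarrow> bool list" where
  "xor_bits = map2 (\<noteq>)"

text \<open>
  A linear operator on \<open>k\<close> qubits is given by its matrix entries \<open>U x y\<close> (row \<open>x\<close>, column
  \<open>y\<close>, so that \<open>U\<close> sends the basis vector \<open>y\<close> to the sum of all \<open>U x y\<close> times the basis vector
  \<open>x\<close>); entries at strings of other lengths are irrelevant.
\<close>

type_synonym operator = "bool list \<Rightarrow> bool list \<Rightarrow> complex"

definition adjoint_op :: "operator \<Rightarrow> operator" where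
  "adjoint_op U = (\<lambda>x y. cnj (U y x))"

definition unitary_op :: "nat \<Rightarrow> operator \<Rightarrow> bool" where
  "unitary_op k U \<longleftrightarrow>
     (\<forall>x \<in> bitstrings k. \<forall>y \<in> bitstrings k.
        (\<Sum>z \<in> bitstrings k. adjoint_op U x z * U z y) = of_bool (x = y) \<and>
        (\<Sum>z \<in> bitstrings k. U x z * adjoint_op U z y) = of_bool (x = y))"

text \<open>
  \<open>Q\<close> is the unitary, \<open>l\<close> the number of ancilla qubits. Nothing is required of \<open>Q\<close> on
  ancillas other than zero or on strings that encode no index.
\<close>

definition corrupted_codeword ::
  "('x, 'i, 's) block_code \<Rightarrow> nat \<Rightarrow> operator \<Rightarrow> ('i \<Rightarrow> bool list \<Rightarrow> complex) \<Rightarrow>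
     ('i \<Rightarrow> bool list \<Rightarrow> bool list \<Rightarrow> complex) \<Rightarrow> bool"
  where
  "corrupted_codeword C l Q \<alpha> \<phi> \<longleftrightarrow>
     unitary_op (index_width C + symbol_width C + l) Q \<and>
     (\<forall>r \<in> indices C. (\<Sum>z \<in> bitstrings (symbol_width C). (cmod (\<alpha> r z))\<^sup>2) = 1) \<and>
     (\<forall>r \<in> indices C. \<forall>z \<in> bitstrings (symbol_width C).
        (\<Sum>a \<in> bitstrings l. (cmod (\<phi> r z a))\<^sup>2) = 1) \<and>
     (\<forall>r \<in> indices C. \<forall>s \<in> bitstrings (symbol_width C).
      \<forall>r' \<in> bitstrings (index_width C). \<forall>s' \<in> bitstrings (symbol_width C). \<forall>a \<in> bitstrings l.
        Q (r' @ s' @ a) (index_bits C r @ s @ replicate l False) =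
          (\<Sum>z \<in> bitstrings (symbol_width C).
             \<alpha> r z * of_bool (r' = index_bits C r) * of_bool (s' = xor_bits s z) * \<phi> r z a))"

definition presence ::
  "('x, 'i, 's) block_code \<Rightarrow> ('i \<Rightarrow> bool list \<Rightarrow> complex) \<Rightarrow> 'x \<Rightarrow> real" where
  "presence C \<alpha> x =
     (\<Sum>r \<in> indices C. (cmod (\<alpha> r (symbol_bits C (codeword C x r))))\<^sup>2) / real (card (indices C))"


section \<open>Quantum circuits with oracle gates\<close>

text \<open>
  Qubits are arranged in rows of unbounded length and addressed by row and column. A \<open>QFT d\<close>
  gate acts on the block of \<open>digit_width d\<close> qubits starting at the given address, and a query acts
  on three blocks (index, symbol, ancilla) starting at the given addresses.
  \<open>QFT 2\<close> is the Hadamard gate, and the phases are \<open>2 * pi * a / b\<close>.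
\<close>

type_synonym qubit = "nat \<times> nat"

datatype 'a gate =
    NOT "'a \<times> 'a"
  | CNOT "'a \<times> 'a" "'a \<times> 'a"
  | Toffoli "'a \<times> 'a" "'a \<times> 'a" "'a \<times> 'a"
  | Phase 'a 'a "'a \<times> 'a"
  | CPhase 'a 'a "'a \<times> 'a" "'a \<times> 'a"
  | QFT 'a "'a \<times> 'a"
  | Query "'a \<times> 'a" "'a \<times> 'a" "'a \<times> 'a"
  | QueryInv "'a \<times> 'a" "'a \<times> 'a" "'a \<times> 'a"

definition block :: "qubit \<Rightarrow> nat \<Rightarrow> qubit list" where
  "block w k = map (\<lambda>i. (fst w, snd w + i)) [0..<k]"

fun gate_qubits :: "('x, 'i, 's) block_code \<Rightarrow> nat \<Rightarrow> nat gate \<Rightarrow> qubit list" where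
  "gate_qubits C l (NOT u) = [u]"
| "gate_qubits C l (CNOT u v) = [u, v]"
| "gate_qubits C l (Toffoli u v w) = [u, v, w]"
| "gate_qubits C l (Phase a b u) = [u]"
| "gate_qubits C l (CPhase a b u v) = [u, v]"
| "gate_qubits C l (QFT d u) = block u (digit_width d)"
| "gate_qubits C l (Query u v w) =
     block u (index_width C) @ block v (symbol_width C) @ block w l"
| "gate_qubits C l (QueryInv u v w) =
     block u (index_width C) @ block v (symbol_width C) @ block w l"

definition classical_op :: "(bool list \<Rightarrow> bool list) \<Rightarrow> operator" where
  "classical_op f = (\<lambda>x y. of_bool (x = f y))"

definition phase_op :: "nat \<Rightarrow> nat \<Rightarrow> operator" where
  "phase_op a b = (\<lambda>x y. if x = y then (if \<forall>c \<in> set y. c then cis (2 * pi * (a / b)) else 1) else 0)"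

text \<open>The transform over the integers modulo \<open>d\<close>; strings encoding numbers \<open>\<ge> d\<close> are fixed.\<close>

definition qft_op :: "nat \<Rightarrow> operator" where
  "qft_op d = (\<lambda>x y.
     let i = (horner_sum of_bool 2 x :: nat); j = (horner_sum of_bool 2 y :: nat)
     in if i < d \<and> j < d then cis (2 * pi * (real (i * j) / real d)) / complex_of_real (sqrt (real d))
        else of_bool (x = y))"

fun gate_op :: "operator \<Rightarrow> nat gate \<Rightarrow> operator" where
  "gate_op Q (NOT u) = classical_op (\<lambda>y. [\<not> y ! 0])"
| "gate_op Q (CNOT u v) = classical_op (\<lambda>y. [y ! 0, y ! 1 \<noteq> y ! 0])"
| "gate_op Q (Toffoli u v w) = classical_op (\<lambda>y. [y ! 0, y ! 1, y ! 2 \<noteq> (y ! 0 \<and> y ! 1)])"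
| "gate_op Q (Phase a b u) = phase_op a b"
| "gate_op Q (CPhase a b u v) = phase_op a b"
| "gate_op Q (QFT d u) = qft_op d"
| "gate_op Q (Query u v w) = Q"
| "gate_op Q (QueryInv u v w) = adjoint_op Q"

text \<open>
  A state assigns an amplitude to every assignment of bits to all qubits. All states that arise
  from the initial one by finitely many gates have finite support.
\<close>

type_synonym qstate = "(qubit \<Rightarrow> bool) \<Rightarrow> complex"

definition initial_state :: qstate where
  "initial_state = (\<lambda>x. of_bool (\<forall>w. \<not> x w))"

definition assign_bits :: "(qubit \<Rightarrow> bool) \<Rightarrow> qubit list \<Rightarrow> bool list \<Rightarrow> qubit \<Rightarrow> bool" where
  "assign_bits x ws bs = (\<lambda>w. case map_of (zip ws bs) w of None \<Rightarrow> x w | Some b \<Rightarrow> b)"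

definition apply_op :: "operator \<Rightarrow> qubit list \<Rightarrow> qstate \<Rightarrow> qstate" where
  "apply_op U ws \<psi> =
     (\<lambda>x. \<Sum>y \<in> bitstrings (length ws). U (map x ws) y * \<psi> (assign_bits x ws y))"

definition run_circuit ::
  "('x, 'i, 's) block_code \<Rightarrow> nat \<Rightarrow> operator \<Rightarrow> nat gate list \<Rightarrow> qstate" where
  "run_circuit C l Q gs =
     fold (\<lambda>g. apply_op (gate_op Q g) (gate_qubits C l g)) gs initial_state"

definition measure_prob :: "qstate \<Rightarrow> qubit list \<Rightarrow> bool list set \<Rightarrow> real" where
  "measure_prob \<psi> ws A = (\<Sum>\<^sub>\<infinity>x \<in> {x. map x ws \<in> A}. (cmod (\<psi> x))\<^sup>2)"


section \<open>Quantum algorithms\<close>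

text \<open>
  A quantum algorithm is one program of a classical register machine that, from its numerical
  input, generates a quantum circuit gate by gate and names the qubits to be measured at the
  end; that is, a uniform family of circuits. The program text mentions only finitely many
  registers. Addition and halving make the registers usable as stacks of bits, so polynomially
  many steps of this machine and of a Turing machine can do the same.
\<close>

datatype program =
    SET nat nat
  | ADD nat nat nat
  | SUB nat nat nat
  | HALF nat nat
  | SEQ program program
  | COND nat program program
  | WHILE nat program
  | EMIT "nat gate"
  | OUTPUT "nat \<times> nat"

text \<open>
  \<open>exec p s s' gs ws t\<close>: started with registers \<open>s\<close>, the program \<open>p\<close> halts after \<open>t\<close> steps with
  registers \<open>s'\<close>, having emitted the gates \<open>gs\<close> and named the output qubits \<open>ws\<close>. The numbers in
  an emitted gate are the contents of the registers named in the program text.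
\<close>

inductive exec ::
  "program \<Rightarrow> (nat \<Rightarrow> nat) \<Rightarrow> (nat \<Rightarrow> nat) \<Rightarrow> nat gate list \<Rightarrow> qubit list \<Rightarrow> nat \<Rightarrow> bool" where
  exec_SET: "exec (SET i c) s (s(i := c)) [] [] 1"
| exec_ADD: "exec (ADD i j k) s (s(i := s j + s k)) [] [] 1"
| exec_SUB: "exec (SUB i j k) s (s(i := s j - s k)) [] [] 1"
| exec_HALF: "exec (HALF i j) s (s(i := s j div 2)) [] [] 1"
| exec_SEQ: "exec p s s' gs ws t \<Longrightarrow> exec p' s' s'' gs' ws' t' \<Longrightarrow>
    exec (SEQ p p') s s'' (gs @ gs') (ws @ ws') (t + t')"
| exec_COND_nonzero: "s i \<noteq> 0 \<Longrightarrow> exec p s s' gs ws t \<Longrightarrow>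
    exec (COND i p p') s s' gs ws (Suc t)"
| exec_COND_zero: "s i = 0 \<Longrightarrow> exec p' s s' gs ws t \<Longrightarrow>
    exec (COND i p p') s s' gs ws (Suc t)"
| exec_WHILE_stop: "s i = 0 \<Longrightarrow> exec (WHILE i p) s s [] [] 1"
| exec_WHILE_step: "s i \<noteq> 0 \<Longrightarrow> exec p s s' gs ws t \<Longrightarrow> exec (WHILE i p) s' s'' gs' ws' t' \<Longrightarrow>
    exec (WHILE i p) s s'' (gs @ gs') (ws @ ws') (Suc (t + t'))"
| exec_EMIT: "exec (EMIT g) s s [map_gate s g] [] 1"
| exec_OUTPUT: "exec (OUTPUT (i, j)) s s [] [(s i, s j)] 1"

definition input_registers :: "nat list \<Rightarrow> nat \<Rightarrow> nat" where
  "input_registers xs = (\<lambda>i. if i < length xs then xs ! i else 0)"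


section \<open>Quantum list decoders\<close>

text \<open>
  The measured bits are cut into consecutive strings of the length of a message; strings that
  encode no message are ignored.
\<close>

definition listed_messages :: "('x, 'i, 's) block_code \<Rightarrow> bool list \<Rightarrow> 'x set" where
  "listed_messages C bs =
     {x \<in> messages C. \<exists>j. (j + 1) * message_width C \<le> length bs \<and>
        take (message_width C) (drop (j * message_width C) bs) = message_bits C x}"

text \<open>
  The input at \<open>n\<close> consists of the message length, \<open>1/\<epsilon>\<close> rounded up, and the parameters \<open>pars n\<close>
  describing the family. The circuit does not depend on the oracle \<open>Q\<close>, nor on its number of
  ancillas.
\<close>

definition decoder_input ::
  "(nat \<Rightarrow> nat) \<Rightarrow> (nat \<Rightarrow> real) \<Rightarrow> (nat \<Rightarrow> nat list) \<Rightarrow> nat \<Rightarrow> nat \<Rightarrow> nat" where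
  "decoder_input len \<epsilon> pars n = input_registers (len n # nat \<lceil>1 / \<epsilon> n\<rceil> # pars n)"

definition is_quantum_list_decoder ::
  "program \<Rightarrow> (nat \<Rightarrow> ('x, 'i, 's) block_code) \<Rightarrow> (nat \<Rightarrow> nat) \<Rightarrow> (nat \<Rightarrow> nat list) \<Rightarrow>
     (nat \<Rightarrow> real) \<Rightarrow> (nat \<Rightarrow> real) \<Rightarrow> bool"
  where
  "is_quantum_list_decoder P C len pars \<epsilon> \<delta> \<longleftrightarrow>
     (\<forall>n \<ge> 1. \<exists>s gs ws t. exec P (decoder_input len \<epsilon> pars n) s gs ws t \<and>
        (\<forall>l. \<forall>g \<in> set gs. distinct (gate_qubits (C n) l g)) \<and>
        (\<forall>l Q \<alpha> \<phi>. corrupted_codeword (C n) l Q \<alpha> \<phi> \<longrightarrow>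
           measure_prob (run_circuit (C n) l Q gs) ws
             {bs. \<forall>x \<in> messages (C n).
                presence (C n) \<alpha> x \<ge> 1 / real (card (alphabet (C n))) + \<epsilon> n \<longrightarrow>
                x \<in> listed_messages (C n) bs}
           \<ge> \<delta> n))"

definition runs_in_time_poly ::
  "program \<Rightarrow> (nat \<Rightarrow> nat) \<Rightarrow> (nat \<Rightarrow> real) \<Rightarrow> (nat \<Rightarrow> nat list) \<Rightarrow> (nat \<Rightarrow> ennreal) \<Rightarrow> bool" where
  "runs_in_time_poly P len \<epsilon> pars bnd \<longleftrightarrow>
     (\<exists>c k :: nat. \<forall>n \<ge> 1. \<forall>s gs ws t. exec P (decoder_input len \<epsilon> pars n) s gs ws t \<longrightarrow>
        of_nat t \<le> of_nat c * bnd n ^ k)"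

definition has_poly_time_quantum_list_decoder ::
  "(nat \<Rightarrow> ('x, 'i, 's) block_code) \<Rightarrow> (nat \<Rightarrow> nat) \<Rightarrow> (nat \<Rightarrow> nat list) \<Rightarrow>
     (nat \<Rightarrow> real) \<Rightarrow> (nat \<Rightarrow> real) \<Rightarrow> (nat \<Rightarrow> ennreal) \<Rightarrow> bool"
  where
  "has_poly_time_quantum_list_decoder C len pars \<epsilon> \<delta> bnd \<longleftrightarrow>
     (\<exists>P. is_quantum_list_decoder P C len pars \<epsilon> \<delta> \<and> runs_in_time_poly P len \<epsilon> pars bnd)"

text \<open>
  A quantity is polynomially bounded in several numbers, at least one of which is \<open>\<ge> 1\<close>, iff it
  is in their sum. In \<open>ennreal\<close>, \<open>1 / 0\<close> is infinite.
\<close>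

definition time_scale :: "nat \<Rightarrow> nat \<Rightarrow> real \<Rightarrow> real \<Rightarrow> real \<Rightarrow> ennreal" where
  "time_scale n q \<epsilon> \<delta> \<theta> =
     of_nat n + of_nat q + 1 / ennreal \<epsilon> + 1 / ennreal \<delta> + 1 / ennreal \<theta>"

end

theory Submission
  imports Defs "HOL-Analysis.Convex"
begin

inductive_cases exec_SEQ_E: "exec (SEQ p p') s s' gs ws t"
inductive_cases exec_COND_E: "exec (COND i p p') s s' gs ws t"
inductive_cases exec_WHILE_E: "exec (WHILE i p) s s' gs ws t"

text \<open>
  The decoder of the outer code is run with every query replaced by a circuit that queries the
  given oracle \<open>O\<close> for the concatenated code; the helper qubits of the circuit become part of the
  ancillas of the simulated oracle. On outer index \<open>r\<close> the circuit prepares the uniform superposition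
  over the inner index \<open>s\<close> and over a multiplier \<open>k \<noteq> 0\<close> modulo \<open>q\<close>, queries \<open>O\<close>, multiplies by the
  phase \<open>\<omega>^(k * z)\<close> for the symbol \<open>z\<close> that \<open>O\<close> returned, queries the inverse of \<open>O\<close>, and applies the
  quantum Fourier transform to \<open>s\<close>. If \<open>z\<close> is the Hadamard codeword of \<open>y\<close>, the register \<open>s\<close> then
  holds \<open>-k * y\<close>; a lookup table adds the corresponding \<open>y\<close> to the symbol qubits. Neither \<open>k\<close> nor
  the table is uncomputed, since the ancilla states of a corrupted codeword are arbitrary.

  Projected onto the initial ancilla state, the amplitude of \<open>y\<close> averaged over \<open>k \<noteq> 0\<close> is
  \<open>(q * p - 1) / (q - 1)\<close>, where \<open>p\<close> is the average over \<open>s\<close> of the probability that \<open>O\<close> answers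
  \<open>(r, s)\<close> in accordance with \<open>y\<close>. By Cauchy-Schwarz over \<open>r\<close> and \<open>k\<close>, presence at least
  \<open>1 / q + \<epsilon>\<close> in \<open>O\<close> yields presence at least \<open>(q * \<epsilon> / (q - 1))^2 \<ge> 1 / M + \<epsilon>'\<close> in the simulated
  oracle. An inverse query runs the circuit backwards; every gate has finite order, so its inverse
  is one of its powers.
\<close>

section \<open>Programs and running time\<close>

text \<open>The uniform choice of \<open>k \<noteq> 0\<close> is what turns phases into
  probabilities. Summed over the nontrivial characters of the integers modulo \<open>q\<close>, a
  correct symbol contributes \<open>q - 1\<close> and every wrong one \<open>-1\<close>, which is
  the origin of \<open>(q * p - 1) / (q - 1)\<close>; with a single multiplier the wrong symbols
  would contribute with uncontrolled phases. The branches of different \<open>k\<close> stay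
  orthogonal because the ancillas keep \<open>k\<close>, so their probabilities add. The outer
  decoder accepts only a genuine corrupted codeword: a unitary that preserves the index and acts on
  the symbol by XOR. Nothing is known about \<open>O\<close> on unclean ancillas, so these two
  properties are not derived from \<open>O\<close> but built into the shape of the circuit: index
  qubits are only controls, symbol qubits only targets. The table works on each of the
  \<open>m\<close> digits separately, with \<open>m * (q - 1) * q\<close> entries in place of one
  for each of the \<open>q ^ m\<close> field elements; this keeps all added work polynomial in
  \<open>n\<close> and \<open>q\<close>.\<close>

lemma exec_deterministic:
  assumes "exec p s s' gs ws t" and "exec p s s'' gs' ws' t'"
  shows "s'' = s' \<and> gs' = gs \<and> ws' = ws \<and> t' = t"
  using assms
proof (induction arbitrary: s'' gs' ws' t' rule: exec.induct)
  case (exec_SEQ p s s1 gs1 ws1 t1 p' s2 gs2 ws2 t2)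
  from exec_SEQ.prems show ?case
    by (rule exec_SEQ_E) (metis exec_SEQ.IH)
next
  case (exec_COND_nonzero s i p s' gs ws t p')
  from exec_COND_nonzero.prems show ?case
    by (rule exec_COND_E) (use exec_COND_nonzero.hyps(1) in \<open>auto dest: exec_COND_nonzero.IH\<close>)
next
  case (exec_COND_zero s i p' s' gs ws t p)
  from exec_COND_zero.prems show ?case
    by (rule exec_COND_E) (use exec_COND_zero.hyps(1) in \<open>auto dest: exec_COND_zero.IH\<close>)
next
  case (exec_WHILE_stop s i p)
  from exec_WHILE_stop.prems show ?case
    by (rule exec_WHILE_E) (use exec_WHILE_stop.hyps in simp_all)
next
  case (exec_WHILE_step s i p s1 gs1 ws1 t1 s2 gs2 ws2 t2)
  from exec_WHILE_step.prems show ?case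
    by (rule exec_WHILE_E) (metis exec_WHILE_step.IH exec_WHILE_step.hyps(1))+
qed (erule exec.cases; simp)+

text \<open>Bounds the number of passes that the inversion of a program makes over it.\<close>

lemma exec_length_gates: "exec p s s' gs ws t \<Longrightarrow> length gs \<le> t"
  by (induction rule: exec.induct) auto

fun written :: "program \<Rightarrow> nat set" where
  "written (SET i c) = {i}"
| "written (ADD i j k) = {i}"
| "written (SUB i j k) = {i}"
| "written (HALF i j) = {i}"
| "written (SEQ p p') = written p \<union> written p'"
| "written (COND i p p') = written p \<union> written p'"
| "written (WHILE i p) = written p"
| "written (EMIT g) = {}"
| "written (OUTPUT w) = {}"

lemma exec_unwritten: "exec p s s' gs ws t \<Longrightarrow> i \<notin> written p \<Longrightarrow> s' i = s i"
  by (induction rule: exec.induct) auto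

text \<open>There is no skip instruction; a write to register 37, which the programs built from
  \<open>SEQs []\<close> never read, takes its place.\<close>

fun SEQs :: "program list \<Rightarrow> program" where
  "SEQs [] = SET 37 0"
| "SEQs [p] = p"
| "SEQs (p # ps) = SEQ p (SEQs ps)"

text \<open>Total correctness with a time bound. The emitted list belongs to the triple, not to the
  state, so every value on which the gates depend has to be pinned by \<open>A\<close>. Outputs are
  excluded, since only the simulated decoder names output qubits.\<close>

definition hoare ::
  "nat \<Rightarrow> ((nat \<Rightarrow> nat) \<Rightarrow> bool) \<Rightarrow> program \<Rightarrow> nat gate list \<Rightarrow> ((nat \<Rightarrow> nat) \<Rightarrow> bool) \<Rightarrow> bool" where
  "hoare T A p gs B \<longleftrightarrow>
     (\<forall>s. A s \<longrightarrow> (\<exists>s' t. exec p s s' gs [] t \<and> t \<le> T \<and> B s'))"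

lemma hoareE:
  assumes "hoare T A p gs B" "A s"
  obtains s' t where "exec p s s' gs [] t" "t \<le> T" "B s'"
  using assms unfolding hoare_def by blast

lemma hoare_conseq:
  assumes "hoare T A p gs B" "\<And>s. A' s \<Longrightarrow> A s" "\<And>s. B s \<Longrightarrow> B' s" "T \<le> T'" "gs = gs'"
  shows "hoare T' A' p gs' B'"
  using assms unfolding hoare_def by (meson le_trans)

lemma hoare_SEQ:
  assumes "hoare T A p gs B" "hoare T' B p' gs' D"
  shows "hoare (T + T') A (SEQ p p') (gs @ gs') D"
  unfolding hoare_def
proof (intro allI impI)
  fix s assume "A s"
  obtain s1 t1 where 1: "exec p s s1 gs [] t1" "t1 \<le> T" "B s1"
    using assms(1) \<open>A s\<close> by (rule hoareE)
  obtain s2 t2 where 2: "exec p' s1 s2 gs' [] t2" "t2 \<le> T'" "D s2"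
    using assms(2) 1(3) by (rule hoareE)
  have "exec (SEQ p p') s s2 (gs @ gs') ([] @ []) (t1 + t2)"
    using 1 2 by (blast intro: exec_SEQ)
  then show "\<exists>s' t. exec (SEQ p p') s s' (gs @ gs') [] t \<and> t \<le> T + T' \<and> D s'"
    using 1 2 by (metis add_mono append_Nil)
qed

lemma hoare_COND:
  assumes "\<And>s. A s \<Longrightarrow> (s i \<noteq> 0) = b"
    and "b \<Longrightarrow> hoare T A p gs B" and "\<not> b \<Longrightarrow> hoare T A p' gs' B"
  shows "hoare (Suc T) A (COND i p p') (if b then gs else gs') B"
  unfolding hoare_def
proof (intro allI impI)
  fix s assume "A s"
  show "\<exists>s' t. exec (COND i p p') s s' (if b then gs else gs') [] t \<and> t \<le> Suc T \<and> B s'"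
  proof (cases b)
    case True
    then obtain s' t where "exec p s s' gs [] t" "t \<le> T" "B s'"
      using assms(2) \<open>A s\<close> hoareE by metis
    then show ?thesis
      using True assms(1)[OF \<open>A s\<close>] by (metis exec_COND_nonzero Suc_le_mono)
  next
    case False
    then obtain s' t where "exec p' s s' gs' [] t" "t \<le> T" "B s'"
      using assms(3) \<open>A s\<close> hoareE by metis
    then show ?thesis
      using False assms(1)[OF \<open>A s\<close>] by (metis exec_COND_zero Suc_le_mono)
  qed
qed

text \<open>Induction on the number \<open>k\<close> of iterations still to come, hence an invariant
  at \<open>N - k\<close>. Every iteration costs one step beyond its body, and the failing test at
  the end costs one more.\<close>

lemma exec_WHILE_iterate:
  assumes "\<And>i. i < N \<Longrightarrow> hoare T (I i) p (gs i) (I (Suc i))"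
    and "\<And>i s. i < N \<Longrightarrow> I i s \<Longrightarrow> s c \<noteq> 0" and "\<And>s. I N s \<Longrightarrow> s c = 0"
    and "k \<le> N" and "I (N - k) s"
  shows "\<exists>s' t. exec (WHILE c p) s s' (concat (map gs [N - k..<N])) [] t \<and>
           t \<le> 1 + k * (T + 1) \<and> I N s'"
  using assms(4,5)
proof (induction k arbitrary: s)
  case 0
  then show ?case using exec_WHILE_stop[of s c p] assms(3) by auto
next
  case (Suc k)
  let ?i = "N - Suc k"
  have i: "?i < N" "Suc ?i = N - k" using Suc.prems by auto
  obtain s1 t1 where 1: "exec p s s1 (gs ?i) [] t1" "t1 \<le> T" "I (N - k) s1"
    using assms(1)[OF i(1)] Suc.prems(2) i(2) hoareE by metis
  obtain s2 t2 where 2: "exec (WHILE c p) s1 s2 (concat (map gs [N - k..<N])) [] t2"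
      "t2 \<le> 1 + k * (T + 1)" "I N s2"
    using Suc.IH 1(3) Suc.prems(1) Suc_leD by blast
  have "[?i..<N] = ?i # [N - k..<N]" using i by (metis upt_conv_Cons)
  moreover have "exec (WHILE c p) s s2 (gs ?i @ concat (map gs [N - k..<N])) ([] @ []) (Suc (t1 + t2))"
    using exec_WHILE_step[OF _ 1(1) 2(1)] assms(2)[OF i(1) Suc.prems(2)] by simp
  ultimately have "exec (WHILE c p) s s2 (concat (map gs [?i..<N])) [] (Suc (t1 + t2))"
    by simp
  moreover have "Suc (t1 + t2) \<le> 1 + Suc k * (T + 1)" using 1 2 by simp
  ultimately show ?case using 2 by blast
qed

lemma hoare_WHILE:
  assumes "\<And>i. i < N \<Longrightarrow> hoare T (I i) p (gs i) (I (Suc i))"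
    and "\<And>i s. i < N \<Longrightarrow> I i s \<Longrightarrow> s c \<noteq> 0" and "\<And>s. I N s \<Longrightarrow> s c = 0" and "N \<le> X"
  shows "hoare (1 + X * (T + 1)) (I 0) (WHILE c p) (concat (map gs [0..<N])) (I N)"
  unfolding hoare_def
proof (intro allI impI)
  fix s assume "I 0 s"
  then have "\<exists>s' t. exec (WHILE c p) s s' (concat (map gs [N - N..<N])) [] t \<and>
      t \<le> 1 + N * (T + 1) \<and> I N s'"
    by (intro exec_WHILE_iterate[where I = I] assms) auto
  moreover have "1 + N * (T + 1) \<le> 1 + X * (T + 1)"
    using mult_le_mono1[OF assms(4)] by (rule add_left_mono)
  ultimately show "\<exists>s' t. exec (WHILE c p) s s' (concat (map gs [0..<N])) [] t \<and>
      t \<le> 1 + X * (T + 1) \<and> I N s'"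
    by (metis diff_self_eq_0 le_trans)
qed

fun basic :: "program \<Rightarrow> bool" where
  "basic (SEQ p p') = False"
| "basic (COND i p p') = False"
| "basic (WHILE i p) = False"
| "basic (OUTPUT w) = False"
| "basic _ = True"

fun basic_step :: "program \<Rightarrow> (nat \<Rightarrow> nat) \<Rightarrow> (nat \<Rightarrow> nat)" where
  "basic_step (SET i c) s = s(i := c)"
| "basic_step (ADD i j k) s = s(i := s j + s k)"
| "basic_step (SUB i j k) s = s(i := s j - s k)"
| "basic_step (HALF i j) s = s(i := s j div 2)"
| "basic_step _ s = s"

fun basic_gates :: "program list \<Rightarrow> (nat \<Rightarrow> nat) \<Rightarrow> nat gate list" where
  "basic_gates [] s = []"
| "basic_gates (EMIT g # ps) s = map_gate s g # basic_gates ps s"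
| "basic_gates (p # ps) s = basic_gates ps (basic_step p s)"

lemma exec_basic: "basic p \<Longrightarrow> exec p s (basic_step p s) (basic_gates [p] s) [] 1"
  unfolding One_nat_def by (cases p) (auto intro: exec.intros[unfolded One_nat_def])

lemma basic_gates_Cons: "basic_gates (p # ps) s = basic_gates [p] s @ basic_gates ps (basic_step p s)"
  by (cases p) auto

lemma exec_basics:
  "ps \<noteq> [] \<Longrightarrow> \<forall>p \<in> set ps. basic p \<Longrightarrow>
     exec (SEQs ps) s (fold basic_step ps s) (basic_gates ps s) [] (length ps)"
proof (induction ps arbitrary: s rule: SEQs.induct)
  case (3 p p' ps)
  have "exec (SEQ p (SEQs (p' # ps))) s (fold basic_step (p' # ps) (basic_step p s))
     (basic_gates [p] s @ basic_gates (p' # ps) (basic_step p s)) ([] @ []) (1 + length (p' # ps))"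
  proof (rule exec_SEQ)
    show "exec p s (basic_step p s) (basic_gates [p] s) [] 1"
      using 3 by (intro exec_basic) simp
  qed (use 3 in simp)
  then show ?case by (simp add: basic_gates_Cons[of p "p' # ps"])
qed (auto dest: exec_basic)

lemma hoare_basics:
  assumes "ps \<noteq> []" "\<forall>p \<in> set ps. basic p"
    and "\<And>s. A s \<Longrightarrow> basic_gates ps s = gs \<and> B (fold basic_step ps s)"
  shows "hoare (length ps) A (SEQs ps) gs B"
  unfolding hoare_def using exec_basics[OF assms(1,2)] assms(3) by (metis order_refl)

lemma hoare_basics_le:
  assumes "\<And>s. A s \<Longrightarrow> basic_gates ps s = gs \<and> B (fold basic_step ps s)"
    and "ps \<noteq> []" "\<forall>p \<in> set ps. basic p" "length ps \<le> T"
  shows "hoare T A (SEQs ps) gs B"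
  using hoare_conseq[OF hoare_basics[OF assms(2,3), of A gs B] _ _ assms(4)] assms(1) by blast

lemma hoare_SEQ_le:
  assumes "hoare T A p gs B" "hoare T' B p' gs' D" "T + T' \<le> S" "hs = gs @ gs'"
  shows "hoare S A (SEQ p p') hs D"
  using hoare_conseq[OF hoare_SEQ[OF assms(1,2)] _ _ assms(3)] assms(4) by blast

lemma hoare_WHILE_le:
  assumes "\<And>i. i < N \<Longrightarrow> hoare T (I i) p (gs i) (I (Suc i))"
    and "\<And>s. A s \<Longrightarrow> I 0 s" and "\<And>s. I N s \<Longrightarrow> B s"
    and "\<And>i s. i < N \<Longrightarrow> I i s \<Longrightarrow> s c \<noteq> 0" and "\<And>s. I N s \<Longrightarrow> s c = 0" and "N \<le> X"
    and "1 + X * (T + 1) \<le> S" and "hs = concat (map gs [0..<N])"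
  shows "hoare S A (WHILE c p) hs B"
  by (rule hoare_conseq[OF hoare_WHILE[where I = I and gs = gs and N = N and T = T and X = X]])
    (use assms in auto)

section \<open>Polynomial bounds on running times\<close>

definition poly_bounded :: "(nat \<Rightarrow> nat) \<Rightarrow> bool" where
  "poly_bounded T \<longleftrightarrow> (\<exists>c k. \<forall>X\<ge>1. T X \<le> c * X ^ k)"

lemma poly_bounded_const [intro, simp]: "poly_bounded (\<lambda>X. c)"
  unfolding poly_bounded_def by (rule exI[of _ c], rule exI[of _ 0]) simp

lemma poly_bounded_id [intro, simp]: "poly_bounded (\<lambda>X. X)"
  unfolding poly_bounded_def by (rule exI[of _ 1], rule exI[of _ 1]) simp

text \<open>Both bounds are raised to the common exponent \<open>k + l\<close>; this is where
  \<open>X \<ge> 1\<close> enters.\<close>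

lemma poly_bounded_add [intro]:
  assumes "poly_bounded S" "poly_bounded T"
  shows "poly_bounded (\<lambda>X. S X + T X)"
proof -
  obtain c k d l where *: "\<forall>X\<ge>1. S X \<le> c * X ^ k" "\<forall>X\<ge>1. T X \<le> d * X ^ l"
    using assms unfolding poly_bounded_def by blast
  have "S X + T X \<le> (c + d) * X ^ (k + l)" if "X \<ge> 1" for X
  proof -
    have "X ^ k \<le> X ^ (k + l)" "X ^ l \<le> X ^ (k + l)" using that by (auto intro: power_increasing)
    then have "c * X ^ k \<le> c * X ^ (k + l)" "d * X ^ l \<le> d * X ^ (k + l)" by simp_all
    then show ?thesis using *(1)[rule_format, OF that] *(2)[rule_format, OF that]
      unfolding distrib_right by linarith
  qed
  then show ?thesis unfolding poly_bounded_def by blast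
qed

lemma poly_bounded_mult [intro]:
  assumes "poly_bounded S" "poly_bounded T"
  shows "poly_bounded (\<lambda>X. S X * T X)"
proof -
  obtain c k d l where *: "\<forall>X\<ge>1. S X \<le> c * X ^ k" "\<forall>X\<ge>1. T X \<le> d * X ^ l"
    using assms unfolding poly_bounded_def by blast
  have "S X * T X \<le> (c * d) * X ^ (k + l)" if "X \<ge> 1" for X
  proof -
    have "S X * T X \<le> (c * X ^ k) * (d * X ^ l)" using * that by (intro mult_mono) auto
    then show ?thesis by (simp add: power_add algebra_simps)
  qed
  then show ?thesis unfolding poly_bounded_def by blast
qed

text \<open>The registers below \<open>d\<close> are free for use by the programs \<open>f g\<close>.\<close>

fun translate :: "nat \<Rightarrow> (nat gate \<Rightarrow> program) \<Rightarrow> program \<Rightarrow> program" where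
  "translate d f (SET i c) = SET (i + d) c"
| "translate d f (ADD i j k) = ADD (i + d) (j + d) (k + d)"
| "translate d f (SUB i j k) = SUB (i + d) (j + d) (k + d)"
| "translate d f (HALF i j) = HALF (i + d) (j + d)"
| "translate d f (SEQ p p') = SEQ (translate d f p) (translate d f p')"
| "translate d f (COND i p p') = COND (i + d) (translate d f p) (translate d f p')"
| "translate d f (WHILE i p) = WHILE (i + d) (translate d f p)"
| "translate d f (EMIT g) = f (map_gate (\<lambda>i. i + d) g)"
| "translate d f (OUTPUT w) = OUTPUT (fst w + d, snd w + d)"

text \<open>\<open>\<gamma>\<close> is a state carried from one replaced emission to the next.
  Direct simulation needs none; inverting a circuit uses it as a counter, because there the
  replacement of an emission depends on its position.\<close>

fun emissions :: "('c \<Rightarrow> nat gate \<Rightarrow> nat gate list) \<Rightarrow> ('c \<Rightarrow> 'c) \<Rightarrow> 'c \<Rightarrow> nat gate list \<Rightarrow> nat gate list"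
  where
  "emissions out nx \<gamma> [] = []"
| "emissions out nx \<gamma> (g # gs) = out \<gamma> g @ emissions out nx (nx \<gamma>) gs"

lemma emissions_append:
  "emissions out nx \<gamma> (gs @ gs') =
     emissions out nx \<gamma> gs @ emissions out nx ((nx ^^ length gs) \<gamma>) gs'"
  by (induction gs arbitrary: \<gamma>) (auto simp: funpow_swap1)

text \<open>Lock-step simulation: \<open>J\<close> survives all writes to registers from
  \<open>d\<close> on, and each program \<open>f g\<close> returns those registers as it found them.
  Hence every step of \<open>p\<close> costs at most \<open>T\<close>.\<close>

lemma exec_translate:
  assumes "exec p s s' gs ws t"
    and "\<And>\<gamma> s i v. J \<gamma> s \<Longrightarrow> i \<ge> d \<Longrightarrow> J \<gamma> (s(i := v))"
    and "\<And>\<gamma> s g. J \<gamma> s \<Longrightarrow> ok (map_gate (\<lambda>i. s (i + d)) g) \<Longrightarrow>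
           \<exists>s' t. exec (f (map_gate (\<lambda>i. i + d) g)) s s' (out \<gamma> (map_gate (\<lambda>i. s (i + d)) g)) [] t \<and>
             t \<le> T \<and> J (nx \<gamma>) s' \<and> (\<forall>i\<ge>d. s' i = s i)"
    and "T \<ge> 1" and "\<forall>g \<in> set gs. ok g" and "J \<gamma> r" and "\<forall>i. r (i + d) = s i"
  shows "\<exists>r' t'. exec (translate d f p) r r' (emissions out nx \<gamma> gs) ws t' \<and> t' \<le> t * T \<and>
           J ((nx ^^ length gs) \<gamma>) r' \<and> (\<forall>i. r' (i + d) = s' i)"
  using assms(1,5,6,7)
proof (induction arbitrary: r \<gamma> rule: exec.induct)
  case (exec_SET i c s)
  have "exec (translate d f (SET i c)) r (r(i + d := c)) [] [] 1"
    using exec.exec_SET[of "i + d" c r] exec_SET.prems by (simp only: translate.simps)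
  moreover have "J \<gamma> (r(i + d := c))" using exec_SET.prems assms(2) by simp
  ultimately show ?case
    using exec_SET.prems assms(4) by (intro exI conjI) (auto simp: fun_upd_def)
next
  case (exec_ADD i j k s)
  have "exec (translate d f (ADD i j k)) r (r(i + d := s j + s k)) [] [] 1"
    using exec.exec_ADD[of "i + d" "j + d" "k + d" r] exec_ADD.prems by (simp only: translate.simps)
  moreover have "J \<gamma> (r(i + d := s j + s k))" using exec_ADD.prems assms(2) by simp
  ultimately show ?case
    using exec_ADD.prems assms(4) by (intro exI conjI) (auto simp: fun_upd_def)
next
  case (exec_SUB i j k s)
  have "exec (translate d f (SUB i j k)) r (r(i + d := s j - s k)) [] [] 1"
    using exec.exec_SUB[of "i + d" "j + d" "k + d" r] exec_SUB.prems by (simp only: translate.simps)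
  moreover have "J \<gamma> (r(i + d := s j - s k))" using exec_SUB.prems assms(2) by simp
  ultimately show ?case
    using exec_SUB.prems assms(4) by (intro exI conjI) (auto simp: fun_upd_def)
next
  case (exec_HALF i j s)
  have "exec (translate d f (HALF i j)) r (r(i + d := s j div 2)) [] [] 1"
    using exec.exec_HALF[of "i + d" "j + d" r] exec_HALF.prems by (simp only: translate.simps)
  moreover have "J \<gamma> (r(i + d := s j div 2))" using exec_HALF.prems assms(2) by simp
  ultimately show ?case
    using exec_HALF.prems assms(4) by (intro exI conjI) (auto simp: fun_upd_def)
next
  case (exec_SEQ p s s1 gs1 ws1 t1 p' s2 gs2 ws2 t2)
  obtain r1 u1 where 1: "exec (translate d f p) r r1 (emissions out nx \<gamma> gs1) ws1 u1"
      "u1 \<le> t1 * T" "J ((nx ^^ length gs1) \<gamma>) r1" "\<forall>i. r1 (i + d) = s1 i"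
    using exec_SEQ.IH(1)[of \<gamma> r] exec_SEQ.prems by auto
  obtain r2 u2 where 2: "exec (translate d f p') r1 r2
        (emissions out nx ((nx ^^ length gs1) \<gamma>) gs2) ws2 u2"
      "u2 \<le> t2 * T" "J ((nx ^^ length gs2) ((nx ^^ length gs1) \<gamma>)) r2" "\<forall>i. r2 (i + d) = s2 i"
    using exec_SEQ.IH(2)[of "(nx ^^ length gs1) \<gamma>" r1] exec_SEQ.prems 1 by auto
  have "(nx ^^ length gs2) ((nx ^^ length gs1) \<gamma>) = (nx ^^ length (gs1 @ gs2)) \<gamma>"
    by (simp add: funpow_add add.commute[of "length gs1"])
  then show ?case
    using exec.exec_SEQ[OF 1(1) 2(1)] 1 2
    by (intro exI[of _ r2] exI[of _ "u1 + u2"]) (auto simp: emissions_append algebra_simps)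
next
  case (exec_COND_nonzero s i p s' gs ws t p')
  obtain r1 u1 where 1: "exec (translate d f p) r r1 (emissions out nx \<gamma> gs) ws u1"
      "u1 \<le> t * T" "J ((nx ^^ length gs) \<gamma>) r1" "\<forall>i. r1 (i + d) = s' i"
    using exec_COND_nonzero.IH[of \<gamma> r] exec_COND_nonzero.prems by auto
  have "exec (translate d f (COND i p p')) r r1 (emissions out nx \<gamma> gs) ws (Suc u1)"
    using exec_COND_nonzero 1 by (auto intro!: exec.exec_COND_nonzero)
  then show ?case
    using 1 assms(4) by (intro exI[of _ r1] exI[of _ "Suc u1"]) auto
next
  case (exec_COND_zero s i p' s' gs ws t p)
  obtain r1 u1 where 1: "exec (translate d f p') r r1 (emissions out nx \<gamma> gs) ws u1"
      "u1 \<le> t * T" "J ((nx ^^ length gs) \<gamma>) r1" "\<forall>i. r1 (i + d) = s' i"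
    using exec_COND_zero.IH[of \<gamma> r] exec_COND_zero.prems by auto
  have "exec (translate d f (COND i p p')) r r1 (emissions out nx \<gamma> gs) ws (Suc u1)"
    using exec_COND_zero 1 by (auto intro!: exec.exec_COND_zero)
  then show ?case
    using 1 assms(4) by (intro exI[of _ r1] exI[of _ "Suc u1"]) auto
next
  case (exec_WHILE_stop s i p)
  then show ?case
    using exec.exec_WHILE_stop[of r "i + d" "translate d f p"] assms(4)
    by (intro exI[of _ r] exI[of _ 1]) auto
next
  case (exec_WHILE_step s i p s1 gs1 ws1 t1 s2 gs2 ws2 t2)
  obtain r1 u1 where 1: "exec (translate d f p) r r1 (emissions out nx \<gamma> gs1) ws1 u1"
      "u1 \<le> t1 * T" "J ((nx ^^ length gs1) \<gamma>) r1" "\<forall>i. r1 (i + d) = s1 i"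
    using exec_WHILE_step.IH(1)[of \<gamma> r] exec_WHILE_step.prems by auto
  obtain r2 u2 where 2: "exec (translate d f (WHILE i p)) r1 r2
        (emissions out nx ((nx ^^ length gs1) \<gamma>) gs2) ws2 u2"
      "u2 \<le> t2 * T" "J ((nx ^^ length gs2) ((nx ^^ length gs1) \<gamma>)) r2" "\<forall>i. r2 (i + d) = s2 i"
    using exec_WHILE_step.IH(2)[of "(nx ^^ length gs1) \<gamma>" r1] exec_WHILE_step.prems 1 by auto
  have "(nx ^^ length gs2) ((nx ^^ length gs1) \<gamma>) = (nx ^^ length (gs1 @ gs2)) \<gamma>"
    by (simp add: funpow_add add.commute[of "length gs1"])
  moreover have "exec (translate d f (WHILE i p)) r r2 (emissions out nx \<gamma> (gs1 @ gs2)) (ws1 @ ws2)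
      (Suc (u1 + u2))"
    using exec.exec_WHILE_step[OF _ 1(1) 2(1)[simplified]] exec_WHILE_step.hyps exec_WHILE_step.prems
    by (simp add: emissions_append)
  ultimately show ?case
    using 1 2 assms(4)
    by (intro exI[of _ r2] exI[of _ "Suc (u1 + u2)"]) (auto simp: algebra_simps)
next
  case (exec_EMIT g s)
  have *: "map_gate (\<lambda>i. r (i + d)) g = map_gate s g"
    using exec_EMIT.prems(3) by simp
  obtain r' t where "exec (f (map_gate (\<lambda>i. i + d) g)) r r' (out \<gamma> (map_gate s g)) [] t"
      "t \<le> T" "J (nx \<gamma>) r'" "\<forall>i\<ge>d. r' i = r i"
    using assms(3)[OF exec_EMIT.prems(2), of g] exec_EMIT.prems
    unfolding * by auto
  then show ?case
    using exec_EMIT.prems(3) by (intro exI[of _ r'] exI[of _ t]) auto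
next
  case (exec_OUTPUT i j s)
  then show ?case
    using exec.exec_OUTPUT[of "i + d" "j + d" r] assms(4)
    by (intro exI[of _ r] exI[of _ 1]) auto
qed

lemma hoare_translate:
  assumes "hoare T A p gs B"
    and "\<And>\<gamma> s i v. J \<gamma> s \<Longrightarrow> i \<ge> d \<Longrightarrow> J \<gamma> (s(i := v))"
    and "\<And>\<gamma> s g. J \<gamma> s \<Longrightarrow> ok (map_gate (\<lambda>i. s (i + d)) g) \<Longrightarrow>
           \<exists>s' t. exec (f (map_gate (\<lambda>i. i + d) g)) s s' (out \<gamma> (map_gate (\<lambda>i. s (i + d)) g)) [] t \<and>
             t \<le> S \<and> J (nx \<gamma>) s' \<and> (\<forall>i\<ge>d. s' i = s i)"
    and "S \<ge> 1" and "\<forall>g \<in> set gs. ok g"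
  shows "hoare (T * S) (\<lambda>s. J \<gamma> s \<and> A (\<lambda>i. s (i + d))) (translate d f p) (emissions out nx \<gamma> gs)
           (\<lambda>s. J ((nx ^^ length gs) \<gamma>) s \<and> B (\<lambda>i. s (i + d)))"
  unfolding hoare_def
proof (intro allI impI)
  fix r assume r: "J \<gamma> r \<and> A (\<lambda>i. r (i + d))"
  then obtain s' t where 1: "exec p (\<lambda>i. r (i + d)) s' gs [] t" "t \<le> T" "B s'"
    using assms(1) hoareE by blast
  obtain r' t' where 2: "exec (translate d f p) r r' (emissions out nx \<gamma> gs) [] t'" "t' \<le> t * S"
      "J ((nx ^^ length gs) \<gamma>) r'" "\<forall>i. r' (i + d) = s' i"
    using exec_translate[OF 1(1), of J d ok f out S nx \<gamma> r] assms(2-5) r by blast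
  have "(\<lambda>i. r' (i + d)) = s'" using 2(4) by auto
  moreover have "t' \<le> T * S" using 2(2) 1(2) by (meson le_trans mult_le_mono1)
  ultimately show "\<exists>s' t. exec (translate d f p) r s' (emissions out nx \<gamma> gs) [] t \<and> t \<le> T * S \<and>
      J ((nx ^^ length gs) \<gamma>) s' \<and> B (\<lambda>i. s' (i + d))"
    using 1 2 by metis
qed

section \<open>The circuit simulating a query\<close>

text \<open>
  The qubits of the circuit are relative: row 0 is the outer index, row 1 the outer symbol and row 2
  the ancilla block. The columns of row 2 are divided into the multiplier (from 0, width \<open>a\<close>), the
  copy of the outer index (from \<open>a\<close>), the inner index (from \<open>col_S\<close>), the inner symbol (from
  \<open>col_T\<close>), the helpers of the table (from \<open>col_H\<close>) and the ancillas of the given oracle (from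
  \<open>col_A\<close>). The latter come last because their number is unknown to the program.
\<close>

definition col_S :: "nat \<Rightarrow> nat \<Rightarrow> nat \<Rightarrow> nat" where
  "col_S m w a = a + m * w"

definition col_T :: "nat \<Rightarrow> nat \<Rightarrow> nat \<Rightarrow> nat" where
  "col_T m w a = col_S m w a + m * w"

definition col_H :: "nat \<Rightarrow> nat \<Rightarrow> nat \<Rightarrow> nat" where
  "col_H m w a = col_T m w a + w"

text \<open>There is one table entry for each digit position, each multiplier and each digit value.
  An entry takes one start helper and one helper per compared bit, \<open>a\<close> for the
  multiplier and \<open>w\<close> for the digit.\<close>

definition helpers :: "nat \<Rightarrow> nat \<Rightarrow> nat \<Rightarrow> nat \<Rightarrow> nat" where
  "helpers m q w a = m * ((q - 1) * (q * (w + a + 1)))"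

definition col_A :: "nat \<Rightarrow> nat \<Rightarrow> nat \<Rightarrow> nat \<Rightarrow> nat" where
  "col_A m q w a = col_H m w a + helpers m q w a"

text \<open>
  Helper \<open>h + i\<close> records whether the first \<open>i\<close> bits agree with those of \<open>v\<close>. Every table entry has
  its own helpers, so that none of them needs to be reset.
\<close>

definition match_chain :: "nat \<Rightarrow> nat \<Rightarrow> nat \<Rightarrow> nat \<Rightarrow> nat gate list" where
  "match_chain h x n v = concat (map (\<lambda>i.
     Toffoli (2, h + i) (2, x + i) (2, h + Suc i) #
       (if bit v i then [] else [CNOT (2, h + i) (2, h + Suc i)])) [0..<n])"

definition xor_out :: "nat \<Rightarrow> nat \<Rightarrow> nat \<Rightarrow> nat \<Rightarrow> nat gate list" where
  "xor_out h x n v = concat (map (\<lambda>i. if bit v i then [CNOT (2, h) (1, x + i)] else []) [0..<n])"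

text \<open>Entries are numbered in mixed radix with \<open>y\<close> running fastest, so that
  blocks of distinct entries are disjoint and the program emitting the table only ever advances its
  helper pointer.\<close>

definition helper_base :: "nat \<Rightarrow> nat \<Rightarrow> nat \<Rightarrow> nat \<Rightarrow> nat \<Rightarrow> nat \<Rightarrow> nat \<Rightarrow> nat" where
  "helper_base m q w a j k y = col_H m w a + ((j * (q - 1) + k) * q + y) * (w + a + 1)"

text \<open>\<open>q - 1 - k\<close> is \<open>-(k + 1)\<close> modulo \<open>q\<close>, so the
  entry fires iff the multiplier qubits hold \<open>k\<close> and digit \<open>j\<close> of the
  transformed inner index is the one produced by \<open>y\<close>. The second chain starts at the
  last helper of the first, which makes the final helper the conjunction of both
  comparisons.\<close>

definition table_entry :: "nat \<Rightarrow> nat \<Rightarrow> nat \<Rightarrow> nat \<Rightarrow> nat \<Rightarrow> nat \<Rightarrow> nat \<Rightarrow> nat gate list" where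
  "table_entry m q w a j k y =
     (let h = helper_base m q w a j k y in
      NOT (2, h) # match_chain h 0 a k
        @ match_chain (h + a) (col_S m w a + j * w) w ((q - 1 - k) * y mod q)
        @ xor_out (h + a + w) (j * w) w y)"

definition fourier_layer :: "nat \<Rightarrow> nat \<Rightarrow> nat \<Rightarrow> nat \<Rightarrow> nat gate list" where
  "fourier_layer m q w a = map (\<lambda>j. QFT q (2, col_S m w a + j * w)) [0..<m]"

text \<open>Querying a copy protects the index. The inverse query meets a state altered by the
  phases, which may overlap with images of unclean ancillas; nothing is known about these, and the
  index qubits of the query may come back changed.\<close>

definition copy_index :: "nat \<Rightarrow> nat \<Rightarrow> nat \<Rightarrow> nat gate list" where
  "copy_index m w a = map (\<lambda>i. CNOT (0, i) (2, a + i)) [0..<m * w]"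

text \<open>The value \<open>k\<close> of the multiplier qubits stands for the nonzero multiplier \<open>k + 1\<close>.\<close>

definition phase_layer :: "nat \<Rightarrow> nat \<Rightarrow> nat \<Rightarrow> nat \<Rightarrow> nat gate list" where
  "phase_layer m q w a = map (\<lambda>b. Phase (2 ^ b) q (2, col_T m w a + b)) [0..<w]
     @ concat (map (\<lambda>i. map (\<lambda>b. CPhase (2 ^ (i + b)) q (2, i) (2, col_T m w a + b)) [0..<w]) [0..<a])"

definition table :: "nat \<Rightarrow> nat \<Rightarrow> nat \<Rightarrow> nat \<Rightarrow> nat gate list" where
  "table m q w a = concat (map (\<lambda>j. concat (map (\<lambda>k. concat (map (\<lambda>y.
     table_entry m q w a j k y) [0..<q])) [0..<q - 1])) [0..<m])"

definition query_circuit :: "nat \<Rightarrow> nat \<Rightarrow> nat \<Rightarrow> nat \<Rightarrow> nat gate list" where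
  "query_circuit m q w a =
     QFT (q - 1) (2, 0) # fourier_layer m q w a @ copy_index m w a
       @ [Query (2, a) (2, col_T m w a) (2, col_A m q w a)]
       @ phase_layer m q w a
       @ [QueryInv (2, a) (2, col_T m w a) (2, col_A m q w a)]
       @ fourier_layer m q w a @ table m q w a"

fun relocate :: "(qubit \<Rightarrow> qubit) \<Rightarrow> nat gate \<Rightarrow> nat gate" where
  "relocate f (NOT u) = NOT (f u)"
| "relocate f (CNOT u v) = CNOT (f u) (f v)"
| "relocate f (Toffoli u v w) = Toffoli (f u) (f v) (f w)"
| "relocate f (Phase a b u) = Phase a b (f u)"
| "relocate f (CPhase a b u v) = CPhase a b (f u) (f v)"
| "relocate f (QFT d u) = QFT d (f u)"
| "relocate f (Query u v w) = Query (f u) (f v) (f w)"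
| "relocate f (QueryInv u v w) = QueryInv (f u) (f v) (f w)"

definition place :: "qubit \<Rightarrow> qubit \<Rightarrow> qubit \<Rightarrow> qubit \<Rightarrow> qubit" where
  "place u v w p = (let b = (if fst p = 0 then u else if fst p = 1 then v else w)
     in (fst b, snd b + snd p))"

lemma place_simps:
  "place u v w (0, i) = (fst u, snd u + i)"
  "place u v w (1, i) = (fst v, snd v + i)"
  "place u v w (Suc 0, i) = (fst v, snd v + i)"
  "place u v w (2, i) = (fst w, snd w + i)"
  by (auto simp: place_def)

section \<open>Register programs that emit the query circuit\<close>

definition fourier_prog :: program where
  "fourier_prog = SEQ (SEQs [ADD 20 2 0, ADD 21 16 0])
     (WHILE 20 (SEQs [EMIT (QFT 3 (13, 21)), ADD 21 21 4, SUB 20 20 1]))"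

definition copy_prog :: program where
  "copy_prog = SEQ (SEQs [ADD 20 6 0, ADD 21 10 0, ADD 22 15 0])
     (WHILE 20 (SEQs [EMIT (CNOT (9, 21) (13, 22)), ADD 21 21 1, ADD 22 22 1, SUB 20 20 1]))"

definition phase_prog :: program where
  "phase_prog = SEQ (SEQs [ADD 20 4 0, ADD 22 17 0, SET 23 1])
     (WHILE 20 (SEQs [EMIT (Phase 23 3 (13, 22)), ADD 23 23 23, ADD 22 22 1, SUB 20 20 1]))"

definition cphase_inner_prog :: program where
  "cphase_inner_prog = WHILE 20 (SEQs [EMIT (CPhase 23 3 (13, 21) (13, 22)),
     ADD 23 23 23, ADD 22 22 1, SUB 20 20 1])"

definition cphase_prog :: program where
  "cphase_prog = SEQ (SEQs [ADD 24 5 0, ADD 21 14 0, SET 25 1])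
     (WHILE 24 (SEQ (SEQs [ADD 20 4 0, ADD 22 17 0, ADD 23 25 0])
       (SEQ cphase_inner_prog
         (SEQs [ADD 25 25 25, ADD 21 21 1, SUB 24 24 1]))))"

text \<open>Register 33 is consumed bit by bit: register 34 gets its half and register 35 its
  parity, as \<open>x - x div 2 - x div 2\<close>. Register 18 points to the current helper and ends
  at the last helper of the chain.\<close>

definition chain_prog :: program where
  "chain_prog = WHILE 20 (SEQ
     (SEQs [ADD 22 18 1, EMIT (Toffoli (13, 18) (13, 21) (13, 22)),
        HALF 34 33, SUB 35 33 34, SUB 35 35 34])
     (SEQ (COND 35 (SEQs []) (EMIT (CNOT (13, 18) (13, 22))))
       (SEQs [ADD 33 34 0, ADD 21 21 1, ADD 18 22 0, SUB 20 20 1])))"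

definition xor_prog :: program where
  "xor_prog = WHILE 20 (SEQ
     (SEQs [HALF 34 33, SUB 35 33 34, SUB 35 35 34])
     (SEQ (COND 35 (EMIT (CNOT (13, 18) (11, 21))) (SEQs []))
       (SEQs [ADD 33 34 0, ADD 21 21 1, SUB 20 20 1])))"

text \<open>Registers 29 and 31 hold \<open>k\<close> and \<open>y\<close>, register 28 holds
  \<open>q - 1 - k\<close>. Register 32 holds \<open>(q - 1 - k) * y mod q\<close>, updated for the
  next \<open>y\<close> by one addition and at most one subtraction of \<open>q\<close>, as the
  machine cannot multiply. Registers 26 and 27 are the columns of digit \<open>j\<close> in the
  inner index and in the symbol.\<close>

definition entry_prog :: program where
  "entry_prog = SEQ (SEQs [EMIT (NOT (13, 18)), ADD 33 29 0, ADD 20 5 0, ADD 21 14 0])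
     (SEQ chain_prog
     (SEQ (SEQs [ADD 33 32 0, ADD 20 4 0, ADD 21 26 0])
     (SEQ chain_prog
     (SEQ (SEQs [ADD 33 31 0, ADD 20 4 0, ADD 21 27 0])
     (SEQ xor_prog
     (SEQ (SEQs [ADD 18 18 1, ADD 31 31 1, ADD 32 32 28, SUB 36 32 8])
     (SEQ (COND 36 (SUB 32 32 3) (SEQs []))
       (SUB 30 30 1))))))))"

text \<open>Register 28 serves twice: as the countdown of the loop over \<open>k\<close> and as the
  factor \<open>q - 1 - k\<close>.\<close>

definition table_prog :: program where
  "table_prog = SEQ (SEQs [ADD 24 2 0, ADD 26 16 0, ADD 27 12 0])
     (WHILE 24 (SEQ (SEQs [ADD 28 8 0, SET 29 0])
       (SEQ (WHILE 28 (SEQ (SEQs [ADD 30 3 0, SET 31 0, SET 32 0])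
           (SEQ (WHILE 30 entry_prog)
             (SEQs [ADD 29 29 1, SUB 28 28 1]))))
         (SEQs [ADD 26 26 4, ADD 27 27 4, SUB 24 24 1]))))"

definition query_prog :: program where
  "query_prog = SEQ (SEQs [ADD 15 14 5, ADD 16 15 6, ADD 17 16 6, ADD 18 17 4, ADD 19 18 7,
       EMIT (QFT 8 (13, 14))])
     (SEQ fourier_prog (SEQ copy_prog (SEQ (EMIT (Query (13, 15) (13, 17) (13, 19)))
     (SEQ phase_prog (SEQ cphase_prog (SEQ (EMIT (QueryInv (13, 15) (13, 17) (13, 19)))
     (SEQ fourier_prog table_prog)))))))"

text \<open>
  Registers 9 to 14 hold the addresses of the blocks that are substituted for rows 0 to 2; the
  registers from 15 on are scratch space.
\<close>

definition sim_env ::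
  "nat \<Rightarrow> nat \<Rightarrow> nat \<Rightarrow> nat \<Rightarrow> qubit \<Rightarrow> qubit \<Rightarrow> qubit \<Rightarrow> (nat \<Rightarrow> nat) \<Rightarrow> bool" where
  "sim_env m q w a u v t s \<longleftrightarrow>
     s 0 = 0 \<and> s 1 = 1 \<and> s 2 = m \<and> s 3 = q \<and> s 4 = w \<and> s 5 = a \<and> s 6 = m * w \<and>
     s 7 = helpers m q w a \<and> s 8 = q - 1 \<and> (s 9, s 10) = u \<and> (s 11, s 12) = v \<and> (s 13, s 14) = t"

section \<open>Correctness and running time of the emitting programs\<close>

locale query_sim =
  fixes m q w a :: nat and u v t :: qubit and X :: nat
  assumes bounds: "m \<le> X" "q \<le> X" "w \<le> X" "a \<le> X" "m * w \<le> X" and q: "q \<ge> 2"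
begin

text \<open>\<open>h\<close> is the position of the helper pointer in register 18; only the table
  moves it, from \<open>col_H\<close> to \<open>col_A\<close>.\<close>

definition env :: "nat \<Rightarrow> (nat \<Rightarrow> nat) \<Rightarrow> bool" where
  "env h s \<longleftrightarrow> s 0 = 0 \<and> s (Suc 0) = 1 \<and> s 2 = m \<and> s 3 = q \<and> s 4 = w \<and> s 5 = a \<and> s 6 = m * w \<and>
     s 7 = helpers m q w a \<and> s 8 = q - 1 \<and>
     s 9 = fst u \<and> s 10 = snd u \<and> s 11 = fst v \<and> s 12 = snd v \<and> s 13 = fst t \<and> s 14 = snd t \<and>
     s 15 = snd t + a \<and> s 16 = snd t + col_S m w a \<and> s 17 = snd t + col_T m w a \<and>
     s 19 = snd t + col_A m q w a \<and> s 18 = snd t + h"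

abbreviation pl where "pl \<equiv> map (relocate (place u v t))"

lemma env_sim_env: "env h s \<Longrightarrow> sim_env m q w a u v t s"
  by (auto simp: env_def sim_env_def)

lemma fourier_prog:
  "hoare (3 + 4 * X) (env h) fourier_prog (pl (fourier_layer m q w a)) (env h)"
  unfolding fourier_prog_def
  apply (rule hoare_SEQ_le[where T = 2 and T' = "1 + X * (3 + 1)"
        and B = "\<lambda>s. env h s \<and> s 20 = m \<and> s 21 = snd t + col_S m w a"])
     apply (rule hoare_basics_le; simp add: env_def)
    apply (rule hoare_WHILE_le[where N = m and X = X and T = 3
        and I = "\<lambda>i s. env h s \<and> s 20 = m - i \<and> s 21 = snd t + (col_S m w a + i * w)"])
           apply (rule hoare_basics_le; simp add: env_def)
          apply (auto simp: bounds fourier_layer_def place_simps comp_def)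
  done

lemma copy_prog:
  "hoare (4 + 5 * X) (env h) copy_prog (pl (copy_index m w a)) (env h)"
  unfolding copy_prog_def
  apply (rule hoare_SEQ_le[where T = 3 and T' = "1 + X * (4 + 1)"
        and B = "\<lambda>s. env h s \<and> s 20 = m * w \<and> s 21 = snd u \<and> s 22 = snd t + a"])
     apply (rule hoare_basics_le; simp add: env_def)
    apply (rule hoare_WHILE_le[where N = "m * w" and X = X and T = 4
        and I = "\<lambda>i s. env h s \<and> s 20 = m * w - i \<and> s 21 = snd u + i \<and> s 22 = snd t + (a + i)"])
           apply (rule hoare_basics_le; simp add: env_def)
          apply (auto simp: bounds copy_index_def place_simps comp_def)
  done

lemma phase_prog:
  "hoare (4 + 5 * X) (env h) phase_prog
     (pl (map (\<lambda>b. Phase (2 ^ b) q (2, col_T m w a + b)) [0..<w])) (env h)"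
  unfolding phase_prog_def
  apply (rule hoare_SEQ_le[where T = 3 and T' = "1 + X * (4 + 1)"
        and B = "\<lambda>s. env h s \<and> s 20 = w \<and> s 22 = snd t + col_T m w a \<and> s 23 = 1"])
     apply (rule hoare_basics_le; simp add: env_def)
    apply (rule hoare_WHILE_le[where N = "w" and X = X and T = 4
        and I = "\<lambda>i s. env h s \<and> s 20 = w - i \<and> s 22 = snd t + (col_T m w a + i) \<and> s 23 = 2 ^ i"])
           apply (rule hoare_basics_le; simp add: env_def)
          apply (auto simp: bounds place_simps comp_def)
  done

lemma cphase_inner_prog:
  "hoare (1 + 5 * X)
     (\<lambda>s. env h s \<and> s 24 = c \<and> s 21 = snd t + i \<and> s 25 = 2 ^ i \<and>
        s 20 = w \<and> s 22 = snd t + col_T m w a \<and> s 23 = 2 ^ i)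
     cphase_inner_prog
     (pl (map (\<lambda>b. CPhase (2 ^ (i + b)) q (2, i) (2, col_T m w a + b)) [0..<w]))
     (\<lambda>s. env h s \<and> s 24 = c \<and> s 21 = snd t + i \<and> s 25 = 2 ^ i)"
  unfolding cphase_inner_prog_def
  apply (rule hoare_WHILE_le[where N = w and X = X and T = 4
        and I = "\<lambda>b s. env h s \<and> s 24 = c \<and> s 21 = snd t + i \<and>
          s 25 = 2 ^ i \<and> s 20 = w - b \<and> s 22 = snd t + (col_T m w a + b) \<and> s 23 = 2 ^ (i + b)"])
         apply (rule hoare_basics_le; simp add: env_def)
        apply (auto simp: bounds place_simps comp_def)
  done

lemma cphase_prog:
  "hoare (4 + X * (8 + 5 * X)) (env h) cphase_prog
     (pl (concat (map (\<lambda>i. map (\<lambda>b. CPhase (2 ^ (i + b)) q (2, i) (2, col_T m w a + b)) [0..<w]) [0..<a])))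
     (env h)"
  unfolding cphase_prog_def
proof (rule hoare_SEQ_le)
  let ?I = "\<lambda>i s. env h s \<and> s 24 = a - i \<and> s 21 = snd t + i \<and> s 25 = 2 ^ i"
  show "hoare 3 (env h) (SEQs [ADD 24 5 0, ADD 21 14 0, SET 25 1]) [] (?I 0)"
    by (rule hoare_basics_le; simp add: env_def)
  show "hoare (1 + X * ((7 + 5 * X) + 1)) (?I 0)
     (WHILE 24 (SEQ (SEQs [ADD 20 4 0, ADD 22 17 0, ADD 23 25 0])
       (SEQ cphase_inner_prog (SEQs [ADD 25 25 25, ADD 21 21 1, SUB 24 24 1]))))
     (pl (concat (map (\<lambda>i. map (\<lambda>b. CPhase (2 ^ (i + b)) q (2, i) (2, col_T m w a + b)) [0..<w]) [0..<a])))
     (env h)"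
  proof (rule hoare_WHILE_le[where N = a and X = X and T = "7 + 5 * X" and I = ?I])
    fix i assume "i < a"
    let ?gs = "pl (map (\<lambda>b. CPhase (2 ^ (i + b)) q (2, i) (2, col_T m w a + b)) [0..<w])"
    show "hoare (7 + 5 * X) (?I i) (SEQ (SEQs [ADD 20 4 0, ADD 22 17 0, ADD 23 25 0])
       (SEQ cphase_inner_prog (SEQs [ADD 25 25 25, ADD 21 21 1, SUB 24 24 1]))) ?gs (?I (Suc i))"
    proof (rule hoare_SEQ_le)
      show "hoare 3 (?I i) (SEQs [ADD 20 4 0, ADD 22 17 0, ADD 23 25 0]) []
        (\<lambda>s. env h s \<and> s 24 = a - i \<and> s 21 = snd t + i \<and> s 25 = 2 ^ i \<and>
          s 20 = w \<and> s 22 = snd t + col_T m w a \<and> s 23 = 2 ^ i)"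
        by (rule hoare_basics_le; simp add: env_def)
      show "hoare (4 + 5 * X) (\<lambda>s. env h s \<and> s 24 = a - i \<and> s 21 = snd t + i \<and> s 25 = 2 ^ i \<and>
          s 20 = w \<and> s 22 = snd t + col_T m w a \<and> s 23 = 2 ^ i)
        (SEQ cphase_inner_prog (SEQs [ADD 25 25 25, ADD 21 21 1, SUB 24 24 1])) ?gs (?I (Suc i))"
        by (rule hoare_SEQ_le[OF cphase_inner_prog, where T' = 3 and gs' = "[]"])
          ((rule hoare_basics_le; simp add: env_def), auto)
    qed auto
  qed (auto simp: bounds place_simps comp_def map_concat)
qed auto

text \<open>The loop registers appear as parameters, so that triples about the inner programs also
  state that these registers are preserved.\<close>

definition tab where
  "tab h c24 c26 c27 c28 c29 c30 c31 c32 s \<longleftrightarrow>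
     env h s \<and> s 24 = c24 \<and> s 26 = c26 \<and> s 27 = c27 \<and> s 28 = c28 \<and> s 29 = c29 \<and>
     s 30 = c30 \<and> s 31 = c31 \<and> s 32 = c32"

lemma parity_by_halving: "(x::nat) - (x div 2 + x div 2) = x mod 2"
  by presburger

lemma chain_prog:
  assumes "n \<le> X"
  shows "hoare (1 + 12 * X)
     (\<lambda>s. tab h c24 c26 c27 c28 c29 c30 c31 c32 s \<and> s 33 = x \<and> s 20 = n \<and> s 21 = snd t + y)
     chain_prog (pl (match_chain h y n x)) (tab (h + n) c24 c26 c27 c28 c29 c30 c31 c32)"
  unfolding chain_prog_def
proof (rule hoare_WHILE_le[where N = n and X = X and T = 11
      and I = "\<lambda>i s. tab (h + i) c24 c26 c27 c28 c29 c30 c31 c32 s \<and> s 33 = x div 2 ^ i \<and>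
        s 20 = n - i \<and> s 21 = snd t + (y + i)"])
  fix i assume "i < n"
  let ?I = "\<lambda>s. tab (h + i) c24 c26 c27 c28 c29 c30 c31 c32 s \<and> s 34 = x div 2 ^ Suc i \<and>
        s 20 = n - i \<and> s 21 = snd t + (y + i) \<and> s 22 = snd t + (h + Suc i)"
  show "hoare 11 (\<lambda>s. tab (h + i) c24 c26 c27 c28 c29 c30 c31 c32 s \<and> s 33 = x div 2 ^ i \<and>
        s 20 = n - i \<and> s 21 = snd t + (y + i))
     (SEQ (SEQs [ADD 22 18 1, EMIT (Toffoli (13, 18) (13, 21) (13, 22)),
        HALF 34 33, SUB 35 33 34, SUB 35 35 34])
     (SEQ (COND 35 (SEQs []) (EMIT (CNOT (13, 18) (13, 22))))
       (SEQs [ADD 33 34 0, ADD 21 21 1, ADD 18 22 0, SUB 20 20 1])))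
     (pl (Toffoli (2, h + i) (2, y + i) (2, h + Suc i) #
       (if bit x i then [] else [CNOT (2, h + i) (2, h + Suc i)])))
     (\<lambda>s. tab (h + Suc i) c24 c26 c27 c28 c29 c30 c31 c32 s \<and> s 33 = x div 2 ^ Suc i \<and>
        s 20 = n - Suc i \<and> s 21 = snd t + (y + Suc i))"
  proof (rule hoare_SEQ_le[where T = 5 and T' = 6
        and B = "\<lambda>s. ?I s \<and> s 35 = (x div 2 ^ i) mod 2"])
    show "hoare 6 (\<lambda>s. ?I s \<and> s 35 = (x div 2 ^ i) mod 2)
       (SEQ (COND 35 (SEQs []) (EMIT (CNOT (13, 18) (13, 22))))
       (SEQs [ADD 33 34 0, ADD 21 21 1, ADD 18 22 0, SUB 20 20 1]))
       (if bit x i then [] else pl [CNOT (2, h + i) (2, h + Suc i)])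
       (\<lambda>s. tab (h + Suc i) c24 c26 c27 c28 c29 c30 c31 c32 s \<and> s 33 = x div 2 ^ Suc i \<and>
        s 20 = n - Suc i \<and> s 21 = snd t + (y + Suc i))"
    proof (rule hoare_SEQ_le[where T = "Suc 1" and T' = 4 and gs' = "[]" and B = ?I])
      show "hoare (Suc 1) (\<lambda>s. ?I s \<and> s 35 = (x div 2 ^ i) mod 2)
         (COND 35 (SEQs []) (EMIT (CNOT (13, 18) (13, 22))))
         (if bit x i then [] else pl [CNOT (2, h + i) (2, h + Suc i)]) ?I"
        proof (rule hoare_COND)
        show "hoare 1 (\<lambda>s. ?I s \<and> s 35 = (x div 2 ^ i) mod 2) (SEQs []) [] ?I"
          using hoare_basics_le[of "\<lambda>s. ?I s \<and> s 35 = (x div 2 ^ i) mod 2" "[SET 37 0]" "[]" ?I 1]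
          by (simp add: tab_def env_def)
        show "hoare 1 (\<lambda>s. ?I s \<and> s 35 = (x div 2 ^ i) mod 2)
            (EMIT (CNOT (13, 18) (13, 22))) (pl [CNOT (2, h + i) (2, h + Suc i)]) ?I"
          using hoare_basics_le[of "\<lambda>s. ?I s \<and> s 35 = (x div 2 ^ i) mod 2"
              "[EMIT (CNOT (13, 18) (13, 22))]" "pl [CNOT (2, h + i) (2, h + Suc i)]" ?I 1]
          by (simp add: tab_def env_def place_simps)
      qed (auto simp: bit_iff_odd odd_iff_mod_2_eq_one)
      show "hoare 4 ?I (SEQs [ADD 33 34 0, ADD 21 21 1, ADD 18 22 0, SUB 20 20 1]) []
        (\<lambda>s. tab (h + Suc i) c24 c26 c27 c28 c29 c30 c31 c32 s \<and> s 33 = x div 2 ^ Suc i \<and>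
        s 20 = n - Suc i \<and> s 21 = snd t + (y + Suc i))"
        by (rule hoare_basics_le; simp add: tab_def env_def)
    qed auto
    show "hoare 5 (\<lambda>s. tab (h + i) c24 c26 c27 c28 c29 c30 c31 c32 s \<and> s 33 = x div 2 ^ i \<and>
        s 20 = n - i \<and> s 21 = snd t + (y + i))
       (SEQs [ADD 22 18 1, EMIT (Toffoli (13, 18) (13, 21) (13, 22)),
        HALF 34 33, SUB 35 33 34, SUB 35 35 34])
       (pl [Toffoli (2, h + i) (2, y + i) (2, h + Suc i)])
       (\<lambda>s. ?I s \<and> s 35 = (x div 2 ^ i) mod 2)"
      by (rule hoare_basics_le;
          simp add: tab_def env_def place_simps parity_by_halving div_mult2_eq power_Suc2 del: power_Suc)
  qed auto
qed (auto simp: assms match_chain_def map_concat comp_def tab_def)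

lemma xor_prog:
  assumes "n \<le> X"
  shows "hoare (1 + 12 * X)
     (\<lambda>s. tab h c24 c26 c27 c28 c29 c30 c31 c32 s \<and> s 33 = x \<and> s 20 = n \<and> s 21 = snd v + y)
     xor_prog (pl (xor_out h y n x)) (tab h c24 c26 c27 c28 c29 c30 c31 c32)"
  unfolding xor_prog_def
proof (rule hoare_WHILE_le[where N = n and X = X and T = 11
      and I = "\<lambda>i s. tab h c24 c26 c27 c28 c29 c30 c31 c32 s \<and> s 33 = x div 2 ^ i \<and>
        s 20 = n - i \<and> s 21 = snd v + (y + i)"])
  fix i assume "i < n"
  let ?I = "\<lambda>s. tab h c24 c26 c27 c28 c29 c30 c31 c32 s \<and> s 34 = x div 2 ^ Suc i \<and>
        s 20 = n - i \<and> s 21 = snd v + (y + i)"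
  show "hoare 11 (\<lambda>s. tab h c24 c26 c27 c28 c29 c30 c31 c32 s \<and> s 33 = x div 2 ^ i \<and>
        s 20 = n - i \<and> s 21 = snd v + (y + i))
     (SEQ (SEQs [HALF 34 33, SUB 35 33 34, SUB 35 35 34])
     (SEQ (COND 35 (EMIT (CNOT (13, 18) (11, 21))) (SEQs []))
       (SEQs [ADD 33 34 0, ADD 21 21 1, SUB 20 20 1])))
     (pl (if bit x i then [CNOT (2, h) (1, y + i)] else []))
     (\<lambda>s. tab h c24 c26 c27 c28 c29 c30 c31 c32 s \<and> s 33 = x div 2 ^ Suc i \<and>
        s 20 = n - Suc i \<and> s 21 = snd v + (y + Suc i))"
  proof (rule hoare_SEQ_le[where T = 3 and T' = 6 and gs = "[]"
        and B = "\<lambda>s. ?I s \<and> s 35 = (x div 2 ^ i) mod 2"])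
    show "hoare 6 (\<lambda>s. ?I s \<and> s 35 = (x div 2 ^ i) mod 2)
       (SEQ (COND 35 (EMIT (CNOT (13, 18) (11, 21))) (SEQs []))
       (SEQs [ADD 33 34 0, ADD 21 21 1, SUB 20 20 1]))
       (if bit x i then pl [CNOT (2, h) (1, y + i)] else [])
       (\<lambda>s. tab h c24 c26 c27 c28 c29 c30 c31 c32 s \<and> s 33 = x div 2 ^ Suc i \<and>
        s 20 = n - Suc i \<and> s 21 = snd v + (y + Suc i))"
    proof (rule hoare_SEQ_le[where T = "Suc 1" and T' = 3 and gs' = "[]" and B = ?I])
      show "hoare (Suc 1) (\<lambda>s. ?I s \<and> s 35 = (x div 2 ^ i) mod 2)
         (COND 35 (EMIT (CNOT (13, 18) (11, 21))) (SEQs []))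
         (if bit x i then pl [CNOT (2, h) (1, y + i)] else []) ?I"
        proof (rule hoare_COND)
        show "hoare 1 (\<lambda>s. ?I s \<and> s 35 = (x div 2 ^ i) mod 2) (SEQs []) [] ?I"
          using hoare_basics_le[of "\<lambda>s. ?I s \<and> s 35 = (x div 2 ^ i) mod 2" "[SET 37 0]" "[]" ?I 1]
          by (simp add: tab_def env_def)
        show "hoare 1 (\<lambda>s. ?I s \<and> s 35 = (x div 2 ^ i) mod 2)
            (EMIT (CNOT (13, 18) (11, 21))) (pl [CNOT (2, h) (1, y + i)]) ?I"
          using hoare_basics_le[of "\<lambda>s. ?I s \<and> s 35 = (x div 2 ^ i) mod 2"
              "[EMIT (CNOT (13, 18) (11, 21))]" "pl [CNOT (2, h) (1, y + i)]" ?I 1]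
          by (simp add: tab_def env_def place_simps)
      qed (auto simp: bit_iff_odd odd_iff_mod_2_eq_one)
      show "hoare 3 ?I (SEQs [ADD 33 34 0, ADD 21 21 1, SUB 20 20 1]) []
        (\<lambda>s. tab h c24 c26 c27 c28 c29 c30 c31 c32 s \<and> s 33 = x div 2 ^ Suc i \<and>
        s 20 = n - Suc i \<and> s 21 = snd v + (y + Suc i))"
        by (rule hoare_basics_le; simp add: tab_def env_def)
    qed auto
    show "hoare 3 (\<lambda>s. tab h c24 c26 c27 c28 c29 c30 c31 c32 s \<and> s 33 = x div 2 ^ i \<and>
        s 20 = n - i \<and> s 21 = snd v + (y + i))
       (SEQs [HALF 34 33, SUB 35 33 34, SUB 35 35 34]) []
       (\<lambda>s. ?I s \<and> s 35 = (x div 2 ^ i) mod 2)"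
      by (rule hoare_basics_le;
          simp add: tab_def env_def place_simps parity_by_halving div_mult2_eq power_Suc2 del: power_Suc)
  qed auto
qed (auto simp: assms xor_out_def map_concat comp_def tab_def)

lemma mod_add_eq_if: "x < n \<Longrightarrow> y < n \<Longrightarrow> (x + y) mod n = (if n \<le> x + y then x + y - n else x + y)"
  for x y n :: nat
  by (simp add: le_mod_geq)

lemma entry_prog:
  fixes j k y :: nat
  assumes "k < q - 1"
  defines "h \<equiv> helper_base m q w a j k"
  shows "hoare (20 + 36 * X)
     (tab (h y) c24 (snd t + (col_S m w a + j * w)) (snd v + j * w) (q - 1 - k) k (q - y) y
        ((q - 1 - k) * y mod q))
     entry_prog (pl (table_entry m q w a j k y))
     (tab (h (Suc y)) c24 (snd t + (col_S m w a + j * w)) (snd v + j * w) (q - 1 - k) k (q - Suc y) (Suc y)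
        ((q - 1 - k) * Suc y mod q))"
proof -
  let ?c = "q - 1 - k"
  let ?tab = "\<lambda>h. tab h c24 (snd t + (col_S m w a + j * w)) (snd v + j * w) ?c k"
  let ?r = "?c * y mod q"
  have c: "?c < q" and r: "?r < q" using q by auto
  \<comment> \<open>Both \<open>?r\<close> and \<open>?c\<close> are below \<open>q\<close>, so one
    conditional subtraction reduces their sum; the truncated difference with \<open>q - 1\<close> is
    nonzero exactly when the sum reaches \<open>q\<close>.\<close>
  have next_r: "?c * Suc y mod q = (if ?r + ?c - (q - 1) \<noteq> 0 then ?r + ?c - q else ?r + ?c)"
  proof -
    have "?c * Suc y mod q = (?r + ?c) mod q" 
      unfolding mult_Suc_right by (subst mod_add_left_eq, subst add.commute, rule refl)
    moreover have "(?r + ?c) mod q = (if q \<le> ?r + ?c then ?r + ?c - q else ?r + ?c)"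
      by (rule mod_add_eq_if[OF r c])
    ultimately show ?thesis using q by auto
  qed
  have h_Suc: "h y + a + w + 1 = h (Suc y)" by (simp add: h_def helper_base_def)
  have table_entry: "table_entry m q w a j k y =
    [NOT (2, h y)] @ (match_chain (h y) 0 a k
        @ ([] @ (match_chain (h y + a) (col_S m w a + j * w) w ?r
        @ ([] @ (xor_out (h y + a + w) (j * w) w y @ ([] @ ([] @ [])))))))"
    by (simp add: table_entry_def Let_def h_def)
  let ?B = "\<lambda>h v n x s. ?tab h (q - y) y ?r s \<and> s 33 = v \<and> s 20 = n \<and> s 21 = x"
  show ?thesis
    unfolding entry_prog_def table_entry map_append
  proof (intro hoare_conseq[OF hoare_SEQ[OF _ hoare_SEQ[OF _ hoare_SEQ[OF _ hoare_SEQ[OF _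
           hoare_SEQ[OF _ hoare_SEQ[OF _ hoare_SEQ[OF _ hoare_SEQ]]]]]]]])
    show "hoare 4 (?tab (h y) (q - y) y ?r)
      (SEQs [EMIT (NOT (13, 18)), ADD 33 29 0, ADD 20 5 0, ADD 21 14 0])
      (pl [NOT (2, h y)]) (?B (h y) k a (snd t + 0))"
      by (rule hoare_basics_le; simp add: tab_def env_def place_simps)
    show "hoare (1 + 12 * X) (?B (h y) k a (snd t + 0)) chain_prog (pl (match_chain (h y) 0 a k))
      (?tab (h y + a) (q - y) y ?r)"
      by (rule chain_prog) (rule bounds)
    show "hoare 3 (?tab (h y + a) (q - y) y ?r) (SEQs [ADD 33 32 0, ADD 20 4 0, ADD 21 26 0])
      (pl []) (?B (h y + a) ?r w (snd t + (col_S m w a + j * w)))"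
      by (rule hoare_basics_le; simp add: tab_def env_def place_simps)
    show "hoare (1 + 12 * X) (?B (h y + a) ?r w (snd t + (col_S m w a + j * w))) chain_prog
      (pl (match_chain (h y + a) (col_S m w a + j * w) w ?r)) (?tab (h y + a + w) (q - y) y ?r)"
      by (rule chain_prog) (rule bounds)
    show "hoare 3 (?tab (h y + a + w) (q - y) y ?r) (SEQs [ADD 33 31 0, ADD 20 4 0, ADD 21 27 0])
      (pl []) (?B (h y + a + w) y w (snd v + j * w))"
      by (rule hoare_basics_le; simp add: tab_def env_def place_simps)
    show "hoare (1 + 12 * X) (?B (h y + a + w) y w (snd v + j * w)) xor_prog
      (pl (xor_out (h y + a + w) (j * w) w y)) (?tab (h y + a + w) (q - y) y ?r)"
      by (rule xor_prog) (rule bounds)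
    show "hoare 4 (?tab (h y + a + w) (q - y) y ?r)
       (SEQs [ADD 18 18 1, ADD 31 31 1, ADD 32 32 28, SUB 36 32 8]) (pl [])
       (\<lambda>s. ?tab (h (Suc y)) (q - y) (Suc y) (?r + ?c) s \<and> s 36 = ?r + ?c - (q - 1))"
      by (rule hoare_basics_le; simp add: tab_def env_def place_simps flip: h_Suc)
    show "hoare (Suc 1) (\<lambda>s. ?tab (h (Suc y)) (q - y) (Suc y) (?r + ?c) s \<and> s 36 = ?r + ?c - (q - 1))
       (COND 36 (SUB 32 32 3) (SEQs [])) (if ?r + ?c - (q - 1) \<noteq> 0 then [] else [])
       (?tab (h (Suc y)) (q - y) (Suc y) (?c * Suc y mod q))" (is "hoare _ ?A _ _ ?D")
    proof (rule hoare_COND)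
      assume "?r + ?c - (q - 1) \<noteq> 0"
      then have "?c * Suc y mod q = ?r + ?c - q" unfolding next_r by (rule if_P)
      then show "hoare 1 ?A (SUB 32 32 3) [] ?D"
        using hoare_basics_le[of ?A "[SUB 32 32 3]" "[]" ?D 1]
        by (simp add: tab_def env_def del: mult_Suc_right)
    next
      assume "\<not> ?r + ?c - (q - 1) \<noteq> 0"
      then have "?c * Suc y mod q = ?r + ?c" unfolding next_r by (rule if_not_P)
      then show "hoare 1 ?A (SEQs []) [] ?D"
        using hoare_basics_le[of ?A "[SET 37 0]" "[]" ?D 1]
        by (simp add: tab_def env_def del: mult_Suc_right)
    qed simp
    show "hoare 1 (?tab (h (Suc y)) (q - y) (Suc y) (?c * Suc y mod q)) (SUB 30 30 1) (pl [])
       (?tab (h (Suc y)) (q - Suc y) (Suc y) (?c * Suc y mod q))" (is "hoare _ ?A _ _ ?D")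
      using hoare_basics_le[of ?A "[SUB 30 30 1]" "[]" ?D 1]
      by (simp add: tab_def env_def)
  qed auto
qed

lemma table_prog:
  "hoare (4 + X * (8 + X * (8 + X * (21 + 36 * X)))) (env (col_H m w a)) table_prog
     (pl (table m q w a)) (env (col_A m q w a))"
proof -
  let ?h = "helper_base m q w a"
  let ?tab = "\<lambda>h j. tab h (m - j) (snd t + (col_S m w a + j * w)) (snd v + j * w)"
  have y_loop: "hoare (1 + X * (20 + 36 * X + 1))
      (?tab (?h j k 0) j (q - 1 - k) k q 0 0) (WHILE 30 entry_prog)
      (pl (concat (map (table_entry m q w a j k) [0..<q])))
      (?tab (?h j k q) j (q - 1 - k) k 0 q 0)" if "k < q - 1" for j k
    by (rule hoare_WHILE_le[where N = q and X = X and
          I = "\<lambda>y. ?tab (?h j k y) j (q - 1 - k) k (q - y) y ((q - 1 - k) * y mod q)",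
          OF entry_prog[OF that]])
      (auto simp: bounds tab_def map_concat comp_def)
  have k_loop: "hoare (1 + X * (7 + X * (20 + 36 * X + 1) + 1))
      (\<lambda>s. \<exists>c30 c31 c32. ?tab (?h j 0 0) j (q - 1) 0 c30 c31 c32 s)
      (WHILE 28 (SEQ (SEQs [ADD 30 3 0, SET 31 0, SET 32 0])
           (SEQ (WHILE 30 entry_prog)
             (SEQs [ADD 29 29 1, SUB 28 28 1]))))
      (pl (concat (map (\<lambda>k. concat (map (table_entry m q w a j k) [0..<q])) [0..<q - 1])))
      (\<lambda>s. \<exists>c30 c31 c32. ?tab (?h j (q - 1) 0) j 0 (q - 1) c30 c31 c32 s)" for j
  proof (rule hoare_WHILE_le[where N = "q - 1" and X = X and T = "7 + X * (20 + 36 * X + 1)" and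
          I = "\<lambda>k s. \<exists>c30 c31 c32. ?tab (?h j k 0) j (q - 1 - k) k c30 c31 c32 s"])
    fix k assume k: "k < q - 1"
    \<comment> \<open>In the mixed radix numbering, running past the last \<open>y\<close> is the
      same as moving to the next \<open>k\<close>; the pointer needs no reset.\<close>
    have h: "?h j k q = ?h j (Suc k) 0" by (simp add: helper_base_def algebra_simps)
    show "hoare (7 + X * (20 + 36 * X + 1))
       (\<lambda>s. \<exists>c30 c31 c32. ?tab (?h j k 0) j (q - 1 - k) k c30 c31 c32 s)
       (SEQ (SEQs [ADD 30 3 0, SET 31 0, SET 32 0])
           (SEQ (WHILE 30 entry_prog)
             (SEQs [ADD 29 29 1, SUB 28 28 1])))
       (pl (concat (map (table_entry m q w a j k) [0..<q])))
       (\<lambda>s. \<exists>c30 c31 c32. ?tab (?h j (Suc k) 0) j (q - 1 - Suc k) (Suc k) c30 c31 c32 s)"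
    proof (rule hoare_SEQ_le)
      show "hoare 3 (\<lambda>s. \<exists>c30 c31 c32. ?tab (?h j k 0) j (q - 1 - k) k c30 c31 c32 s)
         (SEQs [ADD 30 3 0, SET 31 0, SET 32 0]) [] (?tab (?h j k 0) j (q - 1 - k) k q 0 0)"
        by (rule hoare_basics_le; auto simp: tab_def env_def)
      show "hoare (4 + X * (20 + 36 * X + 1)) (?tab (?h j k 0) j (q - 1 - k) k q 0 0)
         (SEQ (WHILE 30 entry_prog) (SEQs [ADD 29 29 1, SUB 28 28 1]))
         (pl (concat (map (table_entry m q w a j k) [0..<q])))
         (\<lambda>s. \<exists>c30 c31 c32. ?tab (?h j (Suc k) 0) j (q - 1 - Suc k) (Suc k) c30 c31 c32 s)"
        by (rule hoare_SEQ_le[OF y_loop[OF k], where T' = 2 and gs' = "[]"])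
          ((rule hoare_basics_le; auto simp: tab_def env_def h), auto)
    qed auto
  qed (use bounds q in \<open>auto simp: tab_def map_concat comp_def\<close>)
  show ?thesis unfolding table_prog_def
  proof (rule hoare_SEQ_le)
    show "hoare 3 (env (col_H m w a)) (SEQs [ADD 24 2 0, ADD 26 16 0, ADD 27 12 0]) []
      (\<lambda>s. \<exists>c28 c29 c30 c31 c32. ?tab (?h 0 0 0) 0 c28 c29 c30 c31 c32 s)"
      by (rule hoare_basics_le; auto simp: tab_def env_def helper_base_def)
    show "hoare (1 + X * (7 + X * (7 + X * (20 + 36 * X + 1) + 1) + 1))
      (\<lambda>s. \<exists>c28 c29 c30 c31 c32. ?tab (?h 0 0 0) 0 c28 c29 c30 c31 c32 s)
      (WHILE 24 (SEQ (SEQs [ADD 28 8 0, SET 29 0])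
       (SEQ (WHILE 28 (SEQ (SEQs [ADD 30 3 0, SET 31 0, SET 32 0])
           (SEQ (WHILE 30 entry_prog)
             (SEQs [ADD 29 29 1, SUB 28 28 1]))))
         (SEQs [ADD 26 26 4, ADD 27 27 4, SUB 24 24 1]))))
      (pl (table m q w a)) (env (col_A m q w a))"
    proof (rule hoare_WHILE_le[where N = m and X = X and T = "7 + X * (7 + X * (20 + 36 * X + 1) + 1)" and
          I = "\<lambda>j s. \<exists>c28 c29 c30 c31 c32. ?tab (?h j 0 0) j c28 c29 c30 c31 c32 s"])
      fix j assume "j < m"
      have h: "?h j (q - Suc 0) 0 = ?h (Suc j) 0 0" by (simp add: helper_base_def algebra_simps)
      show "hoare (7 + X * (7 + X * (20 + 36 * X + 1) + 1))
        (\<lambda>s. \<exists>c28 c29 c30 c31 c32. ?tab (?h j 0 0) j c28 c29 c30 c31 c32 s)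
        (SEQ (SEQs [ADD 28 8 0, SET 29 0])
         (SEQ (WHILE 28 (SEQ (SEQs [ADD 30 3 0, SET 31 0, SET 32 0])
           (SEQ (WHILE 30 entry_prog)
             (SEQs [ADD 29 29 1, SUB 28 28 1]))))
         (SEQs [ADD 26 26 4, ADD 27 27 4, SUB 24 24 1])))
         (pl (concat (map (\<lambda>k. concat (map (table_entry m q w a j k) [0..<q])) [0..<q - 1])))
         (\<lambda>s. \<exists>c28 c29 c30 c31 c32. ?tab (?h (Suc j) 0 0) (Suc j) c28 c29 c30 c31 c32 s)"
      proof (rule hoare_SEQ_le)
        show "hoare 2 (\<lambda>s. \<exists>c28 c29 c30 c31 c32. ?tab (?h j 0 0) j c28 c29 c30 c31 c32 s)
          (SEQs [ADD 28 8 0, SET 29 0]) []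
          (\<lambda>s. \<exists>c30 c31 c32. ?tab (?h j 0 0) j (q - 1) 0 c30 c31 c32 s)"
          by (rule hoare_basics_le; auto simp: tab_def env_def)
        show "hoare (4 + X * (7 + X * (20 + 36 * X + 1) + 1))
          (\<lambda>s. \<exists>c30 c31 c32. ?tab (?h j 0 0) j (q - 1) 0 c30 c31 c32 s)
          (SEQ (WHILE 28 (SEQ (SEQs [ADD 30 3 0, SET 31 0, SET 32 0])
           (SEQ (WHILE 30 entry_prog)
             (SEQs [ADD 29 29 1, SUB 28 28 1]))))
           (SEQs [ADD 26 26 4, ADD 27 27 4, SUB 24 24 1]))
           (pl (concat (map (\<lambda>k. concat (map (table_entry m q w a j k) [0..<q])) [0..<q - 1])))
           (\<lambda>s. \<exists>c28 c29 c30 c31 c32. ?tab (?h (Suc j) 0 0) (Suc j) c28 c29 c30 c31 c32 s)"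
          by (rule hoare_SEQ_le[OF k_loop, where T' = 3 and gs' = "[]"])
            ((rule hoare_basics_le; auto simp: tab_def env_def h), auto)
      qed auto
    next
      fix s assume "\<exists>c28 c29 c30 c31 c32. ?tab (?h m 0 0) m c28 c29 c30 c31 c32 s"
      moreover have "?h m 0 0 = col_A m q w a"
        
        by (simp only: helper_base_def col_A_def helpers_def mult.assoc add_0_right)
      ultimately show "env (col_A m q w a) s" by (auto simp: tab_def)
    qed (use bounds in \<open>auto simp: tab_def map_concat comp_def table_def\<close>)
  qed auto
qed

lemma query_prog:
  "hoare (30 + 18 * X + X * (8 + 5 * X) + X * (8 + X * (8 + X * (21 + 36 * X))))
     (sim_env m q w a u v t) query_prog (pl (query_circuit m q w a)) (sim_env m q w a u v t)"
proof -
  have split: "query_circuit m q w a =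
      [QFT (q - 1) (2, 0)] @ (fourier_layer m q w a @ (copy_index m w a
       @ ([Query (2, a) (2, col_T m w a) (2, col_A m q w a)]
       @ (map (\<lambda>b. Phase (2 ^ b) q (2, col_T m w a + b)) [0..<w]
       @ (concat (map (\<lambda>i. map (\<lambda>b. CPhase (2 ^ (i + b)) q (2, i) (2, col_T m w a + b)) [0..<w]) [0..<a])
       @ ([QueryInv (2, a) (2, col_T m w a) (2, col_A m q w a)]
       @ (fourier_layer m q w a @ table m q w a)))))))"
    by (simp add: query_circuit_def phase_layer_def)
  have emit: "hoare (Suc 0) (env h) (EMIT g) [g'] (env h)" if "\<And>s. env h s \<Longrightarrow> map_gate s g = g'" for h g g'
    using hoare_basics_le[of "env h" "[EMIT g]" "[g']" "env h" 1] that by simp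
  show ?thesis
    unfolding query_prog_def split map_append
  proof (intro hoare_conseq[OF hoare_SEQ[OF _ hoare_SEQ[OF fourier_prog hoare_SEQ[OF copy_prog
        hoare_SEQ[OF _ hoare_SEQ[OF phase_prog hoare_SEQ[OF cphase_prog hoare_SEQ[OF _
        hoare_SEQ[OF fourier_prog table_prog]]]]]]]]])
    show "hoare 6 (sim_env m q w a u v t)
      (SEQs [ADD 15 14 5, ADD 16 15 6, ADD 17 16 6, ADD 18 17 4, ADD 19 18 7, EMIT (QFT 8 (13, 14))])
      (pl [QFT (q - 1) (2, 0)]) (env (col_H m w a))"
      by (rule hoare_basics_le;
          auto simp: env_def sim_env_def place_simps col_S_def col_T_def col_H_def col_A_def)
    show "hoare 1 (env (col_H m w a)) (EMIT (Query (13, 15) (13, 17) (13, 19)))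
      (pl [Query (2, a) (2, col_T m w a) (2, col_A m q w a)]) (env (col_H m w a))"
      by (simp, rule emit) (simp add: env_def place_simps)
    show "hoare 1 (env (col_H m w a)) (EMIT (QueryInv (13, 15) (13, 17) (13, 19)))
      (pl [QueryInv (2, a) (2, col_T m w a) (2, col_A m q w a)]) (env (col_H m w a))"
      by (simp, rule emit) (simp add: env_def place_simps)
  qed (auto simp: env_sim_env)
qed

end

text \<open>The Fourier transform has order dividing 4, a phase \<open>2 * pi * x / y\<close> has
  order dividing \<open>y\<close>, and the remaining gates other than queries are
  involutions.\<close>

fun inverse_gates :: "nat gate \<Rightarrow> nat gate list" where
  "inverse_gates (QFT d u) = replicate 3 (QFT d u)"
| "inverse_gates (Phase x y u) = replicate (y - 1) (Phase x y u)"
| "inverse_gates (CPhase x y u v) = replicate (y - 1) (CPhase x y u v)"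
| "inverse_gates (Query u v w) = [QueryInv u v w]"
| "inverse_gates (QueryInv u v w) = [Query u v w]"
| "inverse_gates g = [g]"

text \<open>Bounds the number of repetitions of a phase gate in its inverse, hence the length of the
  loop in \<open>inverse_prog\<close>.\<close>

fun phase_order :: "nat gate \<Rightarrow> nat" where
  "phase_order (Phase x y u) = y"
| "phase_order (CPhase x y u v) = y"
| "phase_order g = 1"

definition inverse_circuit :: "nat gate list \<Rightarrow> nat gate list" where
  "inverse_circuit gs = concat (map inverse_gates (rev gs))"

fun simulated_gates :: "nat \<Rightarrow> nat \<Rightarrow> nat \<Rightarrow> nat \<Rightarrow> nat gate \<Rightarrow> nat gate list" where
  "simulated_gates m q w a (Query u v t) = map (relocate (place u v t)) (query_circuit m q w a)"
| "simulated_gates m q w a (QueryInv u v t) =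
     inverse_circuit (map (relocate (place u v t)) (query_circuit m q w a))"
| "simulated_gates m q w a g = [g]"

fun inverse_prog :: "nat gate \<Rightarrow> program" where
  "inverse_prog (QFT d u) = SEQs [EMIT (QFT d u), EMIT (QFT d u), EMIT (QFT d u)]"
| "inverse_prog (Phase x y u) =
     SEQ (SUB 3 y 2) (WHILE 3 (SEQs [EMIT (Phase x y u), SUB 3 3 2]))"
| "inverse_prog (CPhase x y u v) =
     SEQ (SUB 3 y 2) (WHILE 3 (SEQs [EMIT (CPhase x y u v), SUB 3 3 2]))"
| "inverse_prog (Query u v w) = EMIT (QueryInv u v w)"
| "inverse_prog (QueryInv u v w) = EMIT (Query u v w)"
| "inverse_prog g = EMIT g"

text \<open>Register 3 is the countdown; the third assumption says that the emitted gate does not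
  depend on it.\<close>

lemma exec_repeated_emission:
  assumes "s 2 = 1" "map_gate s g = g'" "\<And>v. map_gate (s(3 := v)) g = g'" "s y \<le> X"
  shows "\<exists>t. exec (SEQ (SUB 3 y 2) (WHILE 3 (SEQs [EMIT g, SUB 3 3 2]))) s (s(3 := 0))
           (replicate (s y - 1) g') [] t \<and> t \<le> 2 + 3 * X"
proof -
  let ?N = "s y - 1"
  have "hoare (1 + X * (2 + 1)) (\<lambda>r. r = s(3 := ?N - 0)) (WHILE 3 (SEQs [EMIT g, SUB 3 3 2]))
      (concat (map (\<lambda>i. [g']) [0..<?N])) (\<lambda>r. r = s(3 := ?N - ?N))"
  proof (rule hoare_WHILE)
    fix i assume "i < ?N"
    show "hoare 2 (\<lambda>r. r = s(3 := ?N - i)) (SEQs [EMIT g, SUB 3 3 2]) [g'] (\<lambda>r. r = s(3 := ?N - Suc i))"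
      by (rule hoare_basics_le) (use assms in \<open>auto simp: fun_upd_def\<close>)
  qed (use assms in auto)
  then have "\<exists>t. exec (WHILE 3 (SEQs [EMIT g, SUB 3 3 2])) (s(3 := ?N)) (s(3 := 0))
      (replicate ?N g') [] t \<and> t \<le> 1 + X * 3"
    unfolding hoare_def by (auto simp: concat_map_singleton map_replicate_const)
  then obtain t where t: "exec (WHILE 3 (SEQs [EMIT g, SUB 3 3 2])) (s(3 := ?N)) (s(3 := 0))
      (replicate ?N g') [] t" "t \<le> 1 + X * 3" by blast
  moreover have "exec (SUB 3 y 2) s (s(3 := ?N)) [] [] 1"
    using exec_SUB[of 3 y 2 s] assms(1) by simp
  ultimately have "exec (SEQ (SUB 3 y 2) (WHILE 3 (SEQs [EMIT g, SUB 3 3 2]))) s (s(3 := 0))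
      ([] @ replicate ?N g') ([] @ []) (1 + t)"
    by (intro exec_SEQ)
  then show ?thesis using t(2) by auto
qed

lemma exec_inverse_prog:
  assumes "s 2 = 1" "phase_order (map_gate (\<lambda>i. s (i + d)) g) \<le> X" "d \<ge> 4"
  shows "\<exists>s' t. exec (inverse_prog (map_gate (\<lambda>i. i + d) g)) s s'
             (inverse_gates (map_gate (\<lambda>i. s (i + d)) g)) [] t \<and> t \<le> 3 + 3 * X \<and>
           (\<forall>i. i \<noteq> 3 \<longrightarrow> s' i = s i)"
proof (cases g)
  case (Phase x y u)
  obtain i j where u: "u = (i, j)" by fastforce
  show ?thesis
    using exec_repeated_emission[of s "map_gate (\<lambda>i. i + d) g" "map_gate (\<lambda>i. s (i + d)) g" "y + d" X]
      assms unfolding Phase u by force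
next
  case (CPhase x y u v)
  obtain i j k l where u: "u = (i, j)" "v = (k, l)" by fastforce
  show ?thesis
    using exec_repeated_emission[of s "map_gate (\<lambda>i. i + d) g" "map_gate (\<lambda>i. s (i + d)) g" "y + d" X]
      assms unfolding CPhase u by force
next
  case (QFT n u)
  obtain i j where u: "u = (i, j)" by fastforce
  show ?thesis
    using exec_basics[of "replicate 3 (EMIT (map_gate (\<lambda>i. i + d) g))" s] unfolding QFT u
    by (intro exI[of _ s] exI[of _ 3]) (auto simp: numeral_3_eq_3)
next
  case (NOT u)
  then show ?thesis
    using exec_EMIT[of "map_gate (\<lambda>i. i + d) g" s]
    by (intro exI[of _ s] exI[of _ 1]) (cases u, auto)
next
  case (CNOT u v)
  then show ?thesis
    using exec_EMIT[of "map_gate (\<lambda>i. i + d) g" s]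
    by (intro exI[of _ s] exI[of _ 1]) (cases u, cases v, auto)
next
  case (Toffoli u v w)
  then show ?thesis
    using exec_EMIT[of "map_gate (\<lambda>i. i + d) g" s]
    by (intro exI[of _ s] exI[of _ 1]) (cases u, cases v, cases w, auto)
next
  case (Query u v w)
  then show ?thesis
    using exec_EMIT[of "map_gate (\<lambda>i. i + d) (QueryInv u v w)" s]
    by (intro exI[of _ s] exI[of _ 1]) (cases u, cases v, cases w, auto)
next
  case (QueryInv u v w)
  then show ?thesis
    using exec_EMIT[of "map_gate (\<lambda>i. i + d) (Query u v w)" s]
    by (intro exI[of _ s] exI[of _ 1]) (cases u, cases v, cases w, auto)
qed

text \<open>Register 0 counts down to the wanted gate: an emission is inverted when it finds the
  value 1, and dropped before that and once the value is 0. \<open>SET 3 0\<close> stands for doing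
  nothing.\<close>

definition select_prog :: "nat gate \<Rightarrow> program" where
  "select_prog g = COND 0 (SEQ (SUB 0 0 2) (COND 0 (SET 3 0) (inverse_prog g))) (SET 3 0)"

definition select_out :: "nat \<Rightarrow> nat gate \<Rightarrow> nat gate list" where
  "select_out c g = (if c = 1 then inverse_gates g else [])"

lemma emissions_select:
  "emissions select_out (\<lambda>c. c - 1) c gs =
     (if 1 \<le> c \<and> c \<le> length gs then inverse_gates (gs ! (c - 1)) else [])"
proof (induction gs arbitrary: c)
  case (Cons g gs)
  then show ?case by (cases c; cases "c - 1") (auto simp: select_out_def)
qed auto

lemma exec_select_prog:
  assumes "s 0 = c" "s 2 = 1" "phase_order (map_gate (\<lambda>i. s (i + 4)) g) \<le> X"
  shows "\<exists>s' t. exec (select_prog (map_gate (\<lambda>i. i + 4) g)) s s'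
             (select_out c (map_gate (\<lambda>i. s (i + 4)) g)) [] t \<and> t \<le> 6 + 3 * X \<and>
           s' 0 = c - 1 \<and> (\<forall>i. i \<noteq> 0 \<and> i \<noteq> 3 \<longrightarrow> s' i = s i)"
proof -
  let ?s = "s(0 := c - 1)"
  let ?p = "COND 0 (SET 3 0) (inverse_prog (map_gate (\<lambda>i. i + 4) g))"
  have sub: "exec (SUB 0 0 2) s ?s [] [] 1" using exec_SUB[of 0 0 2 s] assms by simp
  have in_seq: "\<exists>s' t. exec (select_prog (map_gate (\<lambda>i. i + 4) g)) s s'
      (select_out c (map_gate (\<lambda>i. s (i + 4)) g)) [] t \<and> t \<le> 6 + 3 * X \<and>
           s' 0 = c - 1 \<and> (\<forall>i. i \<noteq> 0 \<and> i \<noteq> 3 \<longrightarrow> s' i = s i)"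
    if "exec ?p ?s s' (select_out c (map_gate (\<lambda>i. s (i + 4)) g)) [] t" "t \<le> 4 + 3 * X"
      "\<forall>i. i \<noteq> 3 \<longrightarrow> s' i = ?s i" "c \<noteq> 0" for s' t
    using exec_COND_nonzero[OF _ exec_SEQ[OF sub that(1)], of 0 "SET 3 0"] that assms(1)
    unfolding select_prog_def by (intro exI[of _ s'] exI[of _ "Suc (1 + t)"]) auto
  consider "c = 0" | "c = 1" | "c > 1" by linarith
  then show ?thesis
  proof cases
    case 1
    have "exec (select_prog (map_gate (\<lambda>i. i + 4) g)) s (s(3 := 0)) [] [] (Suc 1)"
      unfolding select_prog_def by (rule exec_COND_zero) (use 1 assms exec_SET[of 3 0 s] in auto)
    then show ?thesis using 1 assms
      by (intro exI[of _ "s(3 := 0)"] exI[of _ "Suc 1"]) (auto simp: select_out_def)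
  next
    case 2
    obtain s' t where *: "exec (inverse_prog (map_gate (\<lambda>i. i + 4) g)) ?s s'
             (inverse_gates (map_gate (\<lambda>i. s (i + 4)) g)) [] t" "t \<le> 3 + 3 * X"
           "\<forall>i. i \<noteq> 3 \<longrightarrow> s' i = ?s i"
      using exec_inverse_prog[of ?s 4 g X] assms by auto
    have "exec ?p ?s s' (select_out c (map_gate (\<lambda>i. s (i + 4)) g)) [] (Suc t)"
      unfolding select_out_def using exec_COND_zero[OF _ *(1), of 0 "SET 3 0"] 2 by simp
    then show ?thesis by (rule in_seq) (use * 2 in auto)
  next
    case 3
    have "exec ?p ?s (?s(3 := 0)) (select_out c (map_gate (\<lambda>i. s (i + 4)) g)) [] (Suc 1)"
      unfolding select_out_def using exec_COND_nonzero[OF _ exec_SET[of 3 0 ?s], of 0] 3 by simp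
    then show ?thesis by (rule in_seq) (use 3 in auto)
  qed
qed

text \<open>
  The gates of \<open>p\<close> are counted first; then \<open>p\<close> is run once for every gate, from the last one to the
  first one, emitting only the inverse of that gate.
\<close>

definition inverse_of_prog :: "program \<Rightarrow> program" where
  "inverse_of_prog p = SEQ (SET 1 0) (SEQ (translate 4 (\<lambda>g. ADD 1 1 2) p)
     (WHILE 1 (SEQ (ADD 0 1 4) (SEQ (translate 4 select_prog p) (SUB 1 1 2)))))"

text \<open>\<open>p\<close> is run many times, so it has to restore its precondition, and
  \<open>A\<close> stands on both sides. \<open>zero\<close> makes register 4, the shifted register
  0 of \<open>p\<close>, available as a zero summand for copying; \<open>sat\<close> yields one
  actual run, by which the number of gates is at most \<open>T\<close>.\<close>

lemma hoare_inverse_of_prog: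
  assumes p: "hoare T A p gs A" and zero: "\<And>s. A s \<Longrightarrow> s 0 = 0" and sat: "A s0"
    and phases: "\<forall>g \<in> set gs. phase_order g \<le> X"
  shows "hoare (5 + T + T * (4 + T * (6 + 3 * X)))
     (\<lambda>s. s 2 = 1 \<and> A (\<lambda>i. s (i + 4))) (inverse_of_prog p) (inverse_circuit gs)
     (\<lambda>s. s 2 = 1 \<and> A (\<lambda>i. s (i + 4)))"
proof -
  let ?A = "\<lambda>s. A (\<lambda>i. s (i + 4))"
  let ?I = "\<lambda>i s. s 2 = 1 \<and> s 1 = length gs - i \<and> ?A s"
  have len: "length gs \<le> T"
    using p sat hoareE exec_length_gates le_trans by metis
  have A_upd: "A (\<lambda>i. (s(k := v)) (i + 4)) = A (\<lambda>i. s (i + 4))" if "k < 4" for s :: "nat \<Rightarrow> nat" and k v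
  proof -
    have "(\<lambda>i. (s(k := v)) (i + 4)) = (\<lambda>i. s (i + 4))" using that by auto
    then show ?thesis by simp
  qed
  have count: "hoare (T * 1) (\<lambda>s. (s 1 = 0 \<and> s 2 = 1) \<and> ?A s) (translate 4 (\<lambda>g. ADD 1 1 2) p)
      (emissions (\<lambda>_ _. []) Suc 0 gs) (\<lambda>s. (s 1 = (Suc ^^ length gs) 0 \<and> s 2 = 1) \<and> ?A s)"
  proof (rule hoare_translate[OF p, where J = "\<lambda>c s. s 1 = c \<and> s 2 = 1" and ok = "\<lambda>_. True"])
    fix \<gamma> s g assume "s 1 = \<gamma> \<and> s (2::nat) = (1::nat)"
    then show "\<exists>s' t. exec (ADD 1 1 2) s s' [] [] t \<and> t \<le> 1 \<and> (s' 1 = Suc \<gamma> \<and> s' 2 = 1) \<and>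
        (\<forall>i\<ge>4. s' i = s i)"
      using exec_ADD[of 1 1 2 s] by (intro exI[of _ "s(1 := Suc \<gamma>)"] exI[of _ 1]) auto
  qed auto
  have count_out: "emissions (\<lambda>_ _. []) Suc c gs = []" for c
    by (induction gs arbitrary: c) auto
  have select: "hoare (T * (6 + 3 * X)) (\<lambda>s. (s 0 = c \<and> s 1 = c' \<and> s 2 = 1) \<and> ?A s)
      (translate 4 select_prog p) (emissions select_out (\<lambda>c. c - 1) c gs)
      (\<lambda>s. (s 0 = ((\<lambda>c. c - 1) ^^ length gs) c \<and> s 1 = c' \<and> s 2 = 1) \<and> ?A s)" for c c'
  proof (rule hoare_translate[OF p, where J = "\<lambda>c s. s 0 = c \<and> s 1 = c' \<and> s 2 = 1"
        and ok = "\<lambda>g. phase_order g \<le> X"])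
    fix \<gamma> s g
    assume s: "s 0 = \<gamma> \<and> s 1 = c' \<and> s (2::nat) = (1::nat)" "phase_order (map_gate (\<lambda>i. s (i + 4)) g) \<le> X"
    obtain s' t where "exec (select_prog (map_gate (\<lambda>i. i + 4) g)) s s'
        (select_out \<gamma> (map_gate (\<lambda>i. s (i + 4)) g)) [] t" "t \<le> 6 + 3 * X" "s' 0 = \<gamma> - 1"
        "\<forall>i. i \<noteq> 0 \<and> i \<noteq> 3 \<longrightarrow> s' i = s i"
      using exec_select_prog[of s \<gamma> g X] s by blast
    then show "\<exists>s' t. exec (select_prog (map_gate (\<lambda>i. i + 4) g)) s s'
             (select_out \<gamma> (map_gate (\<lambda>i. s (i + 4)) g)) [] t \<and> t \<le> 6 + 3 * X \<and>
             (s' 0 = \<gamma> - 1 \<and> s' 1 = c' \<and> s' 2 = 1) \<and> (\<forall>i\<ge>4. s' i = s i)"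
      using s by (intro exI[of _ s'] exI[of _ t]) simp
  qed (use phases in auto)
  have body: "hoare (3 + T * (6 + 3 * X)) (?I i)
      (SEQ (ADD 0 1 4) (SEQ (translate 4 select_prog p) (SUB 1 1 2)))
      (inverse_gates (rev gs ! i)) (?I (Suc i))" if i: "i < length gs" for i
  proof (rule hoare_SEQ_le[where T = 1 and gs = "[]"])
    let ?c = "length gs - i"
    show "hoare 1 (?I i) (ADD 0 1 4) [] (\<lambda>s. (s 0 = ?c \<and> s 1 = ?c \<and> s 2 = 1) \<and> ?A s)"
      using hoare_basics_le[of "?I i" "[ADD 0 1 4]" "[]" "\<lambda>s. (s 0 = ?c \<and> s 1 = ?c \<and> s 2 = 1) \<and> ?A s" 1]
        zero by (fastforce simp: A_upd)
    have "emissions select_out (\<lambda>c. c - 1) ?c gs = inverse_gates (rev gs ! i)"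
      using i by (subst emissions_select) (simp add: rev_nth Suc_le_eq)
    then show "hoare (1 + T * (6 + 3 * X) + 1) (\<lambda>s. (s 0 = ?c \<and> s 1 = ?c \<and> s 2 = 1) \<and> ?A s)
        (SEQ (translate 4 select_prog p) (SUB 1 1 2)) (inverse_gates (rev gs ! i)) (?I (Suc i))"
      apply (intro hoare_SEQ_le[OF select, where T' = 1 and gs' = "[]"])
      subgoal using hoare_basics_le[of "\<lambda>s. (s 0 = ((\<lambda>c. c - 1) ^^ length gs) ?c \<and> s 1 = ?c \<and> s 2 = 1) \<and> ?A s"
            "[SUB 1 1 2]" "[]" "?I (Suc i)" 1] by (auto simp: A_upd)
      by auto
  qed auto
  have loop: "hoare (1 + T * (3 + T * (6 + 3 * X) + 1)) (?I 0)
      (WHILE 1 (SEQ (ADD 0 1 4) (SEQ (translate 4 select_prog p) (SUB 1 1 2))))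
      (concat (map (\<lambda>i. inverse_gates (rev gs ! i)) [0..<length gs])) (?I (length gs))"
    by (rule hoare_WHILE[where I = ?I, OF body]) (use len in auto)
  have "map (\<lambda>i. inverse_gates (rev gs ! i)) [0..<length gs] = map inverse_gates (rev gs)"
    by (rule nth_equalityI) auto
  then have gs: "inverse_circuit gs = [] @ emissions (\<lambda>_ _. []) Suc 0 gs @
      concat (map (\<lambda>i. inverse_gates (rev gs ! i)) [0..<length gs])"
    by (simp add: inverse_circuit_def count_out)
  have set: "hoare 1 (\<lambda>s. s 2 = 1 \<and> ?A s) (SET 1 0) [] (\<lambda>s. (s 1 = 0 \<and> s 2 = 1) \<and> ?A s)"
    using hoare_basics_le[of "\<lambda>s. s 2 = 1 \<and> ?A s" "[SET 1 0]" "[]" "\<lambda>s. (s 1 = 0 \<and> s 2 = 1) \<and> ?A s" 1]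
    by (auto simp: A_upd)
  have Suc: "(Suc ^^ k) 0 = k" for k by (induction k) auto
  show ?thesis
    unfolding inverse_of_prog_def gs
    by (rule hoare_conseq[OF hoare_SEQ[OF set hoare_SEQ[OF hoare_conseq[OF count _ _ order_refl refl] loop]]])
      (auto simp: Suc)
qed

text \<open>Plain queries use the same shift by 4 as inverted ones, so that both kinds start from
  the same constants in the same registers.\<close>

lemma hoare_shifted:
  assumes "hoare T A p gs B"
  shows "hoare T (\<lambda>s. s 2 = 1 \<and> A (\<lambda>i. s (i + 4))) (translate 4 EMIT p) gs
     (\<lambda>s. s 2 = 1 \<and> B (\<lambda>i. s (i + 4)))"
proof -
  have "hoare (T * 1) (\<lambda>s. s 2 = 1 \<and> A (\<lambda>i. s (i + 4))) (translate 4 EMIT p)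
     (emissions (\<lambda>_ g. [g]) (\<lambda>x. x) () gs) (\<lambda>s. s 2 = 1 \<and> B (\<lambda>i. s (i + 4)))"
  proof (rule hoare_translate[OF assms, where J = "\<lambda>_ s. s 2 = 1" and ok = "\<lambda>_. True"])
    fix s g assume "s (2::nat) = (1::nat)"
    have "map_gate s (map_gate (\<lambda>i. i + 4) g) = map_gate (\<lambda>i. s (i + 4)) g"
      by (cases g) (auto simp: prod.map_comp comp_def)
    then show "\<exists>s' t. exec (EMIT (map_gate (\<lambda>i. i + 4) g)) s s' [map_gate (\<lambda>i. s (i + 4)) g] [] t \<and>
        t \<le> 1 \<and> s' 2 = 1 \<and> (\<forall>i\<ge>4. s' i = s i)"
      using exec_EMIT[of "map_gate (\<lambda>i. i + 4) g" s] \<open>s 2 = 1\<close> by auto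
  qed auto
  moreover have "emissions (\<lambda>_ g. [g]) (\<lambda>x. x) () gs = gs" for gs by (induction gs) auto
  ultimately show ?thesis by simp
qed

text \<open>Registers 13 to 18 are the address registers 9 to 14 of \<open>query_prog\<close> under
  the shift by 4. Register 4 is its register 0 and holds zero, so these additions are
  copies.\<close>

fun simulation_prog :: "nat gate \<Rightarrow> program" where
  "simulation_prog (Query u v t) =
     SEQ (SEQs [ADD 13 (fst u) 4, ADD 14 (snd u) 4, ADD 15 (fst v) 4, ADD 16 (snd v) 4,
           ADD 17 (fst t) 4, ADD 18 (snd t) 4])
       (translate 4 EMIT query_prog)"
| "simulation_prog (QueryInv u v t) =
     SEQ (SEQs [ADD 13 (fst u) 4, ADD 14 (snd u) 4, ADD 15 (fst v) 4, ADD 16 (snd v) 4,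
           ADD 17 (fst t) 4, ADD 18 (snd t) 4])
       (inverse_of_prog query_prog)"
| "simulation_prog g = EMIT g"

definition sim_consts :: "nat \<Rightarrow> nat \<Rightarrow> nat \<Rightarrow> nat \<Rightarrow> (nat \<Rightarrow> nat) \<Rightarrow> bool" where
  "sim_consts m q w a s \<longleftrightarrow> s 2 = 1 \<and> s 4 = 0 \<and> s 5 = 1 \<and> s 6 = m \<and> s 7 = q \<and> s 8 = w \<and> s 9 = a \<and>
     s 10 = m * w \<and> s 11 = helpers m q w a \<and> s 12 = q - 1"

definition query_time :: "nat \<Rightarrow> nat" where
  "query_time X = 30 + 18 * X + X * (8 + 5 * X) + X * (8 + X * (8 + X * (21 + 36 * X)))"

definition simulation_time :: "nat \<Rightarrow> nat" where
  "simulation_time X = 12 + query_time X + query_time X * (4 + query_time X * (6 + 3 * X))"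

text \<open>The bound 46 leaves room for the shift by 4 below register 50, where the registers of
  the simulated decoder begin.\<close>

lemma written_query_prog: "written query_prog \<subseteq> {..<46}"
  by (simp add: query_prog_def fourier_prog_def copy_prog_def phase_prog_def cphase_prog_def
      cphase_inner_prog_def table_prog_def entry_prog_def chain_prog_def xor_prog_def)

lemma written_translate:
  "written p \<subseteq> {..<N} \<Longrightarrow> (\<And>g. written (f g) \<subseteq> {..<N + d}) \<Longrightarrow> written (translate d f p) \<subseteq> {..<N + d}"
  by (induction p) auto

lemma written_inverse_prog: "written (inverse_prog g) \<subseteq> {..<4}"
  by (cases g) auto

lemma written_simulation_prog: "written (simulation_prog g) \<subseteq> {..<50}"
proof -
  have "written (translate 4 EMIT query_prog) \<subseteq> {..<50}"
    using written_translate[OF written_query_prog, of EMIT 4] by simp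
  moreover have "written (translate 4 select_prog query_prog) \<subseteq> {..<50}"
    using written_translate[OF written_query_prog, of select_prog 4] written_inverse_prog
    unfolding select_prog_def by fastforce
  moreover have "written (translate 4 (\<lambda>g. ADD 1 1 2) query_prog) \<subseteq> {..<50}"
    using written_translate[OF written_query_prog, of "\<lambda>g. ADD 1 1 2" 4] by simp
  ultimately show ?thesis
    by (cases g) (simp_all add: inverse_of_prog_def)
qed

lemma phase_order_relocate [simp]: "phase_order (relocate f g) = phase_order g"
  by (cases g) auto

lemma phase_order_query_circuit:
  assumes "q \<ge> 1" "g \<in> set (query_circuit m q w a)"
  shows "phase_order g \<le> q"
  using assms
  by (auto simp: query_circuit_def fourier_layer_def copy_index_def phase_layer_def table_def
      table_entry_def Let_def match_chain_def xor_out_def split: if_splits)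

lemma exec_simulation_prog:
  assumes "sim_consts m q w a s"
    and "m \<le> X" "q \<le> X" "w \<le> X" "a \<le> X" "m * w \<le> X" "q \<ge> 2"
  shows "\<exists>s' t. exec (simulation_prog (map_gate (\<lambda>i. i + 50) g)) s s'
             (simulated_gates m q w a (map_gate (\<lambda>i. s (i + 50)) g)) [] t \<and>
           t \<le> simulation_time X \<and> sim_consts m q w a s' \<and> (\<forall>i\<ge>50. s' i = s i)"
proof -
  have time: "1 \<le> simulation_time X" "6 + query_time X \<le> simulation_time X"
    "6 + (5 + query_time X + query_time X * (4 + query_time X * (6 + 3 * X))) \<le> simulation_time X"
    by (auto simp: simulation_time_def)
  have frame: "\<forall>i\<ge>50. s' i = s i"
    if "exec (simulation_prog (map_gate (\<lambda>i. i + 50) g)) s s' gs ws t" for s' gs ws t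
    using exec_unwritten[OF that] written_simulation_prog[of "map_gate (\<lambda>i. i + 50) g"] by fastforce
  \<comment> \<open>Queries and inverse queries share the copying of the six address components;
    only the program \<open>p\<close> that follows differs.\<close>
  have query_case: "\<exists>s' t. exec (simulation_prog (map_gate (\<lambda>i. i + 50) g)) s s' gs [] t \<and>
           t \<le> simulation_time X \<and> sim_consts m q w a s' \<and> (\<forall>i\<ge>50. s' i = s i)"
    if g: "simulation_prog (map_gate (\<lambda>i. i + 50) g) =
       SEQ (SEQs [ADD 13 (fst u + 50) 4, ADD 14 (snd u + 50) 4, ADD 15 (fst v + 50) 4, ADD 16 (snd v + 50) 4,
           ADD 17 (fst t + 50) 4, ADD 18 (snd t + 50) 4]) p"
      and p: "hoare T (\<lambda>r. r 2 = 1 \<and> sim_env m q w a (map_prod (\<lambda>i. s (i + 50)) (\<lambda>i. s (i + 50)) u)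
          (map_prod (\<lambda>i. s (i + 50)) (\<lambda>i. s (i + 50)) v)
          (map_prod (\<lambda>i. s (i + 50)) (\<lambda>i. s (i + 50)) t) (\<lambda>i. r (i + 4))) p gs
          (\<lambda>r. r 2 = 1 \<and> sim_env m q w a (map_prod (\<lambda>i. s (i + 50)) (\<lambda>i. s (i + 50)) u)
          (map_prod (\<lambda>i. s (i + 50)) (\<lambda>i. s (i + 50)) v)
          (map_prod (\<lambda>i. s (i + 50)) (\<lambda>i. s (i + 50)) t) (\<lambda>i. r (i + 4)))"
      and T: "6 + T \<le> simulation_time X" for u v t p T gs
  proof -
    have "hoare (6 + T) (\<lambda>r. r = s) (simulation_prog (map_gate (\<lambda>i. i + 50) g)) gs (sim_consts m q w a)"
      unfolding g
    proof (rule hoare_SEQ_le[where T = 6 and gs = "[]"])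
      show "hoare T (\<lambda>r. r 2 = 1 \<and> sim_env m q w a (map_prod (\<lambda>i. s (i + 50)) (\<lambda>i. s (i + 50)) u)
          (map_prod (\<lambda>i. s (i + 50)) (\<lambda>i. s (i + 50)) v)
          (map_prod (\<lambda>i. s (i + 50)) (\<lambda>i. s (i + 50)) t) (\<lambda>i. r (i + 4))) p gs (sim_consts m q w a)"
        by (rule hoare_conseq[OF p]) (auto simp: sim_env_def sim_consts_def)
    qed ((rule hoare_basics_le; use assms(1) in \<open>auto simp: sim_env_def sim_consts_def prod_eq_iff\<close>), auto)
    then obtain s' t' where *: "exec (simulation_prog (map_gate (\<lambda>i. i + 50) g)) s s' gs [] t'"
        "t' \<le> 6 + T" "sim_consts m q w a s'" by (rule hoareE) simp
    then show ?thesis using frame[OF *(1)] T by (meson le_trans)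
  qed
  have phases: "\<forall>g \<in> set (query_circuit m q w a). phase_order g \<le> X"
    using phase_order_query_circuit[of q _ m w a] assms by (meson le_trans order.trans one_le_numeral)
  have emit: ?thesis if "simulation_prog (map_gate (\<lambda>i. i + 50) g) = EMIT (map_gate (\<lambda>i. i + 50) g)"
    "simulated_gates m q w a (map_gate (\<lambda>i. s (i + 50)) g) = [map_gate (\<lambda>i. s (i + 50)) g]"
  proof -
    have "map_gate s (map_gate (\<lambda>i. i + 50) g) = map_gate (\<lambda>i. s (i + 50)) g"
      by (cases g) (auto simp: prod.map_comp comp_def)
    then show ?thesis
      using exec_EMIT[of "map_gate (\<lambda>i. i + 50) g" s] assms(1) time(1) unfolding that by auto
  qed
  have sim: "hoare (query_time X) (sim_env m q w a u v t) query_prog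
      (map (relocate (place u v t)) (query_circuit m q w a)) (sim_env m q w a u v t)" for u v t
    unfolding query_time_def
    by (rule query_sim.query_prog) (use assms in \<open>auto simp: query_sim_def\<close>)
  \<comment> \<open>A register state satisfying \<open>sim_env\<close>, as required for inverting
    \<open>query_prog\<close>.\<close>
  have sat: "sim_env m q w a u v t (\<lambda>i. [0, 1, m, q, w, a, m * w, helpers m q w a, q - 1,
       fst u, snd u, fst v, snd v, fst t, snd t] ! i)" for u v t
    by (auto simp: sim_env_def)
  show ?thesis
  proof (cases g)
    case (Query u v t)
    let ?a = "\<lambda>u. map_prod (\<lambda>i. s (i + 50)) (\<lambda>i. s (i + 50)) u"
    have g: "simulated_gates m q w a (map_gate (\<lambda>i. s (i + 50)) g) =
        map (relocate (place (?a u) (?a v) (?a t))) (query_circuit m q w a)"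
      by (simp add: Query)
    show ?thesis unfolding g
      by (rule query_case[where u = u and v = v and t = t,
            OF _ hoare_shifted[OF sim[of "?a u" "?a v" "?a t"]] time(2)]) (simp add: Query)
  next
    case (QueryInv u v t)
    let ?a = "\<lambda>u. map_prod (\<lambda>i. s (i + 50)) (\<lambda>i. s (i + 50)) u"
    have g: "simulated_gates m q w a (map_gate (\<lambda>i. s (i + 50)) g) =
        inverse_circuit (map (relocate (place (?a u) (?a v) (?a t))) (query_circuit m q w a))"
      by (simp add: QueryInv)
    have inv: "hoare (5 + query_time X + query_time X * (4 + query_time X * (6 + 3 * X)))
       (\<lambda>r. r 2 = 1 \<and> sim_env m q w a (?a u) (?a v) (?a t) (\<lambda>i. r (i + 4))) (inverse_of_prog query_prog)
       (inverse_circuit (map (relocate (place (?a u) (?a v) (?a t))) (query_circuit m q w a)))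
       (\<lambda>r. r 2 = 1 \<and> sim_env m q w a (?a u) (?a v) (?a t) (\<lambda>i. r (i + 4)))"
      by (rule hoare_inverse_of_prog[OF sim[of "?a u" "?a v" "?a t"]])
        (simp add: sim_env_def, rule sat, simp add: phases)
    show ?thesis unfolding g
      by (rule query_case[where u = u and v = v and t = t, OF _ inv time(3)]) (simp add: QueryInv)
  qed (rule emit; simp)+
qed

lemma exec_simulation:
  assumes "exec P s s' gs ws t" "sim_consts m q w a r" "\<forall>i. r (i + 50) = s i"
    and "m \<le> X" "q \<le> X" "w \<le> X" "a \<le> X" "m * w \<le> X" "q \<ge> 2"
  shows "\<exists>r' t'. exec (translate 50 simulation_prog P) r r'
       (concat (map (simulated_gates m q w a) gs)) ws t' \<and> t' \<le> t * simulation_time X"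
proof -
  have "emissions (\<lambda>_. simulated_gates m q w a) (\<lambda>x. x) () gs = concat (map (simulated_gates m q w a) gs)"
    for gs by (induction gs) auto
  moreover have "\<exists>r' t'. exec (translate 50 simulation_prog P) r r'
       (emissions (\<lambda>_. simulated_gates m q w a) (\<lambda>x. x) () gs) ws t' \<and> t' \<le> t * simulation_time X \<and>
       sim_consts m q w a r' \<and> (\<forall>i. r' (i + 50) = s' i)"
  proof (rule exec_translate[OF assms(1), where ok = "\<lambda>_. True" and J = "\<lambda>_. sim_consts m q w a"])
    show "\<exists>s' t. exec (simulation_prog (map_gate (\<lambda>i. i + 50) g)) s s'
             (simulated_gates m q w a (map_gate (\<lambda>i. s (i + 50)) g)) [] t \<and>
             t \<le> simulation_time X \<and> sim_consts m q w a s' \<and> (\<forall>i\<ge>50. s' i = s i)"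
      if "sim_consts m q w a s" for s g
      using exec_simulation_prog[OF that assms(4-)] by blast
  qed (use assms(2,3) in \<open>auto simp: sim_consts_def simulation_time_def\<close>)
  ultimately show ?thesis by auto
qed

section \<open>Operators on embedded qubits\<close>

definition mat_mul :: "nat \<Rightarrow> operator \<Rightarrow> operator \<Rightarrow> operator" where
  "mat_mul n A B = (\<lambda>x y. \<Sum>z \<in> bitstrings n. A x z * B z y)"

definition mat_id :: operator where
  "mat_id = (\<lambda>x y. of_bool (x = y))"

lemma finite_bitstrings [simp, intro]: "finite (bitstrings k)"
  using finite_lists_length_eq[of "UNIV :: bool set" k] by (simp add: bitstrings_def)

lemma map_in_bitstrings [simp]: "map f ws \<in> bitstrings (length ws)"
  by (simp add: bitstrings_def)

lemma assign_bits_notin: "w \<notin> set ws \<Longrightarrow> assign_bits x ws bs w = x w"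
  by (auto simp: assign_bits_def dest: set_zip_leftD split: option.split dest!: map_of_SomeD)

text \<open>Over distinct qubits every bit string has the form \<open>map y ws\<close>, so this
  reduces assignments given by zipped lists to pointwise overriding.\<close>

lemma assign_bits_map: "assign_bits x ws (map y ws) = override_on x y (set ws)"
proof
  fix w show "assign_bits x ws (map y ws) w = override_on x y (set ws) w"
    by (cases "w \<in> set ws")
      (simp_all add: assign_bits_notin, simp add: assign_bits_def map_of_zip_map)
qed

lemma assign_bits_self [simp]: "assign_bits x ws (map x ws) = x"
  by (auto simp: assign_bits_map override_on_def)

lemma map_assign_bits:
  assumes "distinct ws" "bs \<in> bitstrings (length ws)"
  shows "map (assign_bits x ws bs) ws = bs"
  using assms by (auto intro!: nth_equalityI simp: assign_bits_def map_of_zip_nth bitstrings_def)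

lemma bitstring_as_map:
  fixes ws :: "qubit list"
  assumes "distinct ws" "bs \<in> bitstrings (length ws)"
  obtains y where "bs = map y ws"
  using map_assign_bits[OF assms] by metis

lemma assign_bits_assign_bits:
  assumes "distinct ws" "y \<in> bitstrings (length ws)" "z \<in> bitstrings (length ws)"
  shows "assign_bits (assign_bits x ws y) ws z = assign_bits x ws z"
proof -
  obtain y' z' where "y = map y' ws" "z = map z' ws" using assms bitstring_as_map by metis
  then show ?thesis by (auto simp: assign_bits_map override_on_def)
qed

lemma apply_op_cong:
  assumes "\<And>x y. x \<in> bitstrings (length ws) \<Longrightarrow> y \<in> bitstrings (length ws) \<Longrightarrow> A x y = B x y"
  shows "apply_op A ws = apply_op B ws"
  unfolding apply_op_def by (intro ext sum.cong refl) (simp add: assms)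

lemma apply_op_mat_mul:
  assumes "distinct ws"
  shows "apply_op A ws (apply_op B ws \<psi>) = apply_op (mat_mul (length ws) A B) ws \<psi>"
proof
  fix x
  have "apply_op A ws (apply_op B ws \<psi>) x = (\<Sum>y \<in> bitstrings (length ws). \<Sum>z \<in> bitstrings (length ws).
      A (map x ws) y * (B y z * \<psi> (assign_bits x ws z)))"
    unfolding apply_op_def
    by (intro sum.cong refl) (simp add: map_assign_bits[OF assms] assign_bits_assign_bits[OF assms] sum_distrib_left)
  also have "\<dots> = apply_op (mat_mul (length ws) A B) ws \<psi> x"
    unfolding apply_op_def mat_mul_def
    by (subst sum.swap) (simp add: sum_distrib_right mult.assoc)
  finally show "apply_op A ws (apply_op B ws \<psi>) x = apply_op (mat_mul (length ws) A B) ws \<psi> x" .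
qed

lemma apply_op_mat_id [simp]: "apply_op mat_id ws \<psi> = \<psi>"
proof
  fix x
  have "apply_op mat_id ws \<psi> x = (\<Sum>y \<in> bitstrings (length ws). if y = map x ws then \<psi> x else 0)"
    unfolding apply_op_def mat_id_def by (intro sum.cong) auto
  then show "apply_op mat_id ws \<psi> x = \<psi> x" by simp
qed

definition basis_state :: "(qubit \<Rightarrow> bool) \<Rightarrow> qstate" where
  "basis_state x = (\<lambda>y. of_bool (y = x))"

abbreviation at_bits :: "qubit list \<Rightarrow> bool list \<Rightarrow> qubit \<Rightarrow> bool" where
  "at_bits \<equiv> assign_bits (\<lambda>_. False)"

text \<open>Recovers matrix entries from the action on states; this leads back from identities
  between actions to identities between matrices.\<close>

lemma apply_op_basis_state:
  assumes "distinct ws" "X \<in> bitstrings (length ws)" "Y \<in> bitstrings (length ws)"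
  shows "apply_op A ws (basis_state (at_bits ws Y)) (at_bits ws X) = A X Y"
proof -
  have "at_bits ws Z = at_bits ws Y \<longleftrightarrow> Z = Y" if "Z \<in> bitstrings (length ws)" for Z
    using that assms map_assign_bits by metis
  then have "apply_op A ws (basis_state (at_bits ws Y)) (at_bits ws X) =
      (\<Sum>Z \<in> bitstrings (length ws). if Z = Y then A X Y else 0)"
    unfolding apply_op_def basis_state_def
    by (intro sum.cong refl) (simp add: map_assign_bits assign_bits_assign_bits assms)
  then show ?thesis using assms by simp
qed

text \<open>Expressed through the action on states, unitarity passes to products and embeddings
  without any computation with matrix sums.\<close>

lemma unitary_op_iff:
  assumes "distinct ws"
  shows "unitary_op (length ws) U \<longleftrightarrow>
    (\<forall>\<psi>. apply_op (adjoint_op U) ws (apply_op U ws \<psi>) = \<psi> \<and>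
         apply_op U ws (apply_op (adjoint_op U) ws \<psi>) = \<psi>)" (is "_ \<longleftrightarrow> ?R")
proof
  assume u: "unitary_op (length ws) U"
  have "apply_op (mat_mul (length ws) (adjoint_op U) U) ws = apply_op mat_id ws"
       "apply_op (mat_mul (length ws) U (adjoint_op U)) ws = apply_op mat_id ws"
    by (rule apply_op_cong; use u in \<open>simp add: unitary_op_def mat_mul_def mat_id_def\<close>)+
  then show ?R by (simp add: apply_op_mat_mul[OF assms])
next
  assume ?R
  then have "apply_op (mat_mul (length ws) (adjoint_op U) U) ws \<psi> = apply_op mat_id ws \<psi>"
       "apply_op (mat_mul (length ws) U (adjoint_op U)) ws \<psi> = apply_op mat_id ws \<psi>" for \<psi>
    by (simp_all add: apply_op_mat_mul[OF assms])
  then have "mat_mul (length ws) (adjoint_op U) U X Y = mat_id X Y"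
       "mat_mul (length ws) U (adjoint_op U) X Y = mat_id X Y"
    if "X \<in> bitstrings (length ws)" "Y \<in> bitstrings (length ws)" for X Y
    using apply_op_basis_state[OF assms that] by metis+
  then show "unitary_op (length ws) U" by (simp add: unitary_op_def mat_mul_def mat_id_def)
qed

lemma adjoint_mat_mul: "adjoint_op (mat_mul n A B) = mat_mul n (adjoint_op B) (adjoint_op A)"
  by (auto simp: adjoint_op_def mat_mul_def mult.commute intro!: ext)

lemma adjoint_mat_id [simp]: "adjoint_op mat_id = mat_id"
  by (auto simp: adjoint_op_def mat_id_def intro!: ext)

lemma adjoint_adjoint [simp]: "adjoint_op (adjoint_op A) = A"
  by (simp add: adjoint_op_def)

lemma distinct_block [simp]: "distinct (block w k)"
  by (auto simp: block_def distinct_map inj_on_def)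

lemma length_block [simp]: "length (block w k) = k"
  by (simp add: block_def)

lemma unitary_mat_mul:
  assumes "unitary_op n A" "unitary_op n B"
  shows "unitary_op n (mat_mul n A B)"
proof -
  let ?ws = "block (0, 0) n"
  have *: "unitary_op (length ?ws) A" "unitary_op (length ?ws) B" using assms by simp_all
  have mm: "apply_op (mat_mul n C D) ?ws \<psi> = apply_op C ?ws (apply_op D ?ws \<psi>)" for C D \<psi>
    using apply_op_mat_mul[of ?ws C D \<psi>] by simp
  have "unitary_op (length ?ws) (mat_mul n A B)"
    using *[unfolded unitary_op_iff[OF distinct_block]]
    unfolding unitary_op_iff[OF distinct_block] by (simp add: adjoint_mat_mul mm)
  then show ?thesis by simp
qed

text \<open>The matrix, on the qubits \<open>ws\<close>, of the tensor product of \<open>U\<close>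
  on \<open>vs\<close> with the identity on the other qubits of \<open>ws\<close>.\<close>

definition embed_op :: "qubit list \<Rightarrow> qubit list \<Rightarrow> operator \<Rightarrow> operator" where
  "embed_op ws vs U = (\<lambda>X Y. U (map (at_bits ws X) vs) (map (at_bits ws Y) vs) *
     of_bool (\<forall>w \<in> set ws - set vs. at_bits ws X w = at_bits ws Y w))"

lemma adjoint_embed: "adjoint_op (embed_op ws vs U) = embed_op ws vs (adjoint_op U)"
  by (intro ext) (simp add: adjoint_op_def embed_op_def, metis)

lemma assign_bits_map_image:
  assumes "inj_on f (set ws)" "w \<in> set ws"
  shows "assign_bits x (map f ws) (map h ws) (f w) = h w"
proof -
  have "map h ws = map (h \<circ> inv_into (set ws) f) (map f ws)"
    using assms(1) by (auto simp: inv_into_f_f)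
  then show ?thesis
    using assms by (simp only: assign_bits_map) (simp add: override_on_def inv_into_f_f)
qed

text \<open>Only strings that agree with \<open>x\<close> outside \<open>vs\<close> contribute, and
  these correspond to the strings on \<open>vs\<close>: restrict to \<open>vs\<close> one way, fill
  up with the bits of \<open>x\<close> the other way. The injection \<open>f\<close> places the
  relative qubits at actual addresses.\<close>

lemma apply_op_embed:
  assumes "distinct ws" "distinct vs" "set vs \<subseteq> set ws" "inj_on f (set ws)"
  shows "apply_op (embed_op ws vs U) (map f ws) \<psi> = apply_op U (map f vs) \<psi>"
proof
  fix x
  let ?B = "{Y \<in> bitstrings (length ws). \<forall>w \<in> set ws - set vs. x (f w) = at_bits ws Y w}"
  define X where "X = map (x \<circ> f) ws"
  have aX: "at_bits ws X w = x (f w)" if "w \<in> set ws" for w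
    using that by (simp add: X_def assign_bits_map override_on_def)
  have inj_vs: "inj_on f (set vs)" using assms(3,4) inj_on_subset by blast
  have "apply_op (embed_op ws vs U) (map f ws) \<psi> x =
      (\<Sum>Y \<in> bitstrings (length ws). embed_op ws vs U X Y * \<psi> (assign_bits x (map f ws) Y))"
    by (simp add: apply_op_def X_def comp_def)
  also have "\<dots> = (\<Sum>Y \<in> ?B. embed_op ws vs U X Y * \<psi> (assign_bits x (map f ws) Y))"
    by (rule sum.mono_neutral_right) (auto simp: embed_op_def aX)
  also have "\<dots> = (\<Sum>z \<in> bitstrings (length vs).
      U (map x (map f vs)) z * \<psi> (assign_bits x (map f vs) z))"
  proof (rule sum.reindex_bij_witness[where
        i = "\<lambda>z. map (assign_bits (x \<circ> f) vs z) ws" and j = "\<lambda>Y. map (at_bits ws Y) vs"])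
    fix Y assume Y: "Y \<in> ?B"
    then obtain y where y: "Y = map y ws" using assms(1) bitstring_as_map by blast
    have ay: "at_bits ws Y w = y w" if "w \<in> set ws" for w
      using that by (simp add: y assign_bits_map override_on_def)
    show "map (assign_bits (x \<circ> f) vs (map (at_bits ws Y) vs)) ws = Y"
      using Y ay by (auto simp: assign_bits_map override_on_def y)
    show "map (at_bits ws Y) vs \<in> bitstrings (length vs)" by simp
    have X: "map x (map f vs) = map (at_bits ws X) vs" using assms(3) aX by auto
    have "\<forall>w \<in> set ws - set vs. at_bits ws X w = at_bits ws Y w" using Y aX by simp
    moreover have "assign_bits x (map f vs) (map (at_bits ws Y) vs) p = assign_bits x (map f ws) Y p" for p
    proof -
      consider w where "w \<in> set vs" "p = f w" | w where "w \<in> set ws - set vs" "p = f w" | "p \<notin> f ` set ws"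
        by blast
      then show ?thesis
      proof cases
        case 1
        moreover have "w \<in> set ws" using 1 assms(3) by blast
        ultimately show ?thesis
          using assign_bits_map_image[OF inj_vs, of w x "at_bits ws Y"]
            assign_bits_map_image[OF assms(4), of w x y] ay[of w] y by simp
      next
        case 2
        then have "p \<notin> f ` set vs" using assms(3,4) by (auto simp: inj_on_def)
        then show ?thesis using 2 assms(4) Y ay by (auto simp: assign_bits_map_image assign_bits_notin y)
      next
        case 3
        then have "p \<notin> f ` set vs" using assms(3) by blast
        then show ?thesis using 3 by (simp add: assign_bits_notin)
      qed
    qed
    then have "assign_bits x (map f vs) (map (at_bits ws Y) vs) = assign_bits x (map f ws) Y" by blast
    ultimately show "U (map x (map f vs)) (map (at_bits ws Y) vs) *
        \<psi> (assign_bits x (map f vs) (map (at_bits ws Y) vs)) =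
        embed_op ws vs U X Y * \<psi> (assign_bits x (map f ws) Y)"
      unfolding X embed_op_def by simp
  next
    fix z assume z: "z \<in> bitstrings (length vs)"
    let ?g = "assign_bits (x \<circ> f) vs z"
    have *: "at_bits ws (map ?g ws) w = ?g w" if "w \<in> set ws" for w
      using that by (simp add: assign_bits_map override_on_def)
    have "map (at_bits ws (map ?g ws)) vs = map ?g vs" using assms(3) * by auto
    then show "map (at_bits ws (map ?g ws)) vs = z" using map_assign_bits[OF assms(2) z] by simp
    show "map ?g ws \<in> ?B" using * by (auto simp: assign_bits_notin)
  qed
  finally show "apply_op (embed_op ws vs U) (map f ws) \<psi> x = apply_op U (map f vs) \<psi> x"
    by (simp add: apply_op_def)
qed

lemma unitary_embed:
  assumes "distinct ws" "distinct vs" "set vs \<subseteq> set ws" "unitary_op (length vs) U"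
  shows "unitary_op (length ws) (embed_op ws vs U)"
  using assms(4) apply_op_embed[OF assms(1-3) inj_on_id]
  unfolding unitary_op_iff[OF assms(1)] unitary_op_iff[OF assms(2)] by (simp add: adjoint_embed)

section \<open>Circuits as matrices, and their relocation\<close>

definition run_gates :: "('x, 'i, 's) block_code \<Rightarrow> nat \<Rightarrow> operator \<Rightarrow> nat gate list \<Rightarrow> qstate \<Rightarrow> qstate" where
  "run_gates C l Q gs = fold (\<lambda>g. apply_op (gate_op Q g) (gate_qubits C l g)) gs"

lemma run_gates_simps [simp]:
  "run_gates C l Q [] \<psi> = \<psi>"
  "run_gates C l Q (g # gs) \<psi> = run_gates C l Q gs (apply_op (gate_op Q g) (gate_qubits C l g) \<psi>)"
  "run_gates C l Q (gs @ gs') \<psi> = run_gates C l Q gs' (run_gates C l Q gs \<psi>)"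
  by (simp_all add: run_gates_def)

text \<open>The simulated oracle has to be one matrix, the same for all addresses at which it is
  queried; it is therefore built on the relative qubits.\<close>

fun circuit_mat :: "('x, 'i, 's) block_code \<Rightarrow> nat \<Rightarrow> operator \<Rightarrow> qubit list \<Rightarrow> nat gate list \<Rightarrow> operator" where
  "circuit_mat C l Q ws [] = mat_id"
| "circuit_mat C l Q ws (g # gs) = mat_mul (length ws) (circuit_mat C l Q ws gs)
     (embed_op ws (gate_qubits C l g) (gate_op Q g))"

text \<open>Blocks are addressed by their first qubit alone, so a relocation must commute with
  column shifts in order to send blocks to blocks.\<close>

definition shift_map :: "(qubit \<Rightarrow> qubit) \<Rightarrow> bool" where
  "shift_map f \<longleftrightarrow> (\<forall>r c i. f (r, c + i) = (fst (f (r, c)), snd (f (r, c)) + i))"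

lemma map_block: "shift_map f \<Longrightarrow> map f (block u k) = block (f u) k"
  by (cases u) (auto simp: block_def shift_map_def)

lemma gate_qubits_relocate:
  "shift_map f \<Longrightarrow> gate_qubits C l (relocate f g) = map f (gate_qubits C l g)"
  by (cases g) (auto simp: map_block)

lemma gate_op_relocate [simp]: "gate_op Q (relocate f g) = gate_op Q g"
  by (cases g) auto

lemma shift_map_place: "shift_map (place u v w)"
  by (auto simp: shift_map_def place_def Let_def)

text \<open>Gate by gate: embedding a gate into the relative qubits and placing these by
  \<open>f\<close> has the same action as the relocated gate.\<close>

theorem run_relocated_gates:
  assumes "distinct ws" "inj_on f (set ws)" "shift_map f"
    and "\<forall>g \<in> set gs. set (gate_qubits C l g) \<subseteq> set ws \<and> distinct (gate_qubits C l g)"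
  shows "run_gates C l Q (map (relocate f) gs) \<psi> = apply_op (circuit_mat C l Q ws gs) (map f ws) \<psi>"
  using assms(4)
proof (induction gs arbitrary: \<psi>)
  case (Cons g gs)
  have d: "distinct (map f ws)" using assms by (simp add: distinct_map)
  have "run_gates C l Q (map (relocate f) (g # gs)) \<psi> =
     apply_op (circuit_mat C l Q ws gs) (map f ws)
       (apply_op (gate_op Q g) (map f (gate_qubits C l g)) \<psi>)"
    using Cons by (simp add: gate_qubits_relocate[OF assms(3)])
  also have "\<dots> = apply_op (circuit_mat C l Q ws gs) (map f ws)
       (apply_op (embed_op ws (gate_qubits C l g) (gate_op Q g)) (map f ws) \<psi>)"
    using Cons.prems by (subst apply_op_embed) (use assms in auto)
  finally show ?case by (simp add: apply_op_mat_mul[OF d])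
qed simp

lemma run_gates_circuit_mat:
  assumes "distinct ws"
    and "\<forall>g \<in> set gs. set (gate_qubits C l g) \<subseteq> set ws \<and> distinct (gate_qubits C l g)"
  shows "run_gates C l Q gs \<psi> = apply_op (circuit_mat C l Q ws gs) ws \<psi>"
proof -
  have "relocate id g = g" for g by (cases g) auto
  then have "map (relocate id) gs = gs" by (simp add: map_idI)
  then show ?thesis
    using run_relocated_gates[OF assms(1) inj_on_id _ assms(2), of Q \<psi>] by (simp add: shift_map_def)
qed

lemma circuit_mat_entry:
  assumes "distinct ws" "X \<in> bitstrings (length ws)" "Y \<in> bitstrings (length ws)"
    and "\<forall>g \<in> set gs. set (gate_qubits C l g) \<subseteq> set ws \<and> distinct (gate_qubits C l g)"
  shows "circuit_mat C l Q ws gs X Y = run_gates C l Q gs (basis_state (at_bits ws Y)) (at_bits ws X)"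
  using apply_op_basis_state[OF assms(1-3)] by (simp add: run_gates_circuit_mat[OF assms(1,4)])

lemma unitary_circuit_mat:
  assumes "distinct ws"
    and "\<forall>g \<in> set gs. set (gate_qubits C l g) \<subseteq> set ws \<and> distinct (gate_qubits C l g) \<and>
           unitary_op (length (gate_qubits C l g)) (gate_op Q g)"
  shows "unitary_op (length ws) (circuit_mat C l Q ws gs)"
  using assms(2)
proof (induction gs)
  case Nil
  then show ?case using unitary_op_iff[OF assms(1), of mat_id] by simp
next
  case (Cons g gs)
  then show ?case using assms(1) by (auto intro!: unitary_mat_mul unitary_embed)
qed

theorem run_inverse_circuit:
  assumes "distinct ws" "inj_on f (set ws)" "shift_map f"
    and "\<forall>g \<in> set gs. set (gate_qubits C l g) \<subseteq> set ws \<and> distinct (gate_qubits C l g)"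
    and inv: "\<And>g \<psi>. g \<in> set gs \<Longrightarrow> run_gates C l Q (inverse_gates (relocate f g)) \<psi> =
          apply_op (adjoint_op (gate_op Q g)) (map f (gate_qubits C l g)) \<psi>"
  shows "run_gates C l Q (inverse_circuit (map (relocate f) gs)) \<psi> =
     apply_op (adjoint_op (circuit_mat C l Q ws gs)) (map f ws) \<psi>"
  using assms(4,5)
proof (induction gs)
  case Nil
  then show ?case by (simp add: inverse_circuit_def)
next
  case (Cons g gs)
  have d: "distinct (map f ws)" using assms by (simp add: distinct_map)
  have IH: "run_gates C l Q (inverse_circuit (map (relocate f) gs)) \<psi> =
     apply_op (adjoint_op (circuit_mat C l Q ws gs)) (map f ws) \<psi>"
    by (rule Cons.IH) (use Cons.prems in auto)
  have "run_gates C l Q (inverse_circuit (map (relocate f) (g # gs))) \<psi> =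
     apply_op (adjoint_op (gate_op Q g)) (map f (gate_qubits C l g))
       (apply_op (adjoint_op (circuit_mat C l Q ws gs)) (map f ws) \<psi>)"
    using Cons.prems(2)[of g] IH by (simp add: inverse_circuit_def)
  also have "\<dots> = apply_op (embed_op ws (gate_qubits C l g) (adjoint_op (gate_op Q g))) (map f ws)
       (apply_op (adjoint_op (circuit_mat C l Q ws gs)) (map f ws) \<psi>)"
    using Cons.prems(1) by (subst apply_op_embed) (use assms in auto)
  finally show ?case
    using apply_op_mat_mul[OF d] by (simp add: adjoint_mat_mul adjoint_embed)
qed

section \<open>Gates\<close>

definition bits_val :: "bool list \<Rightarrow> nat" where
  "bits_val bs = horner_sum of_bool 2 bs"

lemma le_power_digit_width: "d \<le> 2 ^ digit_width d"
proof -
  have "d \<le> 2 ^ d" by (simp add: less_imp_le)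
  then show ?thesis unfolding digit_width_def by (rule LeastI)
qed

lemma length_digit_bits [simp]: "length (digit_bits d i) = digit_width d"
  by (simp add: digit_bits_def)

lemma digit_bits_in_bitstrings [simp]: "digit_bits d i \<in> bitstrings (digit_width d)"
  by (simp add: bitstrings_def)

lemma bits_val_digit_bits: "i < d \<Longrightarrow> bits_val (digit_bits d i) = i"
  unfolding bits_val_def digit_bits_def horner_sum_bit_eq_take_bit
  using le_power_digit_width[of d] by (intro take_bit_nat_eq_self) simp

lemma bits_of_bits_val: "bs \<in> bitstrings k \<Longrightarrow> map (bit (bits_val bs)) [0..<k] = bs"
  by (auto simp: bits_val_def bitstrings_def bit_horner_sum_bit_iff intro!: nth_equalityI)

lemma digit_bits_bits_val: "bs \<in> bitstrings (digit_width d) \<Longrightarrow> digit_bits d (bits_val bs) = bs"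
  unfolding digit_bits_def by (rule bits_of_bits_val)

lemma bits_val_inj:
  assumes "x \<in> bitstrings k" "y \<in> bitstrings k"
  shows "bits_val x = bits_val y \<longleftrightarrow> x = y"
proof
  assume e: "bits_val x = bits_val y"
  have "map (bit (bits_val x)) [0..<k] = map (bit (bits_val y)) [0..<k]" by (simp only: e)
  then show "x = y" by (simp only: bits_of_bits_val[OF assms(1)] bits_of_bits_val[OF assms(2)])
qed simp

lemma digit_bits_inj: "i < d \<Longrightarrow> j < d \<Longrightarrow> digit_bits d i = digit_bits d j \<longleftrightarrow> i = j"
  by (metis bits_val_digit_bits)

lemma sum_bitstrings_digits:
  assumes "\<And>z. z \<in> bitstrings (digit_width d) \<Longrightarrow> bits_val z \<ge> d \<Longrightarrow> g z = 0"
  shows "(\<Sum>z \<in> bitstrings (digit_width d). g z) = (\<Sum>i<d. g (digit_bits d i))"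
proof -
  have "(\<Sum>z \<in> bitstrings (digit_width d). g z) = (\<Sum>z \<in> {z \<in> bitstrings (digit_width d). bits_val z < d}. g z)"
    by (rule sum.mono_neutral_right) (use assms in \<open>auto simp: not_less\<close>)
  also have "\<dots> = (\<Sum>i<d. g (digit_bits d i))"
    by (rule sum.reindex_bij_witness[where i = "digit_bits d" and j = bits_val])
      (auto simp: bits_val_digit_bits digit_bits_bits_val)
  finally show ?thesis .
qed

lemma sum_bitstrings_delta:
  "y \<in> bitstrings k \<Longrightarrow> (\<Sum>z \<in> bitstrings k. of_bool (z = y) * g z) = (g y :: complex)"
  "y \<in> bitstrings k \<Longrightarrow> (\<Sum>z \<in> bitstrings k. of_bool (y = z) * g z) = (g y :: complex)"
  by (subst sum.remove[of _ y]; auto intro!: sum.neutral)+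

section \<open>The Fourier transform modulo \<open>d\<close>\<close>

lemma cis_fraction_power: "d \<ge> 1 \<Longrightarrow> cis (2 * pi * (real_of_int k / real d)) ^ d = 1"
  by (simp add: DeMoivre)

lemma cis_fraction_eq_1:
  assumes "d \<ge> 1"
  shows "cis (2 * pi * (real_of_int k / real d)) = 1 \<longleftrightarrow> int d dvd k"
proof
  assume "cis (2 * pi * (real_of_int k / real d)) = 1"
  then have "cos (2 * pi * (real_of_int k / real d)) = 1" by (simp add: complex_eq_iff)
  then obtain n :: int where "2 * pi * (real_of_int k / real d) = real_of_int n * 2 * pi"
    using cos_one_2pi_int by blast
  then have "real_of_int k = real_of_int (n * int d)" using assms by (simp add: field_simps)
  then have "k = n * int d" using of_int_eq_iff by blast
  then show "int d dvd k" by simp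
next
  assume "int d dvd k"
  then obtain n where "k = int d * n" by blast
  then show "cis (2 * pi * (real_of_int k / real d)) = 1" using assms by simp
qed

lemma sum_roots_of_unity:
  assumes "d \<ge> 1"
  shows "(\<Sum>i<d. cis (2 * pi * (real_of_int (int i * k) / real d))) = (if int d dvd k then of_nat d else 0)"
proof -
  let ?z = "cis (2 * pi * (real_of_int k / real d))"
  have "cis (2 * pi * (real_of_int (int i * k) / real d)) = ?z ^ i" for i
    by (simp add: DeMoivre algebra_simps)
  then have *: "(\<Sum>i<d. cis (2 * pi * (real_of_int (int i * k) / real d))) = (\<Sum>i<d. ?z ^ i)" by simp
  show ?thesis
  proof (cases "int d dvd k")
    case True
    then have "?z = 1" using cis_fraction_eq_1[OF assms] by blast
    then show ?thesis unfolding * using True by simp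
  next
    case False
    then have "?z \<noteq> 1" using cis_fraction_eq_1[OF assms] by blast
    then show ?thesis unfolding * using False cis_fraction_power[OF assms] by (simp add: geometric_sum)
  qed
qed

lemma qft_op_eq:
  "qft_op d x y = (if bits_val x < d \<and> bits_val y < d
     then cis (2 * pi * (real (bits_val x * bits_val y) / real d)) / complex_of_real (sqrt (real d))
     else of_bool (x = y))"
  by (simp add: qft_op_def bits_val_def Let_def)

lemma qft_op_digits:
  "i < d \<Longrightarrow> j < d \<Longrightarrow>
     qft_op d (digit_bits d i) (digit_bits d j) = cis (2 * pi * (real (i * j) / real d)) / complex_of_real (sqrt (real d))"
  by (simp add: qft_op_eq bits_val_digit_bits)

lemma complex_sqrt_mult_self: "complex_of_real (sqrt (real d)) * complex_of_real (sqrt (real d)) = of_nat d"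
  by (simp flip: of_real_mult)

text \<open>The row \<open>A\<close> is a character with an integer frequency \<open>k\<close>: the
  frequency \<open>x\<close> gives the square of the transform, the frequency \<open>-x\<close> its
  product with the adjoint.\<close>

lemma qft_product_valid:
  assumes "d \<ge> 1" "\<And>z. z < d \<Longrightarrow> A (digit_bits d z) =
       cis (2 * pi * (real_of_int (k * int z) / real d)) / complex_of_real (sqrt (real d))"
    and "\<And>z. z \<in> bitstrings (digit_width d) \<Longrightarrow> bits_val z \<ge> d \<Longrightarrow> A z = 0" and "j < d"
  shows "(\<Sum>z \<in> bitstrings (digit_width d). A z * qft_op d z (digit_bits d j)) =
           of_bool (int d dvd k + int j)"
proof -
  have "(\<Sum>z \<in> bitstrings (digit_width d). A z * qft_op d z (digit_bits d j)) =
      (\<Sum>i<d. A (digit_bits d i) * qft_op d (digit_bits d i) (digit_bits d j))"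
    by (rule sum_bitstrings_digits) (simp add: assms)
  also have "\<dots> = (\<Sum>i<d. cis (2 * pi * (real_of_int (int i * (k + int j)) / real d))) / of_nat d"
    unfolding sum_divide_distrib
    by (rule sum.cong) (auto simp: assms qft_op_digits cis_mult complex_sqrt_mult_self add_divide_distrib algebra_simps)
  also have "\<dots> = of_bool (int d dvd k + int j)"
    using assms(1) by (subst sum_roots_of_unity) auto
  finally show ?thesis .
qed

text \<open>The square of the transform is the permutation \<open>j \<mapsto> -j\<close> modulo
  \<open>d\<close>, and the identity on strings that encode no residue.\<close>

lemma qft_op_square:
  assumes "d \<ge> 1" "x \<in> bitstrings (digit_width d)" "y \<in> bitstrings (digit_width d)"
  shows "mat_mul (digit_width d) (qft_op d) (qft_op d) x y =
    (if bits_val x < d \<and> bits_val y < d then of_bool (d dvd bits_val x + bits_val y) else of_bool (x = y))"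
proof (cases "bits_val x < d \<and> bits_val y < d")
  case True
  have "(\<Sum>z \<in> bitstrings (digit_width d). qft_op d x z * qft_op d z (digit_bits d (bits_val y))) =
      of_bool (int d dvd int (bits_val x) + int (bits_val y))"
    by (rule qft_product_valid) (use True assms in \<open>auto simp: qft_op_eq bits_val_digit_bits\<close>)
  then show ?thesis
    unfolding mat_mul_def digit_bits_bits_val[OF assms(3)] using True
    by (simp flip: of_nat_add add: int_dvd_int_iff)
next
  case False
  have "qft_op d x z * qft_op d z y = of_bool (z = x) * of_bool (x = y)" if "z \<in> bitstrings (digit_width d)" for z
    using False by (auto simp: qft_op_eq)
  then show ?thesis unfolding if_not_P[OF False] using assms by (simp add: mat_mul_def sum_bitstrings_delta)
qed

lemma mat_mul_apply: "mat_mul n A B x y = (\<Sum>z \<in> bitstrings n. A x z * B z y)"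
  by (simp add: mat_mul_def)

text \<open>The square negates the row index, and negating the row index of the transform conjugates
  its entries. As the matrix is symmetric, this is the adjoint.\<close>

lemma qft_op_cube:
  assumes "d \<ge> 1" "x \<in> bitstrings (digit_width d)" "y \<in> bitstrings (digit_width d)"
  shows "mat_mul (digit_width d) (mat_mul (digit_width d) (qft_op d) (qft_op d)) (qft_op d) x y =
     adjoint_op (qft_op d) x y"
proof (cases "bits_val x < d")
  case True
  \<comment> \<open>The representative of \<open>-x\<close> below \<open>d\<close>; the outer
    \<open>mod\<close> covers \<open>x = 0\<close>.\<close>
  define i where "i = (d - bits_val x) mod d"
  have i: "i < d" using assms by (simp add: i_def)
  have neg: "d dvd bits_val x + j \<longleftrightarrow> j = i" if "j < d" for j
  proof -
    have "d dvd bits_val x + i"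
    proof (cases "bits_val x = 0")
      case False
      then show ?thesis using True by (simp add: i_def)
    qed (simp add: i_def)
    moreover have "j = i" if "d dvd bits_val x + j" "d dvd bits_val x + i"
    proof -
      have "int d dvd int (bits_val x + j) - int (bits_val x + i)"
        using that by (intro dvd_diff) (simp_all add: int_dvd_int_iff del: of_nat_add)
      then have "int d dvd int j - int i" by simp
      then show ?thesis using \<open>j < d\<close> i dvd_imp_le_int[of "int j - int i" "int d"] by linarith
    qed
    ultimately show ?thesis by blast
  qed
  have select: "mat_mul (digit_width d) (qft_op d) (qft_op d) x z * qft_op d z y =
      of_bool (z = digit_bits d i) * qft_op d z y" if z: "z \<in> bitstrings (digit_width d)" for z
  proof (cases "bits_val z < d")
    case less: True
    have "z = digit_bits d i \<longleftrightarrow> bits_val z = i"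
      using z i by (metis bits_val_digit_bits digit_bits_bits_val)
    then show ?thesis using True less neg by (simp add: qft_op_square[OF assms(1,2) z])
  next
    case False
    then have "z \<noteq> digit_bits d i" "x \<noteq> z" using i True by (auto simp: bits_val_digit_bits)
    then show ?thesis using False by (simp add: qft_op_square[OF assms(1,2) z])
  qed
  have *: "mat_mul (digit_width d) (mat_mul (digit_width d) (qft_op d) (qft_op d)) (qft_op d) x y =
      qft_op d (digit_bits d i) y"
    unfolding mat_mul_apply[of _ "mat_mul (digit_width d) (qft_op d) (qft_op d)"]
    by (rule trans[OF sum.cong[OF refl select] sum_bitstrings_delta(1)]) simp_all
  show ?thesis
  proof (cases "bits_val y < d")
    case y: True
    let ?j = "bits_val y"
    obtain n where n: "bits_val x + i = d * n" using neg[OF i] by blast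
    have "real (i * ?j) / real d = real (n * ?j) - real (bits_val x * ?j) / real d"
    proof -
      have "real i = real d * real n - real (bits_val x)" using n by (metis add_diff_cancel_left' of_nat_add of_nat_mult)
      then have "real i * real ?j = (real d * real n - real (bits_val x)) * real ?j" by simp
      then show ?thesis using assms(1) by (simp add: field_simps)
    qed
    then have "cis (2 * pi * (real (i * ?j) / real d)) = cis (- (2 * pi * (real (bits_val x * ?j) / real d)))"
      using cis_multiple_2pi[of "real (n * ?j)"] by (simp add: right_diff_distrib flip: cis_divide)
        (simp add: divide_complex_def)
    then show ?thesis
      using * True y i by (simp add: adjoint_op_def qft_op_eq bits_val_digit_bits cis_cnj mult.commute)
  next
    case False
    then have "digit_bits d i \<noteq> y" "x \<noteq> y" using i True by (auto simp: bits_val_digit_bits)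
    then show ?thesis using * False by (simp add: adjoint_op_def qft_op_eq)
  qed
next
  case False
  then have select: "mat_mul (digit_width d) (qft_op d) (qft_op d) x z * qft_op d z y =
      of_bool (z = x) * qft_op d z y" if "z \<in> bitstrings (digit_width d)" for z
    using that by (simp add: qft_op_square[OF assms(1,2)])
  have "mat_mul (digit_width d) (mat_mul (digit_width d) (qft_op d) (qft_op d)) (qft_op d) x y =
      qft_op d x y"
    unfolding mat_mul_apply[of _ "mat_mul (digit_width d) (qft_op d) (qft_op d)"]
    by (rule trans[OF sum.cong[OF refl select] sum_bitstrings_delta(1)]) (simp_all add: assms)
  then show ?thesis using False by (auto simp: adjoint_op_def qft_op_eq)
qed

lemma adjoint_qft_mul_qft:
  assumes "d \<ge> 1" "x \<in> bitstrings (digit_width d)" "y \<in> bitstrings (digit_width d)"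
  shows "mat_mul (digit_width d) (adjoint_op (qft_op d)) (qft_op d) x y = mat_id x y"
proof (cases "bits_val x < d \<and> bits_val y < d")
  case True
  have "(\<Sum>z \<in> bitstrings (digit_width d). adjoint_op (qft_op d) x z * qft_op d z (digit_bits d (bits_val y))) =
      of_bool (int d dvd - int (bits_val x) + int (bits_val y))"
    by (rule qft_product_valid)
      (use True assms in \<open>auto simp: adjoint_op_def qft_op_eq bits_val_digit_bits cis_cnj mult.commute\<close>)
  moreover have "int d dvd - int (bits_val x) + int (bits_val y) \<longleftrightarrow> x = y"
  proof
    assume "int d dvd - int (bits_val x) + int (bits_val y)"
    then have "- int (bits_val x) + int (bits_val y) = 0"
      using True dvd_imp_le_int[of "- int (bits_val x) + int (bits_val y)" "int d"] by linarith
    then show "x = y" using bits_val_inj assms by auto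
  qed auto
  ultimately show ?thesis
    unfolding mat_mul_def mat_id_def digit_bits_bits_val[OF assms(3)] by simp
next
  case False
  have "adjoint_op (qft_op d) x z * qft_op d z y = of_bool (z = x) * of_bool (x = y)" for z
    using False by (auto simp: qft_op_eq adjoint_op_def)
  then show ?thesis using False assms by (simp add: mat_mul_def sum_bitstrings_delta mat_id_def)
qed

lemma qft_op_sym: "qft_op d x y = qft_op d y x"
  by (auto simp: qft_op_eq mult.commute)

lemma unitary_qft_op:
  assumes "d \<ge> 1"
  shows "unitary_op (digit_width d) (qft_op d)"
proof -
  have "(\<Sum>z\<in>bitstrings (digit_width d). qft_op d x z * adjoint_op (qft_op d) z y) =
      (\<Sum>z\<in>bitstrings (digit_width d). adjoint_op (qft_op d) y z * qft_op d z x)" for x y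
    by (intro sum.cong) (auto simp: adjoint_op_def qft_op_sym mult.commute)
  then show ?thesis
    using adjoint_qft_mul_qft[OF assms] by (auto simp: unitary_op_def mat_mul_def mat_id_def)
qed

lemma qft_cubed_is_adjoint:
  assumes "d \<ge> 1"
  shows "apply_op (qft_op d) (block u (digit_width d)) (apply_op (qft_op d) (block u (digit_width d))
     (apply_op (qft_op d) (block u (digit_width d)) \<psi>)) =
     apply_op (adjoint_op (qft_op d)) (block u (digit_width d)) \<psi>"
proof -
  let ?ws = "block u (digit_width d)"
  have "apply_op (mat_mul (digit_width d) (mat_mul (digit_width d) (qft_op d) (qft_op d)) (qft_op d)) ?ws =
      apply_op (adjoint_op (qft_op d)) ?ws"
    by (rule apply_op_cong) (use qft_op_cube[OF assms] in simp)
  then show ?thesis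
    using apply_op_mat_mul[OF distinct_block[of u "digit_width d"]] by (metis length_block)
qed

text \<open>Pushing amplitudes forward along \<open>f\<close> is the same as pulling them back along
  its inverse, and for an involution that is \<open>f\<close> itself.\<close>

lemma apply_classical_op:
  assumes "\<And>y. y \<in> bitstrings (length ws) \<Longrightarrow> f y \<in> bitstrings (length ws) \<and> f (f y) = y"
  shows "apply_op (classical_op f) ws \<psi> x = \<psi> (assign_bits x ws (f (map x ws)))"
proof -
  have "map x ws = f y \<longleftrightarrow> y = f (map x ws)" if "y \<in> bitstrings (length ws)" for y
    using assms[of y] assms[of "map x ws"] that by auto
  then have "apply_op (classical_op f) ws \<psi> x =
      (\<Sum>y \<in> bitstrings (length ws). of_bool (y = f (map x ws)) * \<psi> (assign_bits x ws y))"
    unfolding apply_op_def classical_op_def by (intro sum.cong) auto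
  then show ?thesis using assms[of "map x ws"] by (simp add: sum_bitstrings_delta)
qed

lemma adjoint_classical_op:
  assumes "\<And>y. y \<in> bitstrings (length ws) \<Longrightarrow> f y \<in> bitstrings (length ws) \<and> f (f y) = y"
  shows "apply_op (adjoint_op (classical_op f)) ws = apply_op (classical_op f) ws"
  by (rule apply_op_cong) (use assms in \<open>auto simp: adjoint_op_def classical_op_def\<close>)

lemma unitary_classical_op:
  fixes ws :: "qubit list"
  assumes "\<And>y. y \<in> bitstrings (length ws) \<Longrightarrow> f y \<in> bitstrings (length ws) \<and> f (f y) = y" "distinct ws"
  shows "unitary_op (length ws) (classical_op f)"
proof -
  have "apply_op (classical_op f) ws (apply_op (classical_op f) ws \<psi>) = \<psi>" for \<psi>
    using assms(1)[of "map _ ws"]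
    by (intro ext) (simp add: apply_classical_op[OF assms(1)] map_assign_bits assign_bits_assign_bits assms(2))
  then show ?thesis by (simp add: unitary_op_iff[OF assms(2)] adjoint_classical_op[OF assms(1)])
qed

section \<open>Kinds of gates, their inverses and their unitarity\<close>

definition flip_gate :: "nat gate \<Rightarrow> (qubit \<Rightarrow> bool) \<Rightarrow> (qubit \<Rightarrow> bool)" where
  "flip_gate g x = (case g of NOT u \<Rightarrow> x(u := \<not> x u) | CNOT u v \<Rightarrow> x(v := (x v \<noteq> x u))
     | Toffoli u v w \<Rightarrow> x(w := (x w \<noteq> (x u \<and> x v))) | _ \<Rightarrow> x)"

fun classical_gate :: "nat gate \<Rightarrow> bool" where
  "classical_gate (NOT u) = True"
| "classical_gate (CNOT u v) = (u \<noteq> v)"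
| "classical_gate (Toffoli u v w) = (u \<noteq> v \<and> u \<noteq> w \<and> v \<noteq> w)"
| "classical_gate _ = False"

lemma bitstrings_numerals:
  "y \<in> bitstrings (Suc 0) \<longleftrightarrow> (\<exists>a. y = [a])"
  "y \<in> bitstrings (Suc (Suc 0)) \<longleftrightarrow> (\<exists>a b. y = [a, b])"
  "y \<in> bitstrings (Suc (Suc (Suc 0))) \<longleftrightarrow> (\<exists>a b c. y = [a, b, c])"
  by (auto simp: bitstrings_def length_Suc_conv)

lemma assign_bits_Cons: "assign_bits x (w # ws) (b # bs) = (assign_bits x ws bs)(w := b)"
  by (auto simp: assign_bits_def)

lemma assign_bits_Nil: "assign_bits x [] [] = x"
  by (simp add: assign_bits_def)

lemma classical_gate_op:
  assumes "classical_gate g"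
  obtains f where "gate_op Q g = classical_op f"
    "\<And>y. y \<in> bitstrings (length (gate_qubits C l g)) \<Longrightarrow> f y \<in> bitstrings (length (gate_qubits C l g)) \<and> f (f y) = y"
    "\<And>x. assign_bits x (gate_qubits C l g) (f (map x (gate_qubits C l g))) = flip_gate g x"
proof (cases g)
  case (NOT u)
  show ?thesis
    by (rule that[of "\<lambda>y. [\<not> y ! 0]"])
      (auto simp: NOT bitstrings_numerals flip_gate_def assign_bits_Cons assign_bits_Nil)
next
  case (CNOT u v)
  show ?thesis
    by (rule that[of "\<lambda>y. [y ! 0, y ! 1 \<noteq> y ! 0]"])
      (use assms in \<open>auto simp: CNOT bitstrings_numerals flip_gate_def assign_bits_Cons assign_bits_Nil fun_upd_idem\<close>)
next
  case (Toffoli u v w)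
  show ?thesis
    by (rule that[of "\<lambda>y. [y ! 0, y ! 1, y ! 2 \<noteq> (y ! 0 \<and> y ! 1)]"])
      (use assms in \<open>auto simp: Toffoli bitstrings_numerals flip_gate_def assign_bits_Cons assign_bits_Nil fun_upd_idem\<close>)
qed (use assms in auto)

lemma apply_classical_gate:
  assumes "classical_gate g"
  shows "apply_op (gate_op Q g) (gate_qubits C l g) \<psi> x = \<psi> (flip_gate g x)"
proof -
  obtain f where "gate_op Q g = classical_op f"
    "\<And>y. y \<in> bitstrings (length (gate_qubits C l g)) \<Longrightarrow> f y \<in> bitstrings (length (gate_qubits C l g)) \<and> f (f y) = y"
    "\<And>x. assign_bits x (gate_qubits C l g) (f (map x (gate_qubits C l g))) = flip_gate g x"
    using classical_gate_op[OF assms] by blast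
  then show ?thesis by (simp add: apply_classical_op)
qed

lemma flip_flip: "classical_gate g \<Longrightarrow> flip_gate g (flip_gate g x) = x"
  by (cases g) (simp_all add: flip_gate_def fun_eq_iff, auto?)

lemma apply_phase_op:
  "apply_op (phase_op a b) ws \<psi> x = (if \<forall>w \<in> set ws. x w then cis (2 * pi * (a / b)) else 1) * \<psi> x"
proof -
  have "apply_op (phase_op a b) ws \<psi> x = (\<Sum>y \<in> bitstrings (length ws). of_bool (map x ws = y) *
      ((if \<forall>w \<in> set ws. x w then cis (2 * pi * (a / b)) else 1) * \<psi> (assign_bits x ws y)))"
    unfolding apply_op_def
  proof (intro sum.cong refl)
    fix y show "phase_op a b (map x ws) y * \<psi> (assign_bits x ws y) = of_bool (map x ws = y) *
        ((if \<forall>w \<in> set ws. x w then cis (2 * pi * (a / b)) else 1) * \<psi> (assign_bits x ws y))"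
      by (cases "map x ws = y", hypsubst) (simp_all add: phase_op_def)
  qed
  then show ?thesis by (simp add: sum_bitstrings_delta)
qed

lemma apply_adjoint_phase_op:
  "apply_op (adjoint_op (phase_op a b)) ws \<psi> x =
     (if \<forall>w \<in> set ws. x w then cis (- (2 * pi * (a / b))) else 1) * \<psi> x"
proof -
  have "apply_op (adjoint_op (phase_op a b)) ws \<psi> x = (\<Sum>y \<in> bitstrings (length ws). of_bool (map x ws = y) *
      ((if \<forall>w \<in> set ws. x w then cis (- (2 * pi * (a / b))) else 1) * \<psi> (assign_bits x ws y)))"
    unfolding apply_op_def
  proof (intro sum.cong refl)
    fix y show "adjoint_op (phase_op a b) (map x ws) y * \<psi> (assign_bits x ws y) = of_bool (map x ws = y) *
        ((if \<forall>w \<in> set ws. x w then cis (- (2 * pi * (a / b))) else 1) * \<psi> (assign_bits x ws y))"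
      by (cases "map x ws = y", hypsubst) (auto simp: adjoint_op_def phase_op_def cis_cnj)
  qed
  then show ?thesis by (simp add: sum_bitstrings_delta)
qed

lemma unitary_phase_op:
  fixes ws :: "qubit list"
  assumes "distinct ws"
  shows "unitary_op (length ws) (phase_op a b)"
  unfolding unitary_op_iff[OF assms]
  by (auto intro!: ext simp: apply_phase_op apply_adjoint_phase_op cis_mult simp flip: mult.assoc)

fun phase_gate :: "nat gate \<Rightarrow> bool" where
  "phase_gate (Phase a b u) = (b \<ge> 1)"
| "phase_gate (CPhase a b u v) = (b \<ge> 1 \<and> u \<noteq> v)"
| "phase_gate _ = False"

fun qft_gate :: "nat gate \<Rightarrow> bool" where
  "qft_gate (QFT d u) = (d \<ge> 1)"
| "qft_gate _ = False"

fun query_gate :: "nat gate \<Rightarrow> bool" where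
  "query_gate (Query u v w) = True"
| "query_gate (QueryInv u v w) = True"
| "query_gate _ = False"

lemma cis_fraction_power_pred:
  assumes "b \<ge> 1"
  shows "cis (2 * pi * (real a / real b)) ^ (b - 1) = cis (- (2 * pi * (real a / real b)))"
proof -
  let ?z = "cis (2 * pi * (real a / real b))"
  have "?z ^ (b - 1) * ?z = 1" using cis_fraction_power[OF assms, of "int a"] assms
    by (simp flip: power_Suc2)
  then have "?z ^ (b - 1) * ?z * cis (- (2 * pi * (real a / real b))) = cis (- (2 * pi * (real a / real b)))"
    by simp
  then show ?thesis by (simp add: mult.assoc cis_mult)
qed

lemma run_phase_power:
  assumes "gate_op Q g = phase_op a b"
  shows "run_gates C l Q (replicate n g) \<psi> x =
    (if \<forall>w \<in> set (gate_qubits C l g). x w then cis (2 * pi * (a / b)) else 1) ^ n * \<psi> x"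
  by (induction n arbitrary: \<psi>) (auto simp: assms apply_phase_op)

lemma run_inverse_gates:
  assumes "classical_gate g \<or> phase_gate g \<or> qft_gate g \<or> query_gate g"
  shows "run_gates C l Q (inverse_gates g) \<psi> = apply_op (adjoint_op (gate_op Q g)) (gate_qubits C l g) \<psi>"
proof -
  have phase: "run_gates C l Q (replicate (b - 1) g) \<psi> =
       apply_op (adjoint_op (gate_op Q g)) (gate_qubits C l g) \<psi>"
    if "gate_op Q g = phase_op a b" "b \<ge> 1" for a b
    using cis_fraction_power_pred[OF that(2), of a]
    by (intro ext) (simp add: run_phase_power[OF that(1)] that(1) apply_adjoint_phase_op)
  consider "classical_gate g" | "phase_gate g" | "qft_gate g" | "query_gate g" using assms by blast
  then show ?thesis
  proof cases
    case 1
    obtain f where "gate_op Q g = classical_op f"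
      "\<And>y. y \<in> bitstrings (length (gate_qubits C l g)) \<Longrightarrow>
          f y \<in> bitstrings (length (gate_qubits C l g)) \<and> f (f y) = y"
      using classical_gate_op[OF 1] by blast
    then have "apply_op (adjoint_op (gate_op Q g)) (gate_qubits C l g) = apply_op (gate_op Q g) (gate_qubits C l g)"
      by (simp add: adjoint_classical_op)
    moreover have "inverse_gates g = [g]" using 1 by (cases g) auto
    ultimately show ?thesis by simp
  next
    case 2
    then show ?thesis using phase by (cases g) auto
  next
    case 3
    then show ?thesis using qft_cubed_is_adjoint by (cases g) (auto simp: numeral_3_eq_3)
  next
    case 4
    then show ?thesis by (cases g) auto
  qed
qed

lemma unitary_gate:
  assumes "classical_gate g \<or> phase_gate g \<or> qft_gate g \<or> query_gate g" "distinct (gate_qubits C l g)"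
    and "unitary_op (index_width C + symbol_width C + l) Q"
  shows "unitary_op (length (gate_qubits C l g)) (gate_op Q g)"
proof -
  have adj: "unitary_op (index_width C + symbol_width C + l) (adjoint_op Q)"
    using assms(3) unfolding unitary_op_def by (simp add: adjoint_op_def)
  consider "classical_gate g" | "phase_gate g" | "qft_gate g" | "query_gate g" using assms by blast
  then show ?thesis
  proof cases
    case 1
    then show ?thesis using classical_gate_op[OF 1, of Q C l] unitary_classical_op[OF _ assms(2)] by metis
  next
    case 2
    then show ?thesis using unitary_phase_op[OF assms(2)] by (cases g) auto
  next
    case 3
    then show ?thesis using unitary_qft_op by (cases g) auto
  next
    case 4
    then show ?thesis using assms(3) adj by (cases g) (auto simp: add.assoc)
  qed
qed

section \<open>Amplitudes of the layers\<close>

lemma in_set_block: "p \<in> set (block u k) \<longleftrightarrow> fst p = fst u \<and> snd u \<le> snd p \<and> snd p < snd u + k"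
proof -
  have "p \<in> set (block u k) \<longleftrightarrow> (\<exists>i<k. p = (fst u, snd u + i))" by (auto simp: block_def)
  also have "\<dots> \<longleftrightarrow> fst p = fst u \<and> snd u \<le> snd p \<and> snd p < snd u + k"
    by (cases p) (auto intro: exI[of _ "snd p - snd u"])
  finally show ?thesis .
qed

lemma sum_bitstrings_append:
  "(\<Sum>Y \<in> bitstrings (j + k). f Y) = (\<Sum>Y \<in> bitstrings j. \<Sum>Z \<in> bitstrings k. f (Y @ Z))"
proof -
  have "(\<Sum>Y \<in> bitstrings (j + k). f Y) = (\<Sum>(Y, Z) \<in> bitstrings j \<times> bitstrings k. f (Y @ Z))"
    by (rule sum.reindex_bij_witness[where i = "\<lambda>(Y, Z). Y @ Z" and j = "\<lambda>Y. (take j Y, drop j Y)"])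
      (auto simp: bitstrings_def)
  then show ?thesis by (simp add: sum.cartesian_product)
qed

lemma bitstrings_append [simp]:
  "X \<in> bitstrings j \<Longrightarrow> Y \<in> bitstrings k \<Longrightarrow> X @ Y \<in> bitstrings (j + k)"
  by (simp add: bitstrings_def)

lemma replicate_in_bitstrings [simp]: "replicate k b \<in> bitstrings k"
  by (simp add: bitstrings_def)

lemma length_bitstrings: "X \<in> bitstrings k \<Longrightarrow> length X = k"
  by (simp add: bitstrings_def)

lemma bitstrings_split:
  assumes "X \<in> bitstrings (j + k)"
  obtains Y Z where "X = Y @ Z" "Y \<in> bitstrings j" "Z \<in> bitstrings k"
  using assms that[of "take j X" "drop j X"] by (simp add: bitstrings_def)

lemma assign_bits_append:
  assumes "length Y = length ws" "set ws \<inter> set ws' = {}"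
  shows "assign_bits x (ws @ ws') (Y @ Y') = assign_bits (assign_bits x ws Y) ws' Y'"
proof
  fix p
  show "assign_bits x (ws @ ws') (Y @ Y') p = assign_bits (assign_bits x ws Y) ws' Y' p"
  proof (cases "p \<in> set ws")
    case True
    then have n: "map_of (zip ws' Y') p = None"
      using assms(2) by (auto simp: map_of_eq_None_iff dest: set_zip_leftD)
    show ?thesis
      by (simp add: assign_bits_def map_add_def n assms(1) True split: option.split)
  next
    case False
    then have n: "map_of (zip ws Y) p = None" by (auto simp: map_of_eq_None_iff dest: set_zip_leftD)
    show ?thesis
      by (simp add: assign_bits_def map_add_def n assms(1) split: option.split)
  qed
qed

text \<open>
  The assignment with the index qubits in row 0 holding \<open>rb\<close>, the symbol qubits in row 1 being zero
  and the ancillas in row 2 holding \<open>L\<close>.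
\<close>

definition cfg :: "bool list \<Rightarrow> bool list \<Rightarrow> qubit \<Rightarrow> bool" where
  "cfg rb L = (\<lambda>(r, c). r = 0 \<and> c < length rb \<and> rb ! c \<or> r = 2 \<and> c < length L \<and> L ! c)"

lemma cfg_inj:
  assumes "length L = length L'"
  shows "cfg rb L = cfg rb L' \<longleftrightarrow> L = L'"
proof
  assume "cfg rb L = cfg rb L'"
  then have "cfg rb L (2, c) = cfg rb L' (2, c)" for c by simp
  then show "L = L'" using assms by (intro nth_equalityI) (auto simp: cfg_def)
qed simp

lemma map_cfg_block:
  "length L1 = k \<Longrightarrow> length X = n \<Longrightarrow> map (cfg rb (L1 @ X @ L2)) (block (2, k) n) = X"
  by (auto simp: cfg_def block_def nth_append intro!: nth_equalityI)

lemma assign_cfg_block: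
  assumes "length L1 = k" "length X = n" "length Y = n"
  shows "assign_bits (cfg rb (L1 @ X @ L2)) (block (2, k) n) Y = cfg rb (L1 @ Y @ L2)"
proof -
  have "assign_bits (cfg rb (L1 @ X @ L2)) (block (2, k) n) Y =
      assign_bits (cfg rb (L1 @ X @ L2)) (block (2, k) n) (map (cfg rb (L1 @ Y @ L2)) (block (2, k) n))"
    using assms by (simp add: map_cfg_block)
  also have "\<dots> = cfg rb (L1 @ Y @ L2)"
    unfolding assign_bits_map
    using assms by (auto simp: override_on_def in_set_block cfg_def nth_append fun_eq_iff)
  finally show ?thesis .
qed

lemma apply_op_cfg:
  assumes "length L1 = k" "X \<in> bitstrings n"
  shows "apply_op U (block (2, k) n) \<psi> (cfg rb (L1 @ X @ L2)) =
    (\<Sum>Y \<in> bitstrings n. U X Y * \<psi> (cfg rb (L1 @ Y @ L2)))"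
  unfolding apply_op_def
  by (intro sum.cong) (use assms in \<open>auto simp: map_cfg_block assign_cfg_block bitstrings_def\<close>)

text \<open>The shape of a query: index and symbol blocks are adjacent, and the gap
  \<open>L3\<close> before the ancillas holds the helpers of the table.\<close>

lemma apply_op_cfg3:
  assumes "length L0 = k0" "X1 \<in> bitstrings n1" "X2 \<in> bitstrings n2" "X3 \<in> bitstrings n3"
    and "k2 = k0 + n1" "k3 = k2 + n2 + length L3"
  shows "apply_op U (block (2, k0) n1 @ block (2, k2) n2 @ block (2, k3) n3) \<psi>
      (cfg rb (L0 @ X1 @ X2 @ L3 @ X3)) =
    (\<Sum>Y1 \<in> bitstrings n1. \<Sum>Y2 \<in> bitstrings n2. \<Sum>Y3 \<in> bitstrings n3.
       U (X1 @ X2 @ X3) (Y1 @ Y2 @ Y3) * \<psi> (cfg rb (L0 @ Y1 @ Y2 @ L3 @ Y3)))"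
proof -
  let ?x = "cfg rb (L0 @ X1 @ X2 @ L3 @ X3)"
  have disj: "set (block (2, k0) n1) \<inter> set (block (2, k2) n2 @ block (2, k3) n3) = {}"
    "set (block (2, k2) n2) \<inter> set (block (2, k3) n3) = {}"
    using assms(5,6) by (auto simp: in_set_block)
  have bits: "map ?x (block (2, k0) n1) = X1" "map ?x (block (2, k2) n2) = X2" "map ?x (block (2, k3) n3) = X3"
    using map_cfg_block[of L0 k0 X1 n1 rb "X2 @ L3 @ X3"] map_cfg_block[of "L0 @ X1" k2 X2 n2 rb "L3 @ X3"]
      map_cfg_block[of "L0 @ X1 @ X2 @ L3" k3 X3 n3 rb "[]"] assms by (simp_all add: bitstrings_def)
  have "assign_bits ?x (block (2, k0) n1 @ block (2, k2) n2 @ block (2, k3) n3) (Y1 @ Y2 @ Y3) =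
      cfg rb (L0 @ Y1 @ Y2 @ L3 @ Y3)"
    if "Y1 \<in> bitstrings n1" "Y2 \<in> bitstrings n2" "Y3 \<in> bitstrings n3" for Y1 Y2 Y3
  proof -
    have "assign_bits ?x (block (2, k0) n1 @ block (2, k2) n2 @ block (2, k3) n3) (Y1 @ Y2 @ Y3) =
        assign_bits (assign_bits (assign_bits ?x (block (2, k0) n1) Y1) (block (2, k2) n2) Y2)
          (block (2, k3) n3) Y3"
      using that assign_bits_append[OF _ disj(1), of Y1 ?x "Y2 @ Y3"]
        assign_bits_append[OF _ disj(2), of Y2 _ Y3] by (simp only: length_bitstrings length_block)
    then show ?thesis
      using assign_cfg_block[of L0 k0 X1 n1 Y1 rb "X2 @ L3 @ X3"]
      assign_cfg_block[of "L0 @ Y1" k2 X2 n2 Y2 rb "L3 @ X3"]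
      assign_cfg_block[of "L0 @ Y1 @ Y2 @ L3" k3 X3 n3 Y3 rb "[]"] assms that
      by (simp add: bitstrings_def)
  qed
  then show ?thesis
    unfolding apply_op_def
    by (simp add: bits sum_bitstrings_append)
qed

section \<open>Digit vectors as bit strings\<close>

lemma length_vector_bits: "length (vector_bits q y) = length y * digit_width q"
  by (induction y) (auto simp: vector_bits_def)

lemma vector_bits_snoc: "vector_bits q (y @ [d]) = vector_bits q y @ digit_bits q d"
  by (simp add: vector_bits_def)

lemma vector_bits_in_bitstrings: "y \<in> digit_vectors q m \<Longrightarrow> vector_bits q y \<in> bitstrings (m * digit_width q)"
  by (simp add: bitstrings_def length_vector_bits digit_vectors_def)

lemma nth_vector_bits:
  assumes "j < length y" "b < digit_width q"
  shows "vector_bits q y ! (j * digit_width q + b) = bit (y ! j) b"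
  using assms
proof (induction y arbitrary: j)
  case (Cons d y)
  have "vector_bits q (d # y) = digit_bits q d @ vector_bits q y" by (simp add: vector_bits_def)
  then show ?case using Cons by (cases j) (auto simp: nth_append digit_bits_def)
qed simp

lemma vector_bits_inj:
  assumes "x \<in> digit_vectors q m" "y \<in> digit_vectors q m"
  shows "vector_bits q x = vector_bits q y \<longleftrightarrow> x = y"
proof
  assume *: "vector_bits q x = vector_bits q y"
  show "x = y"
  proof (rule nth_equalityI)
    fix j assume j: "j < length x"
    have "digit_bits q (x ! j) = digit_bits q (y ! j)"
      using nth_vector_bits[of j x _ q] nth_vector_bits[of j y _ q] * j assms
      by (auto simp: digit_bits_def digit_vectors_def)
    then show "x ! j = y ! j"
      using assms j digit_bits_inj by (auto simp: digit_vectors_def)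
  qed (use assms in \<open>auto simp: digit_vectors_def\<close>)
qed simp

lemma finite_digit_vectors [simp, intro]: "finite (digit_vectors q m)"
  and card_digit_vectors: "card (digit_vectors q m) = q ^ m"
proof -
  have "digit_vectors q m = {v. set v \<subseteq> {..<q} \<and> length v = m}" by (auto simp: digit_vectors_def)
  then show "finite (digit_vectors q m)" "card (digit_vectors q m) = q ^ m"
    using finite_lists_length_eq[of "{..<q}" m] card_lists_length_eq[of "{..<q}" m] by auto
qed

lemma digit_vectors_snoc:
  "v @ [d] \<in> digit_vectors q (Suc m) \<longleftrightarrow> v \<in> digit_vectors q m \<and> d < q"
  by (auto simp: digit_vectors_def)

lemma digit_vectors_SucE:
  assumes "v \<in> digit_vectors q (Suc m)"
  obtains u d where "v = u @ [d]" "u \<in> digit_vectors q m" "d < q"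
  using assms by (cases v rule: rev_cases) (auto simp: digit_vectors_def)

lemma sum_digit_vectors_Suc:
  "(\<Sum>s \<in> digit_vectors q (Suc m). f s) = (\<Sum>s \<in> digit_vectors q m. \<Sum>e<q. f (s @ [e]))"
proof -
  have "(\<Sum>s \<in> digit_vectors q (Suc m). f s) = (\<Sum>(s, e) \<in> digit_vectors q m \<times> {..<q}. f (s @ [e]))"
    by (rule sum.reindex_bij_witness[where i = "\<lambda>(s, e). s @ [e]" and j = "\<lambda>s. (butlast s, last s)"])
      (auto simp: digit_vectors_snoc elim!: digit_vectors_SucE)
  then show ?thesis by (simp add: sum.cartesian_product)
qed

lemma bits_val_replicate_False [simp]: "bits_val (replicate k False) = 0"
  by (induction k) (auto simp: bits_val_def)

lemma qft_op_zero_column: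
  assumes "d \<ge> 1" "x \<in> bitstrings (digit_width d)"
  shows "qft_op d x (replicate (digit_width d) False) = of_bool (bits_val x < d) / complex_of_real (sqrt (real d))"
  using assms by (auto simp: qft_op_eq)

lemma snoc_in_vector_bits_image:
  assumes "S \<in> bitstrings (m * digit_width q)" "B \<in> bitstrings (digit_width q)"
  shows "S @ B \<in> vector_bits q ` digit_vectors q (Suc m) \<longleftrightarrow>
    S \<in> vector_bits q ` digit_vectors q m \<and> bits_val B < q"
proof
  assume "S @ B \<in> vector_bits q ` digit_vectors q (Suc m)"
  then obtain y d where "S @ B = vector_bits q y @ digit_bits q d" "y \<in> digit_vectors q m" "d < q"
    by (auto elim!: digit_vectors_SucE simp: vector_bits_snoc)
  moreover then have "length S = length (vector_bits q y)"
    using assms vector_bits_in_bitstrings by (simp add: bitstrings_def)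
  ultimately show "S \<in> vector_bits q ` digit_vectors q m \<and> bits_val B < q"
    by (auto simp: bits_val_digit_bits)
next
  assume "S \<in> vector_bits q ` digit_vectors q m \<and> bits_val B < q"
  then obtain y where "S = vector_bits q y" "y \<in> digit_vectors q m" "bits_val B < q" by blast
  then show "S @ B \<in> vector_bits q ` digit_vectors q (Suc m)"
    using digit_bits_bits_val[OF assms(2)]
    by (intro image_eqI[of _ _ "y @ [bits_val B]"]) (auto simp: vector_bits_snoc digit_vectors_snoc)
qed

text \<open>A zero register becomes the uniform superposition of the valid digit vectors. The last
  digit is split off in the induction; \<open>L2\<close> and \<open>c\<close> are generalised
  because that digit moves to \<open>L2\<close> and the condition that it be zero moves into
  \<open>c\<close>.\<close>

lemma fourier_layer_from_zero:
  assumes "q \<ge> 1" "length L1 = k"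
    and "\<And>S. S \<in> bitstrings (m * digit_width q) \<Longrightarrow>
      \<psi> (cfg rb (L1 @ S @ L2)) = c * of_bool (S = replicate (m * digit_width q) False)"
    and "S \<in> bitstrings (m * digit_width q)"
  shows "run_gates C l Q (map (\<lambda>j. QFT q (2, k + j * digit_width q)) [0..<m]) \<psi> (cfg rb (L1 @ S @ L2)) =
      c * of_bool (S \<in> vector_bits q ` digit_vectors q m) / complex_of_real (sqrt (real q)) ^ m"
  using assms(3,4)
proof (induction m arbitrary: L2 c S)
  case 0
  then show ?case by (auto simp: bitstrings_def digit_vectors_def vector_bits_def)
next
  case (Suc m)
  let ?w = "digit_width q" and ?r = "complex_of_real (sqrt (real q))"
  obtain S' B where S: "S = S' @ B" "S' \<in> bitstrings (m * ?w)" "B \<in> bitstrings ?w"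
    using Suc.prems(2) bitstrings_split[of S "m * ?w" ?w] by (metis add.commute mult_Suc)
  let ?run = "run_gates C l Q (map (\<lambda>j. QFT q (2, k + j * ?w)) [0..<m]) \<psi>"
  have IH: "?run (cfg rb ((L1 @ S') @ z @ L2)) =
      of_bool (z = replicate ?w False) * (c * of_bool (S' \<in> vector_bits q ` digit_vectors q m) / ?r ^ m)"
    if z: "z \<in> bitstrings ?w" for z
  proof -
    have "?run (cfg rb (L1 @ S' @ (z @ L2))) =
      (c * of_bool (z = replicate ?w False)) * of_bool (S' \<in> vector_bits q ` digit_vectors q m) / ?r ^ m"
    proof (rule Suc.IH)
      fix T assume T: "T \<in> bitstrings (m * ?w)"
      have "T @ z \<in> bitstrings (Suc m * ?w)" using T z by (simp add: bitstrings_def)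
      moreover have "T @ z = replicate (Suc m * ?w) False \<longleftrightarrow>
          T = replicate (m * ?w) False \<and> z = replicate ?w False"
        using T z by (simp add: bitstrings_def replicate_add add.commute[of ?w])
      ultimately show "\<psi> (cfg rb (L1 @ T @ z @ L2)) =
          c * of_bool (z = replicate ?w False) * of_bool (T = replicate (m * ?w) False)"
        using Suc.prems(1)[of "T @ z"] by auto
    qed (rule S(2))
    then show ?thesis by simp
  qed
  have "run_gates C l Q (map (\<lambda>j. QFT q (2, k + j * ?w)) [0..<Suc m]) \<psi> (cfg rb (L1 @ S @ L2)) =
      apply_op (qft_op q) (block (2, k + m * ?w) ?w) ?run (cfg rb ((L1 @ S') @ B @ L2))"
    by (simp add: S)
  also have "\<dots> = (\<Sum>z \<in> bitstrings ?w. of_bool (z = replicate ?w False) *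
      (qft_op q B z * (c * of_bool (S' \<in> vector_bits q ` digit_vectors q m) / ?r ^ m)))"
    by (subst apply_op_cfg) (use S assms(2) IH in \<open>auto simp: bitstrings_def intro!: sum.cong\<close>)
  also have "\<dots> = qft_op q B (replicate ?w False) * (c * of_bool (S' \<in> vector_bits q ` digit_vectors q m) / ?r ^ m)"
    by (rule sum_bitstrings_delta) simp
  finally show ?case
    unfolding S(1) snoc_in_vector_bits_image[OF S(2,3)] qft_op_zero_column[OF assms(1) S(3)]
    by (cases "bits_val B < q"; cases "S' \<in> vector_bits q ` digit_vectors q m"; simp)
qed

text \<open>A row of \<open>qft_op\<close> at a valid digit vanishes at strings encoding no digit.
  Hence nothing is assumed about \<open>\<psi>\<close>, although an inverse query may leave invalid
  contents in the register.\<close>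

lemma fourier_layer_sum:
  assumes "length L1 = k" "y \<in> digit_vectors q m"
  shows "run_gates C l Q (map (\<lambda>j. QFT q (2, k + j * digit_width q)) [0..<m]) \<psi>
      (cfg rb (L1 @ vector_bits q y @ L2)) =
    (\<Sum>s \<in> digit_vectors q m. cis (2 * pi * (real (\<Sum>i<m. y ! i * s ! i) / real q)) /
       complex_of_real (sqrt (real q)) ^ m * \<psi> (cfg rb (L1 @ vector_bits q s @ L2)))"
  using assms(2)
proof (induction m arbitrary: L2 y)
  case 0
  then have "digit_vectors q 0 = {[]}" "y = []" by (auto simp: digit_vectors_def)
  then show ?case by simp
next
  case (Suc m)
  let ?w = "digit_width q" and ?r = "complex_of_real (sqrt (real q))"
  obtain y' d where y: "y = y' @ [d]" "y' \<in> digit_vectors q m" "d < q"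
    using Suc.prems by (rule digit_vectors_SucE)
  let ?run = "run_gates C l Q (map (\<lambda>j. QFT q (2, k + j * ?w)) [0..<m]) \<psi>"
  have dot: "(\<Sum>i<Suc m. (y' @ [d]) ! i * (s @ [e]) ! i) = (\<Sum>i<m. y' ! i * s ! i) + d * e"
    if "s \<in> digit_vectors q m" for s e
  proof -
    have "length y' = m" "length s = m" using y that by (auto simp: digit_vectors_def)
    then show ?thesis by (simp add: nth_append)
  qed
  have "run_gates C l Q (map (\<lambda>j. QFT q (2, k + j * ?w)) [0..<Suc m]) \<psi> (cfg rb (L1 @ vector_bits q y @ L2)) =
      apply_op (qft_op q) (block (2, k + m * ?w) ?w) ?run (cfg rb ((L1 @ vector_bits q y') @ digit_bits q d @ L2))"
    by (simp add: y vector_bits_snoc)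
  also have "\<dots> = (\<Sum>z \<in> bitstrings ?w. qft_op q (digit_bits q d) z * ?run (cfg rb ((L1 @ vector_bits q y') @ z @ L2)))"
    by (subst apply_op_cfg) (use y assms(1) in \<open>auto simp: length_vector_bits digit_vectors_def\<close>)
  also have "\<dots> = (\<Sum>e<q. qft_op q (digit_bits q d) (digit_bits q e) *
      ?run (cfg rb ((L1 @ vector_bits q y') @ digit_bits q e @ L2)))"
    by (rule sum_bitstrings_digits) (use y in \<open>auto simp: qft_op_eq bits_val_digit_bits\<close>)
  also have "\<dots> = (\<Sum>e<q. \<Sum>s \<in> digit_vectors q m.
      cis (2 * pi * (real (\<Sum>i<Suc m. y ! i * (s @ [e]) ! i) / real q)) / ?r ^ Suc m *
        \<psi> (cfg rb (L1 @ vector_bits q (s @ [e]) @ L2)))"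
  proof (rule sum.cong[OF refl])
    fix e assume "e \<in> {..<q}"
    then have e: "e < q" by simp
    have "?run (cfg rb ((L1 @ vector_bits q y') @ digit_bits q e @ L2)) =
      (\<Sum>s \<in> digit_vectors q m. cis (2 * pi * (real (\<Sum>i<m. y' ! i * s ! i) / real q)) / ?r ^ m *
         \<psi> (cfg rb (L1 @ vector_bits q s @ digit_bits q e @ L2)))"
      using Suc.IH[OF y(2), of "digit_bits q e @ L2"] by simp
    moreover have "cis (2 * pi * (real (\<Sum>i<Suc m. y ! i * (s @ [e]) ! i) / real q)) =
        cis (2 * pi * (real (d * e) / real q)) * cis (2 * pi * (real (\<Sum>i<m. y' ! i * s ! i) / real q))"
      if "s \<in> digit_vectors q m" for s
      unfolding y(1) dot[OF that] cis_mult by (simp add: add_divide_distrib algebra_simps)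
    ultimately show "qft_op q (digit_bits q d) (digit_bits q e) *
      ?run (cfg rb ((L1 @ vector_bits q y') @ digit_bits q e @ L2)) =
      (\<Sum>s \<in> digit_vectors q m.
      cis (2 * pi * (real (\<Sum>i<Suc m. y ! i * (s @ [e]) ! i) / real q)) / ?r ^ Suc m *
        \<psi> (cfg rb (L1 @ vector_bits q (s @ [e]) @ L2)))"
      unfolding qft_op_digits[OF y(3) e] by (simp add: sum_distrib_left vector_bits_snoc mult.assoc cong: sum.cong)
  qed
  finally show ?case unfolding sum_digit_vectors_Suc by (subst sum.swap)
qed

section \<open>The copy layer and the phase layer\<close>

lemma copy_index_state:
  "run_gates C l Q (map (\<lambda>i. CNOT (0, i) (2, k + i)) [0..<n]) \<psi> x =
     \<psi> (\<lambda>(r, c). if r = 2 \<and> k \<le> c \<and> c < k + n then x (2, c) \<noteq> x (0, c - k) else x (r, c))"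
proof (induction n arbitrary: x)
  case (Suc n)
  have "run_gates C l Q (map (\<lambda>i. CNOT (0, i) (2, k + i)) [0..<Suc n]) \<psi> x =
      run_gates C l Q (map (\<lambda>i. CNOT (0, i) (2, k + i)) [0..<n]) \<psi> (flip_gate (CNOT (0, n) (2, k + n)) x)"
    using apply_classical_gate[of "CNOT (0, n) (2, k + n)" Q C l] by simp
  also have "\<dots> = \<psi> (\<lambda>(r, c). if r = 2 \<and> k \<le> c \<and> c < k + Suc n then x (2, c) \<noteq> x (0, c - k) else x (r, c))"
    unfolding Suc.IH by (rule arg_cong[of _ _ \<psi>]) (auto simp: flip_gate_def fun_eq_iff)
  finally show ?case .
qed (auto intro!: arg_cong[of _ _ \<psi>] simp: fun_eq_iff)

lemma copy_index_cfg:
  assumes "length L1 = k" "length R = length rb"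
  shows "run_gates C l Q (map (\<lambda>i. CNOT (0, i) (2, k + i)) [0..<length rb]) \<psi> (cfg rb (L1 @ R @ L2)) =
     \<psi> (cfg rb (L1 @ xor_bits R rb @ L2))"
  unfolding copy_index_state
  by (rule arg_cong[of _ _ \<psi>])
    (use assms in \<open>auto simp: cfg_def xor_bits_def nth_append fun_eq_iff\<close>)

lemma xor_bits_eq_zero:
  "length X = length Y \<Longrightarrow> xor_bits X Y = replicate (length Y) False \<longleftrightarrow> X = Y"
  by (auto simp: xor_bits_def list_eq_iff_nth_eq)

lemma xor_bits_zero [simp]: "X \<in> bitstrings k \<Longrightarrow> xor_bits (replicate k False) X = X"
  by (auto simp: xor_bits_def bitstrings_def intro!: nth_equalityI)

lemma cis_fraction_add:
  "cis (2 * pi * (real b / real q)) * (cis (2 * pi * (real a / real q)) * z) =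
     cis (2 * pi * (real (a + b) / real q)) * z"
  by (simp add: cis_mult distrib_left add_divide_distrib add.commute flip: mult.assoc)

lemma phases_state:
  "run_gates C l Q (map (\<lambda>b. Phase (f b) q (2, k + b)) [0..<n]) \<psi> x =
     cis (2 * pi * (real (\<Sum>b<n. f b * of_bool (x (2, k + b))) / real q)) * \<psi> x"
proof (induction n)
  case (Suc n)
  have "run_gates C l Q (map (\<lambda>b. Phase (f b) q (2, k + b)) [0..<Suc n]) \<psi> x =
      cis (2 * pi * (real (f n * of_bool (x (2, k + n))) / real q)) *
        run_gates C l Q (map (\<lambda>b. Phase (f b) q (2, k + b)) [0..<n]) \<psi> x"
    by (simp add: apply_phase_op)
  then show ?case unfolding Suc.IH cis_fraction_add by (simp only: sum.lessThan_Suc)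
qed simp

lemma cphases_state:
  "run_gates C l Q (map (\<lambda>b. CPhase (f b) q (2, i) (2, k + b)) [0..<n]) \<psi> x =
     cis (2 * pi * (real (\<Sum>b<n. f b * of_bool (x (2, i) \<and> x (2, k + b))) / real q)) * \<psi> x"
proof (induction n)
  case (Suc n)
  have "run_gates C l Q (map (\<lambda>b. CPhase (f b) q (2, i) (2, k + b)) [0..<Suc n]) \<psi> x =
      cis (2 * pi * (real (f n * of_bool (x (2, i) \<and> x (2, k + n))) / real q)) *
        run_gates C l Q (map (\<lambda>b. CPhase (f b) q (2, i) (2, k + b)) [0..<n]) \<psi> x"
    by (simp add: apply_phase_op)
  then show ?case unfolding Suc.IH cis_fraction_add by (simp only: sum.lessThan_Suc)
qed simp

lemma cphases2_state:
  "run_gates C l Q (concat (map (\<lambda>i. map (\<lambda>b. CPhase (f i b) q (2, i) (2, k + b)) [0..<n]) [0..<n'])) \<psi> x =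
     cis (2 * pi * (real (\<Sum>i<n'. \<Sum>b<n. f i b * of_bool (x (2, i) \<and> x (2, k + b))) / real q)) * \<psi> x"
proof (induction n')
  case (Suc n')
  have e: "concat (map (\<lambda>i. map (\<lambda>b. CPhase (f i b) q (2, i) (2, k + b)) [0..<n]) [0..<Suc n']) =
      concat (map (\<lambda>i. map (\<lambda>b. CPhase (f i b) q (2, i) (2, k + b)) [0..<n]) [0..<n']) @
      map (\<lambda>b. CPhase (f n' b) q (2, n') (2, k + b)) [0..<n]"
    by simp
  have "run_gates C l Q (concat (map (\<lambda>i. map (\<lambda>b. CPhase (f i b) q (2, i) (2, k + b)) [0..<n]) [0..<Suc n'])) \<psi> x =
      cis (2 * pi * (real (\<Sum>b<n. f n' b * of_bool (x (2, n') \<and> x (2, k + b))) / real q)) *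
        run_gates C l Q (concat (map (\<lambda>i. map (\<lambda>b. CPhase (f i b) q (2, i) (2, k + b)) [0..<n]) [0..<n'])) \<psi> x"
    unfolding e run_gates_simps cphases_state by (rule refl)
  then show ?case unfolding Suc.IH cis_fraction_add by (simp only: sum.lessThan_Suc)
qed simp

lemma bits_val_sum: "bits_val X = (\<Sum>i<length X. 2 ^ i * of_bool (X ! i))"
  by (simp add: bits_val_def horner_sum_eq_sum atLeast0LessThan mult.commute)

text \<open>\<open>(K + 1) * T\<close> expands into the single bits of \<open>T\<close>, from the
  plain phases, and the products of bits \<open>2 ^ (i + b) * K_i * T_b\<close>, from the controlled
  ones.\<close>

lemma phase_layer_state:
  assumes "map x (block (2, 0) a) = K" "map x (block (2, col_T m w a) w) = T"
  shows "run_gates C l Q (phase_layer m q w a) \<psi> x =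
     cis (2 * pi * (real ((bits_val K + 1) * bits_val T) / real q)) * \<psi> x"
proof -
  have len: "length K = a" "length T = w" using assms by auto
  have K: "x (2, i) = K ! i" if "i < a" for i using that assms(1) by (auto simp: block_def)
  have T: "x (2, col_T m w a + b) = T ! b" if "b < w" for b using that assms(2) by (auto simp: block_def)
  have 1: "(\<Sum>b<w. 2 ^ b * of_bool (x (2, col_T m w a + b))) = bits_val T"
    by (simp add: bits_val_sum len T)
  have "(\<Sum>i<a. \<Sum>b<w. 2 ^ (i + b) * of_bool (x (2, i) \<and> x (2, col_T m w a + b))) =
      (\<Sum>i<a. \<Sum>b<w. (2 ^ i * of_bool (K ! i)) * (2 ^ b * of_bool (T ! b) :: nat))"
    by (intro sum.cong refl) (simp add: K T power_add)
  also have "\<dots> = bits_val K * bits_val T"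
    by (simp only: bits_val_sum len sum_product)
  finally have 2: "(\<Sum>i<a. \<Sum>b<w. 2 ^ (i + b) * of_bool (x (2, i) \<and> x (2, col_T m w a + b))) =
      bits_val K * bits_val T" .
  show ?thesis
    unfolding phase_layer_def run_gates_simps cphases2_state phases_state 1 2 cis_fraction_add
    by simp
qed

section \<open>The lookup table as a permutation of assignments\<close>

abbreviation run_flips :: "nat gate list \<Rightarrow> (qubit \<Rightarrow> bool) \<Rightarrow> qubit \<Rightarrow> bool" where
  "run_flips \<equiv> fold flip_gate"

text \<open>A gate pulls amplitudes back along its flip; evaluating at the flipped assignment undoes
  this, since flips are involutions.\<close>

lemma run_classical_gates:
  "\<forall>g \<in> set gs. classical_gate g \<Longrightarrow> run_gates C l Q gs \<psi> (run_flips gs x) = \<psi> x"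
  by (induction gs arbitrary: \<psi> x) (auto simp: apply_classical_gate flip_flip)

text \<open>The Toffoli gate sets the next helper to \<open>helper and bit\<close>; where the wanted
  bit is 0, the CNOT gate changes this to \<open>helper and not bit\<close>. The bound
  \<open>c + n \<le> h\<close> keeps the compared bits away from the helpers written.\<close>

lemma flip_match_chain_all:
  assumes "\<And>i. i < n \<Longrightarrow> \<not> x (2, h + Suc i)" "c + n \<le> h"
  shows "(run_flips (match_chain h c n v) x (2, h + n) \<longleftrightarrow> x (2, h) \<and> (\<forall>i<n. x (2, c + i) = bit v i)) \<and>
    (\<forall>p. fst p \<noteq> 2 \<or> snd p \<le> h \<or> snd p > h + n \<longrightarrow> run_flips (match_chain h c n v) x p = x p)"
  using assms
proof (induction n)
  case 0
  then show ?case by (simp add: match_chain_def)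
next
  case (Suc n)
  let ?y = "run_flips (match_chain h c n v) x"
  have IH: "(?y (2, h + n) \<longleftrightarrow> x (2, h) \<and> (\<forall>i<n. x (2, c + i) = bit v i)) \<and>
    (\<forall>p. fst p \<noteq> 2 \<or> snd p \<le> h \<or> snd p > h + n \<longrightarrow> ?y p = x p)"
    by (rule Suc.IH) (use Suc.prems in auto)
  have y: "?y (2, h + n) \<longleftrightarrow> x (2, h) \<and> (\<forall>i<n. x (2, c + i) = bit v i)"
    "\<And>p. fst p \<noteq> 2 \<or> snd p \<le> h \<or> snd p > h + n \<Longrightarrow> ?y p = x p"
    using IH by blast+
  have z: "run_flips (match_chain h c (Suc n) v) x =
      ?y((2, h + Suc n) := (?y (2, h + n) \<and> ?y (2, c + n) = bit v n))"
    using Suc.prems(1)[of n] y(2)[of "(2, h + Suc n)"]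
    by (auto simp: match_chain_def flip_gate_def fun_eq_iff)
  have cn: "?y (2, c + n) = x (2, c + n)" using y(2)[of "(2, c + n)"] Suc.prems(2) by simp
  have "(?y((2, h + Suc n) := (?y (2, h + n) \<and> ?y (2, c + n) = bit v n))) p = x p"
    if "fst p \<noteq> 2 \<or> snd p \<le> h \<or> snd p > h + Suc n" for p
    using that y(2)[of p] by auto
  moreover have "(?y((2, h + Suc n) := (?y (2, h + n) \<and> ?y (2, c + n) = bit v n))) (2, h + Suc n) \<longleftrightarrow>
      x (2, h) \<and> (\<forall>i<Suc n. x (2, c + i) = bit v i)"
    using y(1) cn by (auto simp: less_Suc_eq)
  ultimately show ?case unfolding z by blast
qed

lemma flip_match_chain:
  assumes "\<And>i. i < n \<Longrightarrow> \<not> x (2, h + Suc i)" "c + n \<le> h"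
  shows "run_flips (match_chain h c n v) x (2, h + n) \<longleftrightarrow> x (2, h) \<and> (\<forall>i<n. x (2, c + i) = bit v i)"
    and "fst p \<noteq> 2 \<or> snd p \<le> h \<or> snd p > h + n \<Longrightarrow> run_flips (match_chain h c n v) x p = x p"
  using flip_match_chain_all[where n = n and h = h and c = c and x = x, OF assms] by blast+

lemma flip_xor_out:
  "run_flips (xor_out h c n v) x =
     (\<lambda>p. if fst p = 1 \<and> c \<le> snd p \<and> snd p < c + n then x p \<noteq> (x (2, h) \<and> bit v (snd p - c)) else x p)"
proof (induction n)
  case (Suc n)
  define y where "y = run_flips (xor_out h c n v) x"
  have step: "run_flips (xor_out h c (Suc n) v) x p =
      (if bit v n \<and> p = (1, c + n) then y p \<noteq> y (2, h) else y p)" for p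
    by (simp add: xor_out_def flip_gate_def y_def)
  show ?case
    by (rule ext) (auto simp: step y_def Suc.IH less_Suc_eq)
qed (auto simp: xor_out_def)

lemma bits_eqI:
  fixes x y :: nat
  assumes "x < 2 ^ n" "y < 2 ^ n" "\<And>i. i < n \<Longrightarrow> bit x i = bit y i"
  shows "x = y"
proof -
  have "take_bit n x = take_bit n y" by (rule bit_eqI) (use assms(3) in \<open>auto simp: bit_take_bit_iff\<close>)
  then show ?thesis using assms by (simp add: take_bit_nat_eq_self)
qed

lemma helper_range:
  assumes "j < m" "k < q - 1" "y < q"
  shows "col_H m w a \<le> helper_base m q w a j k y" "helper_base m q w a j k y + a + w < col_A m q w a"
proof -
  have "(j * (q - 1) + k) * q + y < (j * (q - 1) + k + 1) * q" using assms(3) by simp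
  also have "\<dots> \<le> (m * (q - 1)) * q"
  proof (rule mult_le_mono1)
    have "j * (q - 1) + k + 1 \<le> (j + 1) * (q - 1)" using assms(2) by simp
    also have "\<dots> \<le> m * (q - 1)" using assms(1) by (intro mult_le_mono1) simp
    finally show "j * (q - 1) + k + 1 \<le> m * (q - 1)" .
  qed
  finally have "((j * (q - 1) + k) * q + y + 1) * (w + a + 1) \<le> (m * (q - 1) * q) * (w + a + 1)"
    by (intro mult_le_mono1) simp
  then have "((j * (q - 1) + k) * q + y) * (w + a + 1) + (w + a + 1) \<le> helpers m q w a"
    by (simp only: helpers_def mult.assoc distrib_right mult_1)
  then show "helper_base m q w a j k y + a + w < col_A m q w a"
    by (simp add: helper_base_def col_A_def)
qed (simp add: helper_base_def)

text \<open>Distinct triples have distinct mixed radix numbers, and consecutive numbers are a full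
  block of \<open>w + a + 1\<close> columns apart.\<close>

lemma helper_disjoint:
  assumes "k < q - 1" "y < q" "k' < q - 1" "y' < q" "(j, k, y) \<noteq> (j', k', y')"
  shows "helper_base m q w a j k y + a + w < helper_base m q w a j' k' y' \<or>
         helper_base m q w a j' k' y' + a + w < helper_base m q w a j k y"
proof -
  let ?r = "(j * (q - 1) + k) * q + y" and ?r' = "(j' * (q - 1) + k') * q + y'"
  have "?r \<noteq> ?r'"
  proof
    assume e: "?r = ?r'"
    have "?r div q = j * (q - 1) + k" "?r' div q = j' * (q - 1) + k'" "?r mod q = y" "?r' mod q = y'"
      using assms by simp_all
    then have "j * (q - 1) + k = j' * (q - 1) + k'" "y = y'" using e by simp_all
    moreover have "(j * (q - 1) + k) div (q - 1) = j" "(j' * (q - 1) + k') div (q - 1) = j'"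
      using assms by simp_all
    ultimately show False using assms(5) by simp
  qed
  have less: "c + r * (w + a + 1) + a + w < c + r' * (w + a + 1)" if "r + 1 \<le> r'" for c r r'
  proof -
    have "(r + 1) * (w + a + 1) \<le> r' * (w + a + 1)" using that by (rule mult_le_mono1)
    then have "r * (w + a + 1) + (w + a + 1) \<le> r' * (w + a + 1)" by (simp only: distrib_right mult_1)
    then show ?thesis by linarith
  qed
  have "?r + 1 \<le> ?r' \<or> ?r' + 1 \<le> ?r" using \<open>?r \<noteq> ?r'\<close> by linarith
  then show ?thesis unfolding helper_base_def using less by blast
qed

lemma digit_column_bound: "j < m \<Longrightarrow> b < w \<Longrightarrow> j * w + b < m * (w :: nat)"
proof -
  assume "j < m" "b < w"
  then have "j * w + b < (j + 1) * w" by simp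
  also have "\<dots> \<le> m * w" using \<open>j < m\<close> by (intro mult_le_mono1) simp
  finally show ?thesis .
qed

lemma digit_column_eq:
  fixes w :: nat
  assumes "b < w"
  shows "j * w \<le> j' * w + b \<and> j' * w + b < j * w + w \<longleftrightarrow> j = j'"
proof
  assume *: "j * w \<le> j' * w + b \<and> j' * w + b < j * w + w"
  have "j * w < (j' + 1) * w" "j' * w < (j + 1) * w" using * assms by simp_all
  then show "j = j'" by (metis Suc_eq_plus1 less_Suc_eq_le mult_less_cancel2 order_antisym)
qed (use assms in simp)

lemma col_S_le_col_H: "a \<le> col_S m w a" "col_S m w a + m * w \<le> col_H m w a"
  by (auto simp: col_S_def col_T_def col_H_def)

lemma flip_table_entry:
  fixes m q w a j k y
  defines "h \<equiv> helper_base m q w a j k y"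
  assumes j: "j < m" and "k < q - 1" "y < q" and clear: "\<And>c. h \<le> c \<Longrightarrow> c \<le> h + a + w \<Longrightarrow> \<not> x (2, c)"
  shows "fst p \<noteq> 1 \<Longrightarrow> fst p \<noteq> 2 \<or> snd p < h \<or> snd p > h + a + w \<Longrightarrow>
           run_flips (table_entry m q w a j k y) x p = x p"
    and "run_flips (table_entry m q w a j k y) x (1, c) =
      (x (1, c) \<noteq> (j * w \<le> c \<and> c < j * w + w \<and> (\<forall>i<a. x (2, i) = bit k i) \<and>
         (\<forall>i<w. x (2, col_S m w a + j * w + i) = bit ((q - 1 - k) * y mod q) i) \<and> bit y (c - j * w)))"
proof -
  let ?v = "(q - 1 - k) * y mod q"
  define x1 where "x1 = x((2, h) := True)"
  define x2 where "x2 = run_flips (match_chain h 0 a k) x1"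
  define x3 where "x3 = run_flips (match_chain (h + a) (col_S m w a + j * w) w ?v) x2"
  have h: "col_S m w a + m * w \<le> h"
    using helper_range(1)[OF assms(2-4)] col_S_le_col_H(2)[of m w a] unfolding h_def by (meson le_trans)
  have jw: "j * w + w \<le> m * w" using j mult_le_mono1[of "Suc j" m w] by simp
  have a: "a \<le> h" and S: "col_S m w a + j * w + w \<le> h" using h jw col_S_le_col_H(1)[of a m w] by linarith+
  have run: "run_flips (table_entry m q w a j k y) x = run_flips (xor_out (h + a + w) (j * w) w y) x3"
    using clear[of h] by (simp add: table_entry_def Let_def flip_gate_def x1_def x2_def x3_def flip: h_def)
  have x1: "\<And>i. i < a \<Longrightarrow> \<not> x1 (2, h + Suc i)" using clear by (auto simp: x1_def)
  have x2: "x2 (2, h + a) \<longleftrightarrow> (\<forall>i<a. x (2, i) = bit k i)"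
    "\<And>p. fst p \<noteq> 2 \<or> snd p \<le> h \<or> snd p > h + a \<Longrightarrow> x2 p = x1 p"
    using flip_match_chain[where n = a and h = h and x = x1 and c = 0 and v = k, OF x1] a by (auto simp: x2_def x1_def)
  have x2': "\<And>i. i < w \<Longrightarrow> \<not> x2 (2, h + a + Suc i)" using clear x2(2) by (auto simp: x1_def)
  have x3: "x3 (2, h + a + w) \<longleftrightarrow> x2 (2, h + a) \<and> (\<forall>i<w. x2 (2, col_S m w a + j * w + i) = bit ?v i)"
    "\<And>p. fst p \<noteq> 2 \<or> snd p \<le> h + a \<or> snd p > h + a + w \<Longrightarrow> x3 p = x2 p"
    using flip_match_chain[where n = w and h = "h + a" and x = x2 and c = "col_S m w a + j * w" and v = ?v, OF x2'] S unfolding x3_def by auto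
  have S_bits: "x2 (2, col_S m w a + j * w + i) = x (2, col_S m w a + j * w + i)" if "i < w" for i
    using x2(2)[of "(2, col_S m w a + j * w + i)"] that S by (simp add: x1_def)
  show "run_flips (table_entry m q w a j k y) x p = x p"
    if "fst p \<noteq> 1" "fst p \<noteq> 2 \<or> snd p < h \<or> snd p > h + a + w"
    using that x2(2)[of p] x3(2)[of p] unfolding run flip_xor_out by (cases p) (auto simp: x1_def)
  show "run_flips (table_entry m q w a j k y) x (1, c) =
      (x (1, c) \<noteq> (j * w \<le> c \<and> c < j * w + w \<and> (\<forall>i<a. x (2, i) = bit k i) \<and>
         (\<forall>i<w. x (2, col_S m w a + j * w + i) = bit ?v i) \<and> bit y (c - j * w)))"
    unfolding run flip_xor_out using x2(2)[of "(1, c)"] x3(2)[of "(1, c)"]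
    by (auto simp: x1_def x3(1) x2(1) S_bits)
qed

lemma concat_map_product:
  "concat (map f (List.product xs ys)) = concat (map (\<lambda>x. concat (map (\<lambda>y. f (x, y)) ys)) xs)"
  by (induction xs) (auto simp: comp_def)

lemma table_as_list: "table m q w a = concat (map (\<lambda>(j, k, y). table_entry m q w a j k y)
    (List.product [0..<m] (List.product [0..<q - 1] [0..<q])))"
  by (simp add: table_def concat_map_product)

text \<open>Makes the lookup unambiguous: for prime \<open>q\<close> the factor
  \<open>q - 1 - k\<close> is invertible, so at most one table entry per digit fires.\<close>

lemma mult_mod_prime_cancel:
  fixes c y z q :: nat
  assumes "prime q" "0 < c" "c < q" "y < q" "z < q" "c * y mod q = c * z mod q"
  shows "y = z"
proof -
  have aux: "y = z" if "y \<le> z" "z < q" "c * y mod q = c * z mod q" for y z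
  proof -
    have "q dvd c * z - c * y" using that mod_eq_dvd_iff_nat[of "c * y" "c * z" q] by simp
    then have "q dvd c * (z - y)" by (simp add: diff_mult_distrib2)
    then have "q dvd c \<or> q dvd z - y" using assms(1) by (simp add: prime_dvd_mult_iff)
    then show ?thesis using assms(2,3) that by (auto dest: dvd_imp_le)
  qed
  show ?thesis using aux[of y z] aux[of z y] assms by (cases "y \<le> z") auto
qed

text \<open>Among the entries for digit \<open>j\<close> exactly the one with multiplier
  \<open>k\<close> and value \<open>y ! j\<close> fires. Induction over the list of entries,
  appending one at a time.\<close>

lemma flip_table:
  fixes m q :: nat and y :: "nat list"
  defines "w \<equiv> digit_width q" and "a \<equiv> digit_width (q - 1)"
  assumes q: "prime q" and k: "k < q - 1" and y: "y \<in> digit_vectors q m"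
    and K: "\<And>i. i < a \<Longrightarrow> x (2, i) = bit k i"
    and S: "\<And>j i. j < m \<Longrightarrow> i < w \<Longrightarrow> x (2, col_S m w a + j * w + i) = bit ((q - 1 - k) * (y ! j) mod q) i"
    and clear: "\<And>c. col_H m w a \<le> c \<Longrightarrow> c < col_A m q w a \<Longrightarrow> \<not> x (2, c)"
  shows "fst p \<noteq> 1 \<or> snd p \<ge> m * w \<Longrightarrow> fst p \<noteq> 2 \<or> snd p < col_H m w a \<or> snd p \<ge> col_A m q w a \<Longrightarrow>
           run_flips (table m q w a) x p = x p"
    and "j < m \<Longrightarrow> b < w \<Longrightarrow> run_flips (table m q w a) x (1, j * w + b) = (x (1, j * w + b) \<noteq> bit (y ! j) b)"
proof -
  let ?run = "\<lambda>ts. run_flips (concat (map (\<lambda>(j, k, y). table_entry m q w a j k y) ts)) x"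
  let ?ok = "\<lambda>ts. distinct ts \<and> (\<forall>(j, k, y) \<in> set ts. j < m \<and> k < q - 1 \<and> y < q)"
  have q1: "q \<ge> 2" using q by (simp add: prime_ge_2_nat)
  \<comment> \<open>Three invariants: qubits outside the symbol and the helpers keep their values;
    the helpers of entries not yet processed are still clear; and digit \<open>j\<close> of the
    symbol has received \<open>y ! j\<close> iff the matching entry has been processed.\<close>
  have main: "(\<forall>p. (fst p \<noteq> 1 \<or> snd p \<ge> m * w) \<longrightarrow> (fst p \<noteq> 2 \<or> snd p < col_H m w a \<or> snd p \<ge> col_A m q w a) \<longrightarrow>
         ?run ts p = x p) \<and>
      (\<forall>j k y c. (j, k, y) \<notin> set ts \<longrightarrow> j < m \<longrightarrow> k < q - 1 \<longrightarrow> y < q \<longrightarrow>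
         helper_base m q w a j k y \<le> c \<longrightarrow> c \<le> helper_base m q w a j k y + a + w \<longrightarrow> \<not> ?run ts (2, c)) \<and>
      (\<forall>j<m. \<forall>b<w. ?run ts (1, j * w + b) = (x (1, j * w + b) \<noteq> ((j, k, y ! j) \<in> set ts \<and> bit (y ! j) b)))"
    if "?ok ts" for ts
    using that
  proof (induction ts rule: rev_induct)
    case Nil
    have "\<not> x (2, c)" if "j < m" "k' < q - 1" "y' < q" "helper_base m q w a j k' y' \<le> c"
      "c \<le> helper_base m q w a j k' y' + a + w" for j k' y' c
      using helper_range[OF that(1-3), of w a] that(4,5) by (intro clear) linarith+
    then show ?case by simp
  next
    case (snoc t ts)
    obtain j k' y' where t: "t = (j, k', y')" by (cases t)
    have tr: "j < m" "k' < q - 1" "y' < q" "(j, k', y') \<notin> set ts" using snoc.prems by (auto simp: t)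
    let ?z = "?run ts" and ?h = "helper_base m q w a j k' y'"
    have "?ok ts" using snoc.prems by auto
    note IH = snoc.IH[OF this]
    have z1: "?z p = x p" if "fst p \<noteq> 1 \<or> snd p \<ge> m * w" "fst p \<noteq> 2 \<or> snd p < col_H m w a \<or> snd p \<ge> col_A m q w a" for p
      by (rule IH[THEN conjunct1, rule_format, OF that])
    have z2: "\<not> ?z (2, c)" if "(j, k, y) \<notin> set ts" "j < m" "k < q - 1" "y < q"
      "helper_base m q w a j k y \<le> c" "c \<le> helper_base m q w a j k y + a + w" for j k y c
      by (rule IH[THEN conjunct2, THEN conjunct1, rule_format, OF that])
    have z3: "?z (1, j * w + b) = (x (1, j * w + b) \<noteq> ((j, k, y ! j) \<in> set ts \<and> bit (y ! j) b))"
      if "j < m" "b < w" for j b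
      by (rule IH[THEN conjunct2, THEN conjunct2, rule_format, OF that])
    have run: "?run (ts @ [t]) = run_flips (table_entry m q w a j k' y') ?z" by (simp add: t)
    have clear_t: "\<And>c. ?h \<le> c \<Longrightarrow> c \<le> ?h + a + w \<Longrightarrow> \<not> ?z (2, c)" using z2 tr by blast
    have entry1: "run_flips (table_entry m q w a j k' y') ?z p = ?z p"
      if "fst p \<noteq> 1" "fst p \<noteq> 2 \<or> snd p < ?h \<or> snd p > ?h + a + w" for p
      by (rule flip_table_entry(1)[OF tr(1-3) _ that]) (rule clear_t)
    have entry2: "run_flips (table_entry m q w a j k' y') ?z (1, c) =
      (?z (1, c) \<noteq> (j * w \<le> c \<and> c < j * w + w \<and> (\<forall>i<a. ?z (2, i) = bit k' i) \<and>
         (\<forall>i<w. ?z (2, col_S m w a + j * w + i) = bit ((q - 1 - k') * y' mod q) i) \<and> bit y' (c - j * w)))" for c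
      by (rule flip_table_entry(2)[OF tr(1-3)]) (rule clear_t)
    have colH: "col_H m w a \<le> ?h" "?h + a + w < col_A m q w a" using helper_range[OF tr(1-3)] by auto
    have kk: "(\<forall>i<a. ?z (2, i) = bit k' i) \<longleftrightarrow> k' = k"
    proof -
      have "?z (2, i) = bit k i" if "i < a" for i
        using z1[of "(2, i)"] K[OF that] that col_S_le_col_H[where m = m and w = w and a = a] by simp
      moreover have "k' = k" if "\<forall>i<a. bit k i = bit k' i"
        by (rule bits_eqI[of _ a]) (use that tr k le_power_digit_width[of "q - 1"] in \<open>auto simp: a_def\<close>)
      ultimately show ?thesis by auto
    qed
    \<comment> \<open>The qubits compared here are untouched so far and hold the scaled digit of
      \<open>y\<close>; cancelling the factor modulo \<open>q\<close> turns equality of the scaled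
      digits into \<open>y' = y ! j\<close>.\<close>
    have yy: "(\<forall>i<w. ?z (2, col_S m w a + j * w + i) = bit ((q - 1 - k) * y' mod q) i) \<longleftrightarrow> y' = y ! j"
    proof -
      have yj: "y ! j < q" using y tr(1) by (auto simp: digit_vectors_def)
      have "?z (2, col_S m w a + j * w + i) = bit ((q - 1 - k) * (y ! j) mod q) i" if "i < w" for i
        using z1[of "(2, col_S m w a + j * w + i)"] S[OF tr(1) that] digit_column_bound[OF tr(1) that]
          col_S_le_col_H(2)[of m w a] by simp
      moreover have "y' = y ! j"
        if "\<forall>i<w. bit ((q - 1 - k) * (y ! j) mod q) i = bit ((q - 1 - k) * y' mod q) i"
      proof -
        have "z mod q < 2 ^ w" for z
          using le_power_digit_width[of q] mod_less_divisor[of q z] q1 unfolding w_def by linarith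
        then have "(q - 1 - k) * (y ! j) mod q = (q - 1 - k) * y' mod q"
          by (intro bits_eqI[of _ w]) (use that in auto)
        then show ?thesis
          using mult_mod_prime_cancel[OF q, of "q - 1 - k" y' "y ! j"] k tr(3) yj by simp
      qed
      ultimately show ?thesis by auto
    qed
    show ?case
    proof (intro conjI allI impI)
      fix p :: qubit
      assume p: "fst p \<noteq> 1 \<or> snd p \<ge> m * w" "fst p \<noteq> 2 \<or> snd p < col_H m w a \<or> snd p \<ge> col_A m q w a"
      show "?run (ts @ [t]) p = x p"
      proof (cases "fst p = 1")
        case True
        then obtain c where c: "p = (1, c)" "c \<ge> m * w" using p by (cases p) auto
        then have "\<not> c < j * w + w"
          using tr(1) mult_le_mono1[of "Suc j" m w] by simp
        then show ?thesis unfolding run c(1) entry2 using z1[of "(1, c)"] c by simp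
      next
        case False
        then show ?thesis unfolding run using entry1[of p] z1[of p] p colH by auto
      qed
    next
      fix j2 k2 y2 c
      assume *: "(j2, k2, y2) \<notin> set (ts @ [t])" "j2 < m" "k2 < q - 1" "y2 < q"
        "helper_base m q w a j2 k2 y2 \<le> c" "c \<le> helper_base m q w a j2 k2 y2 + a + w"
      have "c < ?h \<or> ?h + a + w < c"
        using helper_disjoint[OF *(3,4) tr(2,3), of j2 j m w a] * by (auto simp: t)
      then show "\<not> ?run (ts @ [t]) (2, c)"
        unfolding run using entry1[of "(2, c)"] z2[of j2 k2 y2 c] * by auto
    next
      fix j2 b assume jb: "j2 < m" "b < w"
      show "?run (ts @ [t]) (1, j2 * w + b) =
          (x (1, j2 * w + b) \<noteq> ((j2, k, y ! j2) \<in> set (ts @ [t]) \<and> bit (y ! j2) b))"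
      proof (cases "j = j2")
        case True
        then have "(\<forall>i<a. ?z (2, i) = bit k' i) \<and>
            (\<forall>i<w. ?z (2, col_S m w a + j * w + i) = bit ((q - 1 - k') * y' mod q) i) \<longleftrightarrow> t = (j2, k, y ! j2)"
          using kk yy by (auto simp: t)
        then show ?thesis
          unfolding run entry2 z3[OF jb] using True tr(4) jb by (auto simp: t)
      next
        case False
        then show ?thesis
          unfolding run entry2 z3[OF jb] using digit_column_eq[OF jb(2), of j j2] by (auto simp: t)
      qed
    qed
  qed
  let ?ts = "List.product [0..<m] (List.product [0..<q - 1] [0..<q])"
  have ok: "?ok ?ts" by (auto simp: distinct_product)
  show "run_flips (table m q w a) x p = x p"
    if "fst p \<noteq> 1 \<or> snd p \<ge> m * w" "fst p \<noteq> 2 \<or> snd p < col_H m w a \<or> snd p \<ge> col_A m q w a"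
    unfolding table_as_list using main[OF ok] that by blast
  show "run_flips (table m q w a) x (1, j * w + b) = (x (1, j * w + b) \<noteq> bit (y ! j) b)" if "j < m" "b < w"
  proof -
    have "y ! j < q" using y that by (auto simp: digit_vectors_def)
    then have "(j, k, y ! j) \<in> set ?ts" using that k by auto
    then show ?thesis unfolding table_as_list using main[OF ok] that by blast
  qed
qed

section \<open>The simulated oracle\<close>

text \<open>Row 0 may only control and row 1 may only be a target. These are the two facts behind
  preservation of the index and the XOR action on the symbol.\<close>

definition row_gate :: "('x, 'i, 's) block_code \<Rightarrow> nat \<Rightarrow> nat gate \<Rightarrow> bool" where
  "row_gate C l g \<longleftrightarrow> (\<forall>p \<in> set (gate_qubits C l g). fst p = 2) \<or>
     (\<exists>c t. g = CNOT c t \<and> c \<noteq> t \<and> fst t \<noteq> 0 \<and> fst c \<noteq> 1)"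

lemma apply_op_shift:
  assumes "\<forall>p \<in> set ws. \<not> d p"
  shows "apply_op U ws (\<lambda>x. \<psi> (\<lambda>p. x p \<noteq> d p)) x = apply_op U ws \<psi> (\<lambda>p. x p \<noteq> d p)"
proof -
  have "map (\<lambda>p. x p \<noteq> d p) ws = map x ws" using assms by auto
  moreover have "(\<lambda>p. assign_bits x ws y p \<noteq> d p) = assign_bits (\<lambda>p. x p \<noteq> d p) ws y" for y
    using assms by (auto simp: assign_bits_def fun_eq_iff split: option.split dest!: map_of_SomeD set_zip_leftD)
  ultimately show ?thesis by (simp only: apply_op_def)
qed

text \<open>No gate reads row 1, so XORing a fixed mask \<open>d\<close> onto that row commutes with
  the circuit.\<close>

lemma run_gates_shift:
  assumes "\<forall>g \<in> set gs. row_gate C l g" "\<And>p. d p \<Longrightarrow> fst p = 1"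
  shows "run_gates C l Q gs (\<lambda>x. \<psi> (\<lambda>p. x p \<noteq> d p)) = (\<lambda>x. run_gates C l Q gs \<psi> (\<lambda>p. x p \<noteq> d p))"
  using assms(1)
proof (induction gs arbitrary: \<psi>)
  case (Cons g gs)
  have "apply_op (gate_op Q g) (gate_qubits C l g) (\<lambda>x. \<psi> (\<lambda>p. x p \<noteq> d p)) =
      (\<lambda>x. apply_op (gate_op Q g) (gate_qubits C l g) \<psi> (\<lambda>p. x p \<noteq> d p))"
  proof (cases "\<forall>p \<in> set (gate_qubits C l g). fst p = 2")
    case True
    then have "\<forall>p \<in> set (gate_qubits C l g). \<not> d p" using assms(2) by fastforce
    then show ?thesis by (intro ext apply_op_shift)
  next
    case False
    then obtain c t where g: "g = CNOT c t" "c \<noteq> t" "fst t \<noteq> 0" "fst c \<noteq> 1"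
      using Cons.prems by (auto simp: row_gate_def)
    then have "\<not> d c" using assms(2) by blast
    then have "(\<lambda>p. flip_gate g x p \<noteq> d p) = flip_gate g (\<lambda>p. x p \<noteq> d p)" for x
      using g by (auto simp: flip_gate_def fun_eq_iff)
    then show ?thesis using apply_classical_gate[of g Q C l] g by (intro ext) simp
  qed
  then show ?case using Cons.IH Cons.prems by simp
qed simp

text \<open>No gate changes row 0, so multiplication by a function of that row commutes with the
  circuit. Applied to the indicator of an index, it shows that the index is preserved.\<close>

lemma run_gates_row0:
  fixes f :: "(qubit \<Rightarrow> bool) \<Rightarrow> complex"
  assumes "\<forall>g \<in> set gs. row_gate C l g" "\<And>x y. (\<And>c. x (0, c) = y (0, c)) \<Longrightarrow> f x = f y"
  shows "run_gates C l Q gs (\<lambda>x. f x * \<psi> x) = (\<lambda>x. f x * run_gates C l Q gs \<psi> x)"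
  using assms(1)
proof (induction gs arbitrary: \<psi>)
  case (Cons g gs)
  have "apply_op (gate_op Q g) (gate_qubits C l g) (\<lambda>x. f x * \<psi> x) =
      (\<lambda>x. f x * apply_op (gate_op Q g) (gate_qubits C l g) \<psi> x)"
  proof (cases "\<forall>p \<in> set (gate_qubits C l g). fst p = 2")
    case True
    have "f (assign_bits x (gate_qubits C l g) y) = f x" for x y
      by (rule assms(2)) (use True in \<open>auto intro!: assign_bits_notin\<close>)
    then show ?thesis by (auto simp: apply_op_def sum_distrib_left mult.left_commute)
  next
    case False
    then obtain c t where g: "g = CNOT c t" "c \<noteq> t" "fst t \<noteq> 0" "fst c \<noteq> 1"
      using Cons.prems by (auto simp: row_gate_def)
    have "f (flip_gate g x) = f x" for x
      by (rule assms(2)) (use g in \<open>auto simp: flip_gate_def\<close>)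
    then show ?thesis using apply_classical_gate[of g Q C l] g by (intro ext) simp
  qed
  then show ?case using Cons.IH Cons.prems by simp
qed simp

lemma sum_bitstrings_conj:
  "z \<in> bitstrings k \<Longrightarrow> (\<Sum>Z \<in> bitstrings k. of_bool (P \<and> Z = z) * c) = of_bool P * (c :: complex)"
  using sum_bitstrings_delta(1)[of z k "\<lambda>_. c"] by (cases P) simp_all

lemma cis_fraction_cong:
  assumes "d \<ge> 1" "int d dvd j - k"
  shows "cis (2 * pi * (real_of_int j / real d)) = cis (2 * pi * (real_of_int k / real d))"
proof -
  have "cis (2 * pi * (real_of_int (j - k) / real d)) = 1" using cis_fraction_eq_1 assms by blast
  moreover have "cis (2 * pi * (real_of_int j / real d)) =
      cis (2 * pi * (real_of_int (j - k) / real d)) * cis (2 * pi * (real_of_int k / real d))"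
    by (simp add: cis_mult diff_divide_distrib algebra_simps)
  ultimately show ?thesis by simp
qed

text \<open>The sum over all characters without the trivial one; the shift \<open>k + 1\<close>
  skips the multiplier 0. The term \<open>-1\<close> is what a wrong symbol contributes.\<close>

lemma sum_nontrivial_characters:
  assumes "d \<ge> 1"
  shows "(\<Sum>k<d - 1. cis (2 * pi * (real_of_int (int (k + 1) * t) / real d))) =
     (if int d dvd t then of_nat d else 0) - 1"
proof -
  have "(\<Sum>i<Suc (d - 1). cis (2 * pi * (real_of_int (int i * t) / real d))) =
      1 + (\<Sum>k<d - 1. cis (2 * pi * (real_of_int (int (k + 1) * t) / real d)))"
    by (subst sum.lessThan_Suc_shift) simp
  moreover have "Suc (d - 1) = d" using assms by simp
  ultimately have "(if int d dvd t then of_nat d else 0) =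
      1 + (\<Sum>k<d - 1. cis (2 * pi * (real_of_int (int (k + 1) * t) / real d)))"
    using sum_roots_of_unity[OF assms, of t] by (simp only:)
  then show ?thesis by (simp only: add_diff_cancel_left')
qed

definition sim_qubits :: "nat \<Rightarrow> nat \<Rightarrow> qubit list" where
  "sim_qubits k n = block (0, 0) k @ block (1, 0) k @ block (2, 0) n"

lemma in_sim_qubits:
  "p \<in> set (sim_qubits k n) \<longleftrightarrow>
     fst p = 0 \<and> snd p < k \<or> fst p = 1 \<and> snd p < k \<or> fst p = 2 \<and> snd p < n"
  by (auto simp: sim_qubits_def in_set_block)

lemma distinct_sim_qubits: "distinct (sim_qubits k n)"
  by (auto simp: sim_qubits_def in_set_block)

lemma length_sim_qubits [simp]: "length (sim_qubits k n) = k + k + n"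
  by (simp add: sim_qubits_def)

definition sim_gate :: "('x, 'i, 's) block_code \<Rightarrow> nat \<Rightarrow> nat \<Rightarrow> nat \<Rightarrow> nat gate \<Rightarrow> bool" where
  "sim_gate C l k n g \<longleftrightarrow> row_gate C l g \<and> set (gate_qubits C l g) \<subseteq> set (sim_qubits k n) \<and>
     distinct (gate_qubits C l g) \<and> (classical_gate g \<or> phase_gate g \<or> qft_gate g \<or> query_gate g)"

lemma sim_gate_match_chain:
  assumes "x + n \<le> h" "h + n < A" "g \<in> set (match_chain h x n v)"
  shows "sim_gate C l k (A + l) g \<and> classical_gate g"
  using assms by (auto simp: match_chain_def sim_gate_def row_gate_def in_sim_qubits split: if_splits)

lemma sim_gate_xor_out:
  assumes "x + n \<le> k" "h < A" "g \<in> set (xor_out h x n v)"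
  shows "sim_gate C l k (A + l) g \<and> classical_gate g"
  using assms by (auto simp: xor_out_def sim_gate_def row_gate_def in_sim_qubits split: if_splits)

lemma sim_gate_table:
  assumes "g \<in> set (table m q w a)"
  shows "sim_gate C l (m * w) (col_A m q w a + l) g \<and> classical_gate g"
proof -
  obtain j k y where t: "j < m" "k < q - 1" "y < q" "g \<in> set (table_entry m q w a j k y)"
    using assms by (auto simp: table_def)
  let ?h = "helper_base m q w a j k y"
  have h: "col_H m w a \<le> ?h" "?h + a + w < col_A m q w a" using helper_range[OF t(1-3)] by auto
  have jw: "j * w + w \<le> m * w" using t(1) mult_le_mono1[of "Suc j" m w] by simp
  have S: "col_S m w a + j * w + w \<le> ?h + a" "a \<le> ?h"
    using h(1) jw col_S_le_col_H[where m = m and w = w and a = a] by linarith+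
  have "sim_gate C l (m * w) (col_A m q w a + l) (NOT (2, ?h))"
    using h by (auto simp: sim_gate_def row_gate_def in_sim_qubits)
  moreover have "?h + a < col_A m q w a" using h(2) by simp
  ultimately show ?thesis
    using t(4) S h(2) jw sim_gate_match_chain[of 0 a ?h "col_A m q w a" g k C l "m * w"]
      sim_gate_match_chain[of "col_S m w a + j * w" w "?h + a" "col_A m q w a" g _ C l "m * w"]
      sim_gate_xor_out[of "j * w" w "m * w" "?h + a + w" "col_A m q w a" g y C l]
    by (auto simp: table_entry_def Let_def)
qed

lemma sim_gate_query_circuit:
  fixes m q
  defines "w \<equiv> digit_width q" and "a \<equiv> digit_width (q - 1)"
  assumes "q \<ge> 2" "index_width C = m * w + m * w" "symbol_width C = w" "g \<in> set (query_circuit m q w a)"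
  shows "sim_gate C l (m * w) (col_A m q w a + l) g"
proof -
  have cols: "col_S m w a = a + m * w" "col_T m w a = a + m * w + m * w"
    "col_H m w a = a + m * w + m * w + w" "a + m * w + m * w + w \<le> col_A m q w a"
    by (auto simp: col_S_def col_T_def col_H_def col_A_def)
  have F: "sim_gate C l (m * w) (col_A m q w a + l) g" if gF: "g \<in> set (fourier_layer m q w a)"
  proof -
    obtain j where j: "j < m" "g = QFT q (2, col_S m w a + j * w)" using gF by (auto simp: fourier_layer_def)
    have "j * w + w \<le> m * w" using j(1) mult_le_mono1[of "Suc j" m w] by simp
    then show ?thesis
      using assms(3) cols by (auto simp: j(2) sim_gate_def row_gate_def in_sim_qubits in_set_block simp flip: w_def)
  qed
  have K: "sim_gate C l (m * w) (col_A m q w a + l) (QFT (q - 1) (2, 0))"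
  proof -
    have "digit_width (q - Suc 0) = a" by (simp add: a_def)
    then show ?thesis
      using assms(3) cols(4) by (auto simp: sim_gate_def row_gate_def in_sim_qubits in_set_block)
  qed
  have I: "sim_gate C l (m * w) (col_A m q w a + l) g" if "g \<in> set (copy_index m w a)"
    using that cols(4) by (auto simp: copy_index_def sim_gate_def row_gate_def in_sim_qubits)
  have P: "sim_gate C l (m * w) (col_A m q w a + l) g" if "g \<in> set (phase_layer m q w a)"
    using that cols assms(3) by (auto simp: phase_layer_def sim_gate_def row_gate_def in_sim_qubits)
  have O: "sim_gate C l (m * w) (col_A m q w a + l) (Query (2, a) (2, col_T m w a) (2, col_A m q w a))"
    "sim_gate C l (m * w) (col_A m q w a + l) (QueryInv (2, a) (2, col_T m w a) (2, col_A m q w a))"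
    using cols assms(4,5) by (auto simp: sim_gate_def row_gate_def in_sim_qubits in_set_block)
  show ?thesis
    using assms(6) F K I P O sim_gate_table[of g m q w a C l] by (auto simp: query_circuit_def)
qed

section \<open>Amplitudes along one simulated query\<close>

locale hadamard_simulation =
  fixes C1 :: "('x, 'i, nat list) block_code" and q m l :: nat and Q :: operator
    and \<alpha> :: "'i \<times> nat list \<Rightarrow> bool list \<Rightarrow> complex" and \<phi> :: "'i \<times> nat list \<Rightarrow> bool list \<Rightarrow> bool list \<Rightarrow> complex"
  assumes prime: "prime q"
    and symbols: "symbol_bits C1 = vector_bits q" "symbol_width C1 = m * digit_width q"
    and index_width: "index_width C1 = m * digit_width q"
    and index_bits: "\<And>r. r \<in> indices C1 \<Longrightarrow> index_bits C1 r \<in> bitstrings (m * digit_width q)"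
    and corrupted: "corrupted_codeword (concatenated_code (hadamard_code q m) C1) l Q \<alpha> \<phi>"
begin

abbreviation "w \<equiv> digit_width q"
abbreviation "a \<equiv> digit_width (q - 1)"
abbreviation "C \<equiv> concatenated_code (hadamard_code q m) C1"
abbreviation "anc \<equiv> col_A m q w a + l"
abbreviation "ws \<equiv> sim_qubits (m * w) anc"
abbreviation "zeros k \<equiv> replicate k False"
abbreviation "H0 \<equiv> zeros (helpers m q w a)"

definition sim_op :: operator where
  "sim_op = circuit_mat C l Q ws (query_circuit m q w a)"

lemma q: "q \<ge> 2"
  using prime by (simp add: prime_ge_2_nat)

lemma C_simps [simp]:
  "index_width C = m * w + m * w" "symbol_width C = w" "indices C = indices C1 \<times> digit_vectors q m"
  "index_bits C (r, s) = index_bits C1 r @ vector_bits q s" "symbol_bits C = digit_bits q"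
  by (auto simp: concatenated_code_def hadamard_code_def index_width)

lemma unitary_Q: "unitary_op (m * w + m * w + w + l) Q"
  using corrupted by (simp add: corrupted_codeword_def)

lemma alpha_norm:
  "r \<in> indices C1 \<Longrightarrow> s \<in> digit_vectors q m \<Longrightarrow> (\<Sum>z \<in> bitstrings w. (cmod (\<alpha> (r, s) z))\<^sup>2) = 1"
  using corrupted by (simp add: corrupted_codeword_def)

lemma phi_norm:
  "r \<in> indices C1 \<Longrightarrow> s \<in> digit_vectors q m \<Longrightarrow> z \<in> bitstrings w \<Longrightarrow>
     (\<Sum>A \<in> bitstrings l. (cmod (\<phi> (r, s) z A))\<^sup>2) = 1"
  using corrupted by (simp add: corrupted_codeword_def)

lemma Q_entry:
  assumes "r \<in> indices C1" "s \<in> digit_vectors q m" "R' \<in> bitstrings (m * w)" "S' \<in> bitstrings (m * w)"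
    "T \<in> bitstrings w" "A \<in> bitstrings l"
  shows "Q ((R' @ S') @ T @ A) ((index_bits C1 r @ vector_bits q s) @ zeros w @ zeros l) =
    of_bool (R' = index_bits C1 r \<and> S' = vector_bits q s) * (\<alpha> (r, s) T * \<phi> (r, s) T A)"
proof -
  have "Q ((R' @ S') @ T @ A) (index_bits C (r, s) @ zeros w @ zeros l) =
      (\<Sum>z \<in> bitstrings w. \<alpha> (r, s) z * of_bool (R' @ S' = index_bits C (r, s)) *
         of_bool (T = xor_bits (zeros w) z) * \<phi> (r, s) z A)"
    using corrupted[unfolded corrupted_codeword_def] assms by (fastforce simp del: append_assoc)
  also have "\<dots> = (\<Sum>z \<in> bitstrings w. of_bool (z = T) *
      (of_bool (R' @ S' = index_bits C (r, s)) * (\<alpha> (r, s) z * \<phi> (r, s) z A)))"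
    by (intro sum.cong) auto
  also have "\<dots> = of_bool (R' @ S' = index_bits C (r, s)) * (\<alpha> (r, s) T * \<phi> (r, s) T A)"
    by (rule sum_bitstrings_delta(1)[OF assms(5)])
  also have "R' @ S' = index_bits C (r, s) \<longleftrightarrow> R' = index_bits C1 r \<and> S' = vector_bits q s"
    using assms index_bits[of r] by (auto simp: bitstrings_def)
  finally show ?thesis by simp
qed

lemma sim_gates: "\<forall>g \<in> set (query_circuit m q w a). sim_gate C l (m * w) anc g"
  using sim_gate_query_circuit[of q C m _ l] q by simp

context
  fixes r :: 'i and k :: nat
  assumes r: "r \<in> indices C1" and k: "k < q - 1"
begin

abbreviation (input) "rb \<equiv> index_bits C1 r"
abbreviation (input) "K \<equiv> digit_bits (q - 1) k"

text \<open>No gate after the first changes the multiplier qubits, so the states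
  \<open>\<psi>1\<close> to \<open>\<psi>7\<close> are evaluated only where these qubits hold
  \<open>k\<close>. \<open>amp0\<close> is the amplitude of one such branch.\<close>

definition "amp0 = complex_of_real (1 / sqrt (real (q - 1)))"
definition "\<psi>0 = basis_state (cfg rb (zeros anc))"
definition "\<psi>1 = run_gates C l Q [QFT (q - 1) (2, 0)] \<psi>0"
definition "\<psi>2 = run_gates C l Q (fourier_layer m q w a) \<psi>1"
definition "\<psi>3 = run_gates C l Q (copy_index m w a) \<psi>2"
definition "\<psi>4 = run_gates C l Q [Query (2, a) (2, col_T m w a) (2, col_A m q w a)] \<psi>3"
definition "\<psi>5 = run_gates C l Q (phase_layer m q w a) \<psi>4"
definition "\<psi>6 = run_gates C l Q [QueryInv (2, a) (2, col_T m w a) (2, col_A m q w a)] \<psi>5"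
definition "\<psi>7 = run_gates C l Q (fourier_layer m q w a) \<psi>6"

lemma rb: "rb \<in> bitstrings (m * w)"
  using index_bits r .

lemma K: "K \<in> bitstrings a" "bits_val K = k" "length K = a"
  using k by (simp_all add: bits_val_digit_bits)

lemma anc: "anc = a + (m * w + (m * w + (w + (helpers m q w a + l))))"
  by (simp add: col_A_def col_H_def col_T_def col_S_def)

lemma state1:
  assumes "length Z = m * w + (m * w + (w + (helpers m q w a + l)))"
  shows "\<psi>1 (cfg rb (K @ Z)) = amp0 * of_bool (Z = zeros (length Z))"
proof -
  have "\<psi>1 (cfg rb (K @ Z)) = (\<Sum>Y \<in> bitstrings a. qft_op (q - 1) K Y * \<psi>0 (cfg rb (Y @ Z)))"
    using apply_op_cfg[of "[]" 0 K a "qft_op (q - 1)" \<psi>0 rb Z] K by (simp add: \<psi>1_def)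
  also have "\<dots> = (\<Sum>Y \<in> bitstrings a. of_bool (Y = zeros a) * (qft_op (q - 1) K Y * of_bool (Z = zeros (length Z))))"
  proof (rule sum.cong[OF refl])
    fix Y assume "Y \<in> bitstrings a"
    then have len: "length (Y @ Z) = length (zeros anc)" using assms
      by (simp add: bitstrings_def col_A_def col_H_def col_T_def col_S_def)
    have "\<psi>0 (cfg rb (Y @ Z)) = of_bool (Y @ Z = zeros anc)"
      by (simp only: \<psi>0_def basis_state_def cfg_inj[OF len])
    moreover have "zeros anc = zeros a @ zeros (length Z)" using assms by (simp only: anc replicate_add)
    moreover have "length Y = a" using \<open>Y \<in> bitstrings a\<close> by (simp add: bitstrings_def)
    ultimately show "qft_op (q - 1) K Y * \<psi>0 (cfg rb (Y @ Z)) =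
        of_bool (Y = zeros a) * (qft_op (q - 1) K Y * of_bool (Z = zeros (length Z)))"
      by simp
  qed
  also have "\<dots> = qft_op (q - 1) K (zeros a) * of_bool (Z = zeros (length Z))"
    by (rule sum_bitstrings_delta) simp
  finally show ?thesis using q K k by (simp add: qft_op_zero_column amp0_def)
qed

lemma state2:
  assumes "R \<in> bitstrings (m * w)" "S \<in> bitstrings (m * w)" "length Z = w + (helpers m q w a + l)"
  shows "\<psi>2 (cfg rb (K @ R @ S @ Z)) = amp0 * of_bool (R = zeros (m * w) \<and> Z = zeros (length Z)) *
     of_bool (S \<in> vector_bits q ` digit_vectors q m) / complex_of_real (sqrt (real q)) ^ m"
proof -
  have "run_gates C l Q (map (\<lambda>j. QFT q (2, col_S m w a + j * w)) [0..<m]) \<psi>1 (cfg rb ((K @ R) @ S @ Z)) =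
     amp0 * of_bool (R = zeros (m * w) \<and> Z = zeros (length Z)) *
     of_bool (S \<in> vector_bits q ` digit_vectors q m) / complex_of_real (sqrt (real q)) ^ m"
  proof (rule fourier_layer_from_zero)
    show "length (K @ R) = col_S m w a" using assms(1) by (simp add: bitstrings_def col_S_def digit_bits_def)
    fix S assume S: "S \<in> bitstrings (m * w)"
    have len: "length R = m * w" "length S = m * w" using assms(1) S by (simp_all add: bitstrings_def)
    have "\<psi>1 (cfg rb (K @ (R @ S @ Z))) = amp0 * of_bool (R @ S @ Z = zeros (length (R @ S @ Z)))"
      by (rule state1) (use len assms(3) in simp)
    also have "zeros (length (R @ S @ Z)) = zeros (m * w) @ zeros (m * w) @ zeros (length Z)"
      by (simp only: length_append len replicate_add)
    finally show "\<psi>1 (cfg rb ((K @ R) @ S @ Z)) =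
       amp0 * of_bool (R = zeros (m * w) \<and> Z = zeros (length Z)) * of_bool (S = zeros (m * w))"
      using len by auto
  qed (use q assms(2) in auto)
  then show ?thesis by (simp add: \<psi>2_def fourier_layer_def)
qed

lemma state3:
  assumes "R \<in> bitstrings (m * w)" "S \<in> bitstrings (m * w)" "length Z = w + (helpers m q w a + l)"
  shows "\<psi>3 (cfg rb (K @ R @ S @ Z)) = amp0 * of_bool (R = rb \<and> Z = zeros (length Z)) *
     of_bool (S \<in> vector_bits q ` digit_vectors q m) / complex_of_real (sqrt (real q)) ^ m"
proof -
  have len: "length rb = m * w" "length R = length rb" using rb assms(1) by (simp_all add: bitstrings_def)
  have "\<psi>3 (cfg rb (K @ R @ S @ Z)) = \<psi>2 (cfg rb (K @ xor_bits R rb @ S @ Z))"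
    using copy_index_cfg[of K a R rb C l Q \<psi>2 "S @ Z"] K(3) len by (simp add: \<psi>3_def copy_index_def)
  moreover have "xor_bits R rb \<in> bitstrings (m * w)" using len by (simp add: xor_bits_def bitstrings_def)
  moreover have "xor_bits R rb = zeros (m * w) \<longleftrightarrow> R = rb" using xor_bits_eq_zero[OF len(2)] len(1) by simp
  ultimately show ?thesis using state2 assms by simp
qed

definition "amp1 = amp0 / complex_of_real (sqrt (real q)) ^ m"

lemma query_gate_cfg:
  assumes "X1 \<in> bitstrings (m * w + m * w)" "T \<in> bitstrings w" "A \<in> bitstrings l"
  shows "apply_op U (block (2, a) (m * w + m * w) @ block (2, col_T m w a) w @ block (2, col_A m q w a) l) \<psi>
      (cfg rb (K @ X1 @ T @ H0 @ A)) =
    (\<Sum>R' \<in> bitstrings (m * w). \<Sum>S' \<in> bitstrings (m * w). \<Sum>T' \<in> bitstrings w. \<Sum>A' \<in> bitstrings l.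
       U (X1 @ T @ A) ((R' @ S') @ T' @ A') * \<psi> (cfg rb (K @ (R' @ S') @ T' @ H0 @ A')))"
  by (subst apply_op_cfg3)
    (use assms K(3) in \<open>simp_all add: col_T_def col_S_def col_A_def col_H_def sum_bitstrings_append\<close>)

text \<open>Before the query the symbol, helper and ancilla qubits are zero and the index is valid.
  Hence only those columns of \<open>Q\<close> occur that the definition of a corrupted codeword
  determines.\<close>

lemma state4:
  assumes s: "s \<in> digit_vectors q m" and T: "T \<in> bitstrings w" and A: "A \<in> bitstrings l"
  shows "\<psi>4 (cfg rb (K @ (rb @ vector_bits q s) @ T @ H0 @ A)) = amp1 * (\<alpha> (r, s) T * \<phi> (r, s) T A)"
proof -
  let ?vs = "vector_bits q s"
  have vs: "?vs \<in> bitstrings (m * w)" using s by (rule vector_bits_in_bitstrings)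
  have "\<psi>4 (cfg rb (K @ (rb @ ?vs) @ T @ H0 @ A)) =
    (\<Sum>R' \<in> bitstrings (m * w). \<Sum>S' \<in> bitstrings (m * w). \<Sum>T' \<in> bitstrings w. \<Sum>A' \<in> bitstrings l.
       Q ((rb @ ?vs) @ T @ A) ((R' @ S') @ T' @ A') * \<psi>3 (cfg rb (K @ (R' @ S') @ T' @ H0 @ A')))"
    using query_gate_cfg[OF bitstrings_append[OF rb vs] T A] by (simp add: \<psi>4_def)
  also have "\<dots> = (\<Sum>R' \<in> bitstrings (m * w). \<Sum>S' \<in> bitstrings (m * w). \<Sum>T' \<in> bitstrings w. \<Sum>A' \<in> bitstrings l.
       of_bool (((R' = rb \<and> S' = ?vs) \<and> T' = zeros w) \<and> A' = zeros l) * (amp1 * (\<alpha> (r, s) T * \<phi> (r, s) T A)))"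
  proof (intro sum.cong refl)
    fix R' S' T' A' assume *: "R' \<in> bitstrings (m * w)" "S' \<in> bitstrings (m * w)" "T' \<in> bitstrings w" "A' \<in> bitstrings l"
    have len: "length T' = w" "length A' = l" using * by (simp_all add: bitstrings_def)
    have "\<psi>3 (cfg rb (K @ R' @ S' @ (T' @ H0 @ A'))) =
        amp0 * of_bool (R' = rb \<and> T' @ H0 @ A' = zeros (length (T' @ H0 @ A'))) *
        of_bool (S' \<in> vector_bits q ` digit_vectors q m) / complex_of_real (sqrt (real q)) ^ m"
      by (rule state3) (use * len in auto)
    also have "zeros (length (T' @ H0 @ A')) = zeros w @ H0 @ zeros l"
      by (simp only: length_append len replicate_add length_replicate)
    finally have psi: "\<psi>3 (cfg rb (K @ (R' @ S') @ T' @ H0 @ A')) =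
        amp1 * of_bool (R' = rb \<and> T' = zeros w \<and> A' = zeros l) * of_bool (S' \<in> vector_bits q ` digit_vectors q m)"
      using len by (auto simp: amp1_def)
    show "Q ((rb @ ?vs) @ T @ A) ((R' @ S') @ T' @ A') * \<psi>3 (cfg rb (K @ (R' @ S') @ T' @ H0 @ A')) =
       of_bool (((R' = rb \<and> S' = ?vs) \<and> T' = zeros w) \<and> A' = zeros l) * (amp1 * (\<alpha> (r, s) T * \<phi> (r, s) T A))"
    proof (cases "R' = rb \<and> T' = zeros w \<and> A' = zeros l \<and> S' \<in> vector_bits q ` digit_vectors q m")
      case True
      then obtain s' where s': "S' = vector_bits q s'" "s' \<in> digit_vectors q m" by blast
      have "Q ((rb @ ?vs) @ T @ A) ((rb @ vector_bits q s') @ zeros w @ zeros l) =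
          of_bool (rb = rb \<and> ?vs = vector_bits q s') * (\<alpha> (r, s') T * \<phi> (r, s') T A)"
        by (rule Q_entry[OF r s'(2) rb vs T A])
      then show ?thesis unfolding psi using True s' vector_bits_inj[OF s s'(2)] by auto
    next
      case False
      then show ?thesis unfolding psi using s by auto
    qed
  qed
  also have "\<dots> = amp1 * (\<alpha> (r, s) T * \<phi> (r, s) T A)"
    using sum_bitstrings_conj[OF rb, of True] by (simp only: sum_bitstrings_conj replicate_in_bitstrings vs) simp
  finally show ?thesis .
qed

lemma state5:
  assumes "s \<in> digit_vectors q m" "T \<in> bitstrings w" "A \<in> bitstrings l"
  shows "\<psi>5 (cfg rb (K @ (rb @ vector_bits q s) @ T @ H0 @ A)) =
     cis (2 * pi * (real ((k + 1) * bits_val T) / real q)) * (amp1 * (\<alpha> (r, s) T * \<phi> (r, s) T A))"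
proof -
  have len: "length rb = m * w" "length (vector_bits q s) = m * w" "length T = w"
    using rb assms vector_bits_in_bitstrings[OF assms(1)] by (simp_all add: bitstrings_def)
  have "map (cfg rb (K @ (rb @ vector_bits q s) @ T @ H0 @ A)) (block (2, 0) a) = K"
    "map (cfg rb (K @ (rb @ vector_bits q s) @ T @ H0 @ A)) (block (2, col_T m w a) w) = T"
    using map_cfg_block[of "[]" 0 K a rb] map_cfg_block[of "K @ rb @ vector_bits q s" "col_T m w a" T w rb] K(3) len
    by (simp_all add: col_T_def col_S_def)
  from phase_layer_state[OF this, of C l Q q] show ?thesis
    using state4[OF assms] K(2) by (simp add: \<psi>5_def)
qed

text \<open>Evaluated only at zero symbol and ancilla qubits: the row of the adjoint there is the
  conjugate of a known column of \<open>Q\<close>. This gives squared moduli of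
  \<open>\<alpha>\<close> and \<open>\<phi>\<close>, and the unknown ancilla states sum to
  1.\<close>

lemma state6:
  assumes s: "s \<in> digit_vectors q m"
  shows "\<psi>6 (cfg rb (K @ (rb @ vector_bits q s) @ zeros w @ H0 @ zeros l)) =
     amp1 * (\<Sum>T \<in> bitstrings w. (cmod (\<alpha> (r, s) T))\<^sup>2 * cis (2 * pi * (real ((k + 1) * bits_val T) / real q)))"
proof -
  let ?vs = "vector_bits q s"
  let ?G = "\<lambda>T A. amp1 * (of_real ((cmod (\<alpha> (r, s) T))\<^sup>2) * cis (2 * pi * (real ((k + 1) * bits_val T) / real q))) *
       of_real ((cmod (\<phi> (r, s) T A))\<^sup>2)"
  have vs: "?vs \<in> bitstrings (m * w)" using s by (rule vector_bits_in_bitstrings)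
  have "\<psi>6 (cfg rb (K @ (rb @ ?vs) @ zeros w @ H0 @ zeros l)) =
    (\<Sum>R' \<in> bitstrings (m * w). \<Sum>S' \<in> bitstrings (m * w). \<Sum>T' \<in> bitstrings w. \<Sum>A' \<in> bitstrings l.
       adjoint_op Q ((rb @ ?vs) @ zeros w @ zeros l) ((R' @ S') @ T' @ A') *
         \<psi>5 (cfg rb (K @ (R' @ S') @ T' @ H0 @ A')))"
    using query_gate_cfg[OF bitstrings_append[OF rb vs], of "zeros w" "zeros l"] by (simp add: \<psi>6_def)
  also have "\<dots> = (\<Sum>R' \<in> bitstrings (m * w). \<Sum>S' \<in> bitstrings (m * w). \<Sum>T' \<in> bitstrings w. \<Sum>A' \<in> bitstrings l.
       of_bool (R' = rb \<and> S' = ?vs) * ?G T' A')"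
  proof (intro sum.cong refl)
    fix R' S' T' A' assume *: "R' \<in> bitstrings (m * w)" "S' \<in> bitstrings (m * w)" "T' \<in> bitstrings w" "A' \<in> bitstrings l"
    have adj: "adjoint_op Q ((rb @ ?vs) @ zeros w @ zeros l) ((R' @ S') @ T' @ A') =
        of_bool (R' = rb \<and> S' = ?vs) * (cnj (\<alpha> (r, s) T') * cnj (\<phi> (r, s) T' A'))"
      unfolding adjoint_op_def Q_entry[OF r s *] by simp
    show "adjoint_op Q ((rb @ ?vs) @ zeros w @ zeros l) ((R' @ S') @ T' @ A') *
         \<psi>5 (cfg rb (K @ (R' @ S') @ T' @ H0 @ A')) = of_bool (R' = rb \<and> S' = ?vs) * ?G T' A'"
    proof (cases "R' = rb \<and> S' = ?vs")
      case True
      have sq: "cnj z * z = complex_of_real ((cmod z)\<^sup>2)" for z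
        by (simp only: complex_norm_square mult.commute)
      have "cnj (\<alpha> (r, s) T') * cnj (\<phi> (r, s) T' A') *
          (cis (2 * pi * (real ((k + 1) * bits_val T') / real q)) * (amp1 * (\<alpha> (r, s) T' * \<phi> (r, s) T' A'))) =
          amp1 * ((cnj (\<alpha> (r, s) T') * \<alpha> (r, s) T') * cis (2 * pi * (real ((k + 1) * bits_val T') / real q))) *
            (cnj (\<phi> (r, s) T' A') * \<phi> (r, s) T' A')"
        by (simp only: mult_ac)
      also have "\<dots> = ?G T' A'" by (simp only: sq)
      finally show ?thesis unfolding adj using state5[OF s *(3,4)] True by simp
    next
      case False
      then show ?thesis unfolding adj by simp
    qed
  qed
  also have "\<dots> = (\<Sum>R' \<in> bitstrings (m * w). \<Sum>S' \<in> bitstrings (m * w).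
      of_bool (R' = rb \<and> S' = ?vs) * (\<Sum>T' \<in> bitstrings w. \<Sum>A' \<in> bitstrings l. ?G T' A'))"
    by (simp only: sum_distrib_left)
  also have "\<dots> = (\<Sum>T' \<in> bitstrings w. \<Sum>A' \<in> bitstrings l. ?G T' A')"
    using sum_bitstrings_conj[OF rb, of True] by (simp only: sum_bitstrings_conj[OF vs]) simp
  also have "\<dots> = (\<Sum>T' \<in> bitstrings w. amp1 * (of_real ((cmod (\<alpha> (r, s) T'))\<^sup>2) *
       cis (2 * pi * (real ((k + 1) * bits_val T') / real q))))"
  proof (rule sum.cong[OF refl])
    fix T' assume T': "T' \<in> bitstrings w"
    have "(\<Sum>A' \<in> bitstrings l. complex_of_real ((cmod (\<phi> (r, s) T' A'))\<^sup>2)) = 1"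
      using phi_norm[OF r s T'] by (simp only: of_real_sum[symmetric]) simp
    then show "(\<Sum>A' \<in> bitstrings l. ?G T' A') = amp1 * (of_real ((cmod (\<alpha> (r, s) T'))\<^sup>2) *
       cis (2 * pi * (real ((k + 1) * bits_val T') / real q)))"
      by (simp only: sum_distrib_left[symmetric] mult_1_right)
  qed
  finally show ?thesis by (simp only: sum_distrib_left)
qed

lemma state7:
  assumes y: "y' \<in> digit_vectors q m"
  shows "\<psi>7 (cfg rb (K @ (rb @ vector_bits q y') @ zeros w @ H0 @ zeros l)) = amp0 / of_nat (q ^ m) *
     (\<Sum>s \<in> digit_vectors q m. \<Sum>T \<in> bitstrings w. (cmod (\<alpha> (r, s) T))\<^sup>2 *
        cis (2 * pi * (real ((k + 1) * bits_val T + (\<Sum>i<m. y' ! i * s ! i)) / real q)))"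
proof -
  let ?r = "complex_of_real (sqrt (real q))"
  have "length (K @ rb) = col_S m w a" using rb K by (simp add: bitstrings_def col_S_def)
  from fourier_layer_sum[OF this y, of C l Q \<psi>6 rb]
  have "\<psi>7 (cfg rb (K @ (rb @ vector_bits q y') @ zeros w @ H0 @ zeros l)) =
      (\<Sum>s \<in> digit_vectors q m. cis (2 * pi * (real (\<Sum>i<m. y' ! i * s ! i) / real q)) / ?r ^ m *
        \<psi>6 (cfg rb (K @ (rb @ vector_bits q s) @ zeros w @ H0 @ zeros l)))"
    by (simp add: \<psi>7_def fourier_layer_def)
  also have "\<dots> = (\<Sum>s \<in> digit_vectors q m. amp0 / of_nat (q ^ m) * (\<Sum>T \<in> bitstrings w. (cmod (\<alpha> (r, s) T))\<^sup>2 *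
        cis (2 * pi * (real ((k + 1) * bits_val T + (\<Sum>i<m. y' ! i * s ! i)) / real q))))"
  proof (rule sum.cong[OF refl])
    fix s assume s: "s \<in> digit_vectors q m"
    let ?y = "\<Sum>i<m. y' ! i * s ! i"
    \<comment> \<open>One factor from each of the two Fourier layers.\<close>
    have rr: "?r ^ m * ?r ^ m = of_nat (q ^ m)"
      by (simp add: complex_sqrt_mult_self flip: power_mult_distrib)
    have "cis (2 * pi * (real ?y / real q)) / ?r ^ m *
        (amp1 * (\<Sum>T \<in> bitstrings w. (cmod (\<alpha> (r, s) T))\<^sup>2 * cis (2 * pi * (real ((k + 1) * bits_val T) / real q)))) =
        amp0 / (?r ^ m * ?r ^ m) * (\<Sum>T \<in> bitstrings w. (cmod (\<alpha> (r, s) T))\<^sup>2 *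
          (cis (2 * pi * (real ?y / real q)) * (cis (2 * pi * (real ((k + 1) * bits_val T) / real q)) * 1)))"
      by (simp add: amp1_def sum_distrib_left sum_divide_distrib mult_ac)
    then show "cis (2 * pi * (real ?y / real q)) / ?r ^ m *
        \<psi>6 (cfg rb (K @ (rb @ vector_bits q s) @ zeros w @ H0 @ zeros l)) =
        amp0 / of_nat (q ^ m) * (\<Sum>T \<in> bitstrings w. (cmod (\<alpha> (r, s) T))\<^sup>2 *
        cis (2 * pi * (real ((k + 1) * bits_val T + ?y) / real q)))"
      unfolding state6[OF s] rr cis_fraction_add by (simp only: mult_1_right)
  qed
  finally show ?thesis by (simp only: sum_distrib_left)
qed

end

end

section \<open>Matrix entries of the simulated oracle\<close>

definition reg :: "bool list \<Rightarrow> bool list \<Rightarrow> bool list \<Rightarrow> qubit \<Rightarrow> bool" where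
  "reg R S A = (\<lambda>(r, c). r = 0 \<and> c < length R \<and> R ! c \<or> r = 1 \<and> c < length S \<and> S ! c \<or>
     r = 2 \<and> c < length A \<and> A ! c)"

lemma map_reg:
  "length R = k \<Longrightarrow> length S = k \<Longrightarrow> length A = n \<Longrightarrow> map (reg R S A) (sim_qubits k n) = R @ S @ A"
  by (auto simp: sim_qubits_def block_def reg_def intro!: nth_equalityI)

lemma at_bits_sim_qubits:
  assumes "length R = k" "length S = k" "length A = n"
  shows "at_bits (sim_qubits k n) (R @ S @ A) = reg R S A"
proof -
  have "at_bits (sim_qubits k n) (map (reg R S A) (sim_qubits k n)) = reg R S A"
    unfolding assign_bits_map using assms
    by (auto simp: override_on_def in_sim_qubits reg_def fun_eq_iff)
  then show ?thesis by (simp only: map_reg[OF assms])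
qed

lemma cfg_reg: "cfg rb L = reg rb (replicate n False) L"
  by (auto simp: cfg_def reg_def fun_eq_iff)

lemma reg_xor:
  assumes "length S = length s"
  shows "(\<lambda>p. reg R S A p \<noteq> (fst p = 1 \<and> snd p < length s \<and> s ! snd p)) = reg R (xor_bits s S) A"
  using assms by (auto simp: reg_def xor_bits_def fun_eq_iff)

lemma xor_bits_in_bitstrings: "x \<in> bitstrings k \<Longrightarrow> y \<in> bitstrings k \<Longrightarrow> xor_bits x y \<in> bitstrings k"
  by (simp add: xor_bits_def bitstrings_def)

lemma xor_bits_flip:
  "x \<in> bitstrings k \<Longrightarrow> y \<in> bitstrings k \<Longrightarrow> z \<in> bitstrings k \<Longrightarrow> x = xor_bits y z \<longleftrightarrow> z = xor_bits y x"
  by (auto simp: xor_bits_def bitstrings_def list_eq_iff_nth_eq)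

context hadamard_simulation
begin

lemma sim_op_entry:
  assumes "R \<in> bitstrings (m * w)" "S \<in> bitstrings (m * w)" "A \<in> bitstrings anc"
    and "R' \<in> bitstrings (m * w)" "S' \<in> bitstrings (m * w)" "A' \<in> bitstrings anc"
  shows "sim_op (R @ S @ A) (R' @ S' @ A') =
    run_gates C l Q (query_circuit m q w a) (basis_state (reg R' S' A')) (reg R S A)"
proof -
  have len: "length R = m * w" "length S = m * w" "length A = anc"
    "length R' = m * w" "length S' = m * w" "length A' = anc"
    using assms by (simp_all add: bitstrings_def)
  have "sim_op (R @ S @ A) (R' @ S' @ A') = run_gates C l Q (query_circuit m q w a)
      (basis_state (at_bits ws (R' @ S' @ A'))) (at_bits ws (R @ S @ A))"
    unfolding sim_op_def
    by (rule circuit_mat_entry[OF distinct_sim_qubits])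
      (use sim_gates len in \<open>auto simp: bitstrings_def sim_gate_def\<close>)
  then show ?thesis using len by (simp add: at_bits_sim_qubits)
qed

lemma unitary_sim_op: "unitary_op (m * w + m * w + anc) sim_op"
proof -
  have "unitary_op (length ws) sim_op"
    unfolding sim_op_def
    by (rule unitary_circuit_mat[OF distinct_sim_qubits])
      (use sim_gates unitary_Q in \<open>auto simp: sim_gate_def intro!: unitary_gate\<close>)
  then show ?thesis by simp
qed

text \<open>Combines the two commutation properties of the circuit: every column with clean ancillas
  follows from the one with zero symbol, in the XOR form demanded of a corrupted codeword.\<close>

lemma sim_op_covariant:
  assumes "R \<in> bitstrings (m * w)" "S \<in> bitstrings (m * w)" "A \<in> bitstrings anc"
    and "R0 \<in> bitstrings (m * w)" "s \<in> bitstrings (m * w)" "Z \<in> bitstrings anc"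
  shows "sim_op (R @ S @ A) (R0 @ s @ Z) =
    of_bool (R = R0) * sim_op (R0 @ xor_bits s S @ A) (R0 @ zeros (m * w) @ Z)"
proof -
  let ?run = "run_gates C l Q (query_circuit m q w a)"
  let ?d = "\<lambda>p :: qubit. fst p = 1 \<and> snd p < length s \<and> s ! snd p"
  let ?f = "\<lambda>x :: qubit \<Rightarrow> bool. of_bool (map x (block (0, 0) (m * w)) = R0) :: complex"
  have rows: "\<forall>g \<in> set (query_circuit m q w a). row_gate C l g" using sim_gates by (auto simp: sim_gate_def)
  have len: "length S = length s" "length (zeros (m * w)) = length s"
    using assms by (simp_all add: bitstrings_def)
  have xs: "xor_bits s (zeros (m * w)) = s" using len by (auto simp: xor_bits_def intro!: nth_equalityI)
  have "x = reg R0 s Z \<longleftrightarrow> (\<lambda>p. x p \<noteq> ?d p) = reg R0 (zeros (m * w)) Z" for x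
    using reg_xor[OF len(2), of R0 Z, unfolded xs] by (auto simp: fun_eq_iff)
  then have "basis_state (reg R0 s Z) = (\<lambda>x. basis_state (reg R0 (zeros (m * w)) Z) (\<lambda>p. x p \<noteq> ?d p))"
    by (simp add: basis_state_def)
  then have "?run (basis_state (reg R0 s Z)) = (\<lambda>x. ?run (basis_state (reg R0 (zeros (m * w)) Z)) (\<lambda>p. x p \<noteq> ?d p))"
    using run_gates_shift[OF rows, of ?d] by simp
  then have shift: "?run (basis_state (reg R0 s Z)) (reg R S A) =
      ?run (basis_state (reg R0 (zeros (m * w)) Z)) (reg R (xor_bits s S) A)"
    using reg_xor[OF len(1)] by simp
  have fR: "?f (reg R' S' A') = of_bool (R' = R0)" if "R' \<in> bitstrings (m * w)" for R' S' A'
  proof -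
    have "map (reg R' S' A') (block (0, 0) (m * w)) = R'"
      using that by (auto simp: bitstrings_def block_def reg_def intro!: nth_equalityI)
    then show ?thesis by simp
  qed
  have "basis_state (reg R0 (zeros (m * w)) Z) = (\<lambda>x. ?f x * basis_state (reg R0 (zeros (m * w)) Z) x)"
  proof
    fix x show "basis_state (reg R0 (zeros (m * w)) Z) x = ?f x * basis_state (reg R0 (zeros (m * w)) Z) x"
      using fR[OF assms(4)] by (cases "x = reg R0 (zeros (m * w)) Z") (simp_all add: basis_state_def)
  qed
  then have "?run (basis_state (reg R0 (zeros (m * w)) Z)) =
      ?run (\<lambda>x. ?f x * basis_state (reg R0 (zeros (m * w)) Z) x)" by (rule arg_cong)
  also have "\<dots> = (\<lambda>x. ?f x * ?run (basis_state (reg R0 (zeros (m * w)) Z)) x)"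
  proof (rule run_gates_row0[OF rows])
    fix x y :: "qubit \<Rightarrow> bool" assume "\<And>c. x (0, c) = y (0, c)"
    then have "map x (block (0, 0) (m * w)) = map y (block (0, 0) (m * w))" by (simp add: block_def)
    then show "?f x = ?f y" by (simp only:)
  qed
  finally have "?run (basis_state (reg R0 (zeros (m * w)) Z)) (reg R (xor_bits s S) A) =
      ?f (reg R (xor_bits s S) A) * ?run (basis_state (reg R0 (zeros (m * w)) Z)) (reg R (xor_bits s S) A)"
    by (rule fun_cong)
  then show ?thesis
    using sim_op_entry[OF assms] sim_op_entry[OF assms(4) xor_bits_in_bitstrings[OF assms(5,2)] assms(3,4) _ assms(6)]
      shift fR[OF assms(1)] by (cases "R = R0") auto
qed

text \<open>The probability that the simulated query, on index \<open>r\<close> and zero symbol,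
  answers \<open>z\<close> with any contents of its ancillas.\<close>

definition weight :: "'i \<Rightarrow> bool list \<Rightarrow> real" where
  "weight r z = (\<Sum>A \<in> bitstrings anc.
     (cmod (sim_op (index_bits C1 r @ z @ A) (index_bits C1 r @ zeros (m * w) @ zeros anc)))\<^sup>2)"

text \<open>Only the products of \<open>\<alpha>\<close> and \<open>\<phi>\<close> are determined by
  the matrix; a nonnegative real \<open>\<alpha>\<close> carries the norm and leaves
  \<open>\<phi>\<close> normalised.\<close>

definition sim_alpha :: "'i \<Rightarrow> bool list \<Rightarrow> complex" where
  "sim_alpha r z = complex_of_real (sqrt (weight r z))"

text \<open>For weight 0 the ancilla state is arbitrary but must still be a unit vector; the zero
  string is chosen.\<close>

definition sim_phi :: "'i \<Rightarrow> bool list \<Rightarrow> bool list \<Rightarrow> complex" where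
  "sim_phi r z A = (if weight r z = 0 then of_bool (A = zeros anc)
     else sim_op (index_bits C1 r @ z @ A) (index_bits C1 r @ zeros (m * w) @ zeros anc) / sim_alpha r z)"

lemma weight_nonneg: "weight r z \<ge> 0"
  unfolding weight_def by (intro sum_nonneg) simp

lemma cmod_sim_alpha: "(cmod (sim_alpha r z))\<^sup>2 = weight r z"
  using weight_nonneg by (simp add: sim_alpha_def)

lemma sim_alpha_phi:
  assumes "A \<in> bitstrings anc"
  shows "sim_alpha r z * sim_phi r z A =
     sim_op (index_bits C1 r @ z @ A) (index_bits C1 r @ zeros (m * w) @ zeros anc)"
proof (cases "weight r z = 0")
  case True
  then have "(cmod (sim_op (index_bits C1 r @ z @ A) (index_bits C1 r @ zeros (m * w) @ zeros anc)))\<^sup>2 = 0"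
    unfolding weight_def using assms by (subst (asm) sum_nonneg_eq_0_iff) auto
  then show ?thesis using True by (simp add: sim_alpha_def)
qed (simp add: sim_phi_def sim_alpha_def)

text \<open>A column of a unitary matrix has norm 1, and by covariance this column vanishes on all
  rows with another index.\<close>

lemma sum_weight:
  assumes r: "r \<in> indices C1"
  shows "(\<Sum>z \<in> bitstrings (m * w). weight r z) = 1"
proof -
  let ?rb = "index_bits C1 r"
  let ?y = "?rb @ zeros (m * w) @ zeros anc"
  let ?N = "\<lambda>R S A. (cmod (sim_op (R @ S @ A) ?y))\<^sup>2"
  note rb = index_bits[OF r]
  have y: "?y \<in> bitstrings (m * w + m * w + anc)" using rb by (simp add: bitstrings_def)
  have "(\<Sum>X \<in> bitstrings (m * w + m * w + anc). adjoint_op sim_op ?y X * sim_op X ?y) = 1"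
    using unitary_sim_op y by (simp add: unitary_op_def)
  then have "complex_of_real (\<Sum>X \<in> bitstrings (m * w + m * w + anc). (cmod (sim_op X ?y))\<^sup>2) = 1"
    by (simp only: adjoint_op_def of_real_sum complex_norm_square mult.commute)
  then have "(\<Sum>X \<in> bitstrings (m * w + (m * w + anc)). (cmod (sim_op X ?y))\<^sup>2) = 1"
    unfolding add.assoc using of_real_eq_1_iff by blast
  then have total: "(\<Sum>R \<in> bitstrings (m * w). \<Sum>S \<in> bitstrings (m * w). \<Sum>A \<in> bitstrings anc. ?N R S A) = 1"
    by (simp only: sum_bitstrings_append)
  have "?N R S A = 0" if "R \<in> bitstrings (m * w) - {?rb}" "S \<in> bitstrings (m * w)" "A \<in> bitstrings anc" for R S A
    using sim_op_covariant[of R S A ?rb "zeros (m * w)" "zeros anc"] that rb by simp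
  then have "(\<Sum>R \<in> bitstrings (m * w). \<Sum>S \<in> bitstrings (m * w). \<Sum>A \<in> bitstrings anc. ?N R S A) =
      (\<Sum>R \<in> {?rb}. \<Sum>S \<in> bitstrings (m * w). \<Sum>A \<in> bitstrings anc. ?N R S A)"
    using rb by (intro sum.mono_neutral_right) auto
  then show ?thesis using total by (simp add: weight_def)
qed

theorem sim_corrupted: "corrupted_codeword C1 anc sim_op sim_alpha sim_phi"
  unfolding corrupted_codeword_def index_width symbols
proof (intro conjI ballI)
  show "unitary_op (m * w + m * w + anc) sim_op" by (rule unitary_sim_op)
next
  fix r assume "r \<in> indices C1"
  then show "(\<Sum>z \<in> bitstrings (m * w). (cmod (sim_alpha r z))\<^sup>2) = 1"
    by (simp add: cmod_sim_alpha sum_weight)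
next
  fix r z assume "r \<in> indices C1" "z \<in> bitstrings (m * w)"
  show "(\<Sum>A \<in> bitstrings anc. (cmod (sim_phi r z A))\<^sup>2) = 1"
  proof (cases "weight r z = 0")
    case True
    have "(\<Sum>A \<in> bitstrings anc. (cmod (sim_phi r z A))\<^sup>2) = (\<Sum>A \<in> bitstrings anc. if A = zeros anc then 1 else 0)"
      using True by (intro sum.cong) (auto simp: sim_phi_def)
    then show ?thesis by simp
  next
    case False
    have "(\<Sum>A \<in> bitstrings anc. (cmod (sim_phi r z A))\<^sup>2) = (\<Sum>A \<in> bitstrings anc.
        (cmod (sim_op (index_bits C1 r @ z @ A) (index_bits C1 r @ zeros (m * w) @ zeros anc)))\<^sup>2 / weight r z)"
      using False by (intro sum.cong) (auto simp: sim_phi_def norm_divide power_divide cmod_sim_alpha)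
    also have "\<dots> = weight r z / weight r z" by (simp only: weight_def sum_divide_distrib)
    finally show ?thesis using False by simp
  qed
next
  fix r s r' s' A
  assume *: "r \<in> indices C1" "s \<in> bitstrings (m * w)" "r' \<in> bitstrings (m * w)" "s' \<in> bitstrings (m * w)"
    "A \<in> bitstrings anc"
  let ?rb = "index_bits C1 r"
  have "(\<Sum>z \<in> bitstrings (m * w). sim_alpha r z * of_bool (r' = ?rb) * of_bool (s' = xor_bits s z) * sim_phi r z A) =
      (\<Sum>z \<in> bitstrings (m * w). of_bool (z = xor_bits s s') * (of_bool (r' = ?rb) * (sim_alpha r z * sim_phi r z A)))"
    by (intro sum.cong refl) (simp add: xor_bits_flip[OF *(4,2)])
  also have "\<dots> = of_bool (r' = ?rb) * (sim_alpha r (xor_bits s s') * sim_phi r (xor_bits s s') A)"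
    by (rule sum_bitstrings_delta(1)[OF xor_bits_in_bitstrings[OF *(2,4)]])
  also have "\<dots> = sim_op (r' @ s' @ A) (?rb @ s @ zeros anc)"
    using sim_alpha_phi[OF *(5)] sim_op_covariant[OF *(3,4,5) index_bits[OF *(1)] *(2), of "zeros anc"] by simp
  finally show "sim_op (r' @ s' @ A) (?rb @ s @ zeros anc) =
      (\<Sum>z \<in> bitstrings (m * w). sim_alpha r z * of_bool (r' = ?rb) * of_bool (s' = xor_bits s z) * sim_phi r z A)"
    by simp
qed

text \<open>Since \<open>k\<close> encodes the multiplier \<open>k + 1\<close>, this is \<open>-(k + 1) * y\<close> modulo \<open>q\<close>.\<close>

definition scaled :: "nat \<Rightarrow> nat list \<Rightarrow> nat list" where
  "scaled k y = map (\<lambda>d. (q - 1 - k) * d mod q) y"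

text \<open>Up to the factor \<open>amp0 / q ^ m\<close>, the amplitude in branch \<open>k\<close>
  of the clean configuration from which the table reads off \<open>y\<close>.\<close>

definition amplitude_sum :: "'i \<Rightarrow> nat \<Rightarrow> nat list \<Rightarrow> complex" where
  "amplitude_sum r k y = (\<Sum>s \<in> digit_vectors q m. \<Sum>T \<in> bitstrings w. (cmod (\<alpha> (r, s) T))\<^sup>2 *
        cis (2 * pi * (real ((k + 1) * bits_val T + (\<Sum>i<m. scaled k y ! i * s ! i)) / real q)))"

lemma scaled_in_digit_vectors: "y \<in> digit_vectors q m \<Longrightarrow> scaled k y \<in> digit_vectors q m"
  using q by (auto simp: digit_vectors_def scaled_def)

text \<open>The table permutes assignments, so it merely carries the amplitude of the clean
  configuration \<open>x\<close> over to \<open>x'\<close>. There row 1 reads \<open>y\<close>,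
  while row 2 holds a string \<open>A\<close> with used helpers whose first bits still encode
  \<open>k\<close>.\<close>

lemma query_circuit_outcome:
  assumes r: "r \<in> indices C1" and k: "k < q - 1" and y: "y \<in> digit_vectors q m"
  obtains A where "A \<in> bitstrings anc" "take a A = digit_bits (q - 1) k"
    "sim_op (index_bits C1 r @ vector_bits q y @ A) (index_bits C1 r @ zeros (m * w) @ zeros anc) =
       amp0 / of_nat (q ^ m) * amplitude_sum r k y"
proof -
  let ?rb = "index_bits C1 r" and ?K = "digit_bits (q - 1) k" and ?S = "vector_bits q (scaled k y)"
  let ?L = "?K @ (?rb @ ?S) @ zeros w @ H0 @ zeros l"
  define x where "x = cfg ?rb ?L"
  define x' where "x' = run_flips (table m q w a) x"
  define A where "A = map x' (block (2, 0) anc)"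
  note sc = scaled_in_digit_vectors[OF y, of k]
  have len: "length ?rb = m * w" "length ?S = m * w" "length ?K = a" "length y = m"
    using index_bits[OF r] vector_bits_in_bitstrings[OF sc] y by (auto simp: bitstrings_def digit_vectors_def)
  have lenL: "length ?L = anc"
    using len by (simp add: col_A_def col_H_def col_T_def col_S_def)
  have xK: "x (2, i) = bit k i" if "i < a" for i
    using that len by (simp add: x_def cfg_def nth_append digit_bits_def)
  have xS: "x (2, col_S m w a + j * w + i) = bit ((q - 1 - k) * (y ! j) mod q) i" if "j < m" "i < w" for j i
  proof -
    have "j * w + i < m * w" using digit_column_bound that by blast
    then have "x (2, col_S m w a + j * w + i) = ?S ! (j * w + i)"
      using len lenL by (simp add: x_def cfg_def nth_append col_S_def)
    then show ?thesis
      using nth_vector_bits[of j "scaled k y" i q] that len by (simp add: scaled_def)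
  qed
  have x_clear: "\<not> x (2, c)" if "col_H m w a \<le> c" for c
  proof -
    let ?P = "?K @ (?rb @ ?S) @ zeros w"
    have L: "?L = ?P @ zeros (helpers m q w a + l)" by (simp add: replicate_add)
    have "length ?P \<le> c" using that len by (simp add: col_H_def col_T_def col_S_def)
    then have "\<not> ?L ! c" if "c < length ?L"
      using that unfolding L nth_append by (simp del: append_assoc)
    then show ?thesis by (auto simp: x_def cfg_def simp del: append_assoc)
  qed
  note flip = flip_table[OF prime k y xK xS x_clear, folded x'_def]
  have bits: "x' (1, c) = vector_bits q y ! c" if "c < m * w" for c
  proof -
    have w: "w > 0" using that by (cases w) auto
    have c: "c = c div w * w + c mod w" by simp
    have j: "c div w < m" using that by (simp add: less_mult_imp_div_less)
    have "x' (1, c div w * w + c mod w) = (x (1, c div w * w + c mod w) \<noteq> bit (y ! (c div w)) (c mod w))"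
      by (rule flip(2)) (use j w in auto)
    moreover have "\<not> x (1, c div w * w + c mod w)" by (simp add: x_def cfg_def)
    moreover have "vector_bits q y ! (c div w * w + c mod w) = bit (y ! (c div w)) (c mod w)"
      by (rule nth_vector_bits) (use j w len in auto)
    ultimately show ?thesis using c by simp
  qed
  have other: "x' (b, c) = x (b, c)" if "b \<noteq> 1 \<or> c \<ge> m * w" "b \<noteq> 2 \<or> c \<ge> anc" for b c
    using flip(1)[of "(b, c)"] that by auto
  have x'_reg: "x' = reg ?rb (vector_bits q y) A"
  proof (intro ext)
    fix p show "x' p = reg ?rb (vector_bits q y) A p"
    proof (cases p)
      case (Pair b c)
      have A: "A ! c = x' (2, c)" if "c < anc" using that by (simp add: A_def block_def)
      have "length A = anc" "length (vector_bits q y) = m * w"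
        using len by (simp_all add: A_def length_vector_bits)
      then show ?thesis
        using bits[of c] other[of b c] A lenL unfolding Pair
        by (cases "b = 1 \<and> c < m * w"; cases "b = 2 \<and> c < anc") (auto simp: reg_def x_def cfg_def)
    qed
  qed
  have classical: "\<forall>g \<in> set (table m q w a). classical_gate g"
    using sim_gate_table by blast
  have "run_gates C l Q (query_circuit m q w a) (\<psi>0 r) x' = run_gates C l Q (table m q w a) (\<psi>7 r) x'"
    by (simp add: query_circuit_def \<psi>1_def[OF r k] \<psi>2_def[OF r k] \<psi>3_def[OF r k] \<psi>4_def[OF r k]
        \<psi>5_def[OF r k] \<psi>6_def[OF r k] \<psi>7_def[OF r k])
  also have "\<dots> = \<psi>7 r x" unfolding x'_def by (rule run_classical_gates[OF classical])
  also have "\<dots> = amp0 / of_nat (q ^ m) * amplitude_sum r k y"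
    unfolding x_def amplitude_sum_def by (rule state7[OF r k sc])
  finally have run: "run_gates C l Q (query_circuit m q w a) (\<psi>0 r) x' = amp0 / of_nat (q ^ m) * amplitude_sum r k y" .
  show ?thesis
  proof (rule that[of A])
    show A: "A \<in> bitstrings anc" by (simp add: A_def bitstrings_def)
    have "x' (2, i) = bit k i" if "i < a" for i
      using flip(1)[of "(2, i)"] xK[OF that] that col_S_le_col_H[where m = m and w = w and a = a] by simp
    then show "take a A = ?K"
      by (auto simp: A_def digit_bits_def block_def col_A_def col_H_def col_T_def col_S_def intro!: nth_equalityI)
    show "sim_op (?rb @ vector_bits q y @ A) (?rb @ zeros (m * w) @ zeros anc) =
        amp0 / of_nat (q ^ m) * amplitude_sum r k y"
      using sim_op_entry[OF index_bits[OF r] vector_bits_in_bitstrings[OF y] A index_bits[OF r], of "zeros (m * w)" "zeros anc"]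
        run unfolding x'_reg \<psi>0_def[OF r k] cfg_reg[of _ _ "m * w"] by simp
  qed
qed

section \<open>Presence in the simulated oracle\<close>

lemma cmod_amp0:
  "r \<in> indices C1 \<Longrightarrow> k < q - 1 \<Longrightarrow> (cmod amp0)\<^sup>2 = 1 / real (q - 1)"
  by (simp add: amp0_def norm_divide power_divide)

text \<open>Each multiplier yields one ancilla string, and these strings differ because they begin
  with the bits of \<open>k\<close>; so the squared moduli add up inside the weight. Real parts
  suffice, as the sum over \<open>k\<close> is real.\<close>

lemma weight_lower_bound:
  assumes r: "r \<in> indices C1" and y: "y \<in> digit_vectors q m"
  shows "(\<Sum>k<q - 1. (Re (amplitude_sum r k y))\<^sup>2) / (real (q - 1) * (real (q ^ m))\<^sup>2) \<le> weight r (vector_bits q y)"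
proof -
  let ?N = "\<lambda>A. (cmod (sim_op (index_bits C1 r @ vector_bits q y @ A) (index_bits C1 r @ zeros (m * w) @ zeros anc)))\<^sup>2"
  have "\<forall>k \<in> {..<q - 1}. \<exists>A. A \<in> bitstrings anc \<and> take a A = digit_bits (q - 1) k \<and>
      sim_op (index_bits C1 r @ vector_bits q y @ A) (index_bits C1 r @ zeros (m * w) @ zeros anc) =
       amp0 / of_nat (q ^ m) * amplitude_sum r k y"
    using query_circuit_outcome[OF r _ y] by (metis lessThan_iff)
  then obtain A where A: "\<And>k. k < q - 1 \<Longrightarrow> A k \<in> bitstrings anc"
    "\<And>k. k < q - 1 \<Longrightarrow> take a (A k) = digit_bits (q - 1) k"
    "\<And>k. k < q - 1 \<Longrightarrow> sim_op (index_bits C1 r @ vector_bits q y @ A k) (index_bits C1 r @ zeros (m * w) @ zeros anc) =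
       amp0 / of_nat (q ^ m) * amplitude_sum r k y"
    by (auto dest!: bchoice)
  have inj: "inj_on A {..<q - 1}"
  proof (rule inj_onI)
    fix j k assume *: "j \<in> {..<q - 1}" "k \<in> {..<q - 1}" "A j = A k"
    then have "digit_bits (q - 1) j = digit_bits (q - 1) k" using A(2)[of j] A(2)[of k] by simp
    then show "j = k" using * digit_bits_inj by simp
  qed
  have "(\<Sum>k<q - 1. (Re (amplitude_sum r k y))\<^sup>2) / (real (q - 1) * (real (q ^ m))\<^sup>2) =
      (\<Sum>k<q - 1. (Re (amplitude_sum r k y))\<^sup>2 / (real (q - 1) * (real (q ^ m))\<^sup>2))"
    by (rule sum_divide_distrib)
  also have "\<dots> \<le> (\<Sum>k<q - 1. ?N (A k))"
  proof (rule sum_mono)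
    fix k assume k: "k \<in> {..<q - 1}"
    then have "?N (A k) = (cmod amp0)\<^sup>2 / (real (q ^ m))\<^sup>2 * (cmod (amplitude_sum r k y))\<^sup>2"
      using A(3)[of k] by (simp add: norm_mult norm_divide power_mult_distrib power_divide norm_power)
    also have "\<dots> = (cmod (amplitude_sum r k y))\<^sup>2 / (real (q - 1) * (real (q ^ m))\<^sup>2)"
      using cmod_amp0[OF r, of k] k by simp
    finally have N: "?N (A k) = (cmod (amplitude_sum r k y))\<^sup>2 / (real (q - 1) * (real (q ^ m))\<^sup>2)" .
    have "(Re (amplitude_sum r k y))\<^sup>2 \<le> (cmod (amplitude_sum r k y))\<^sup>2"
      using abs_Re_le_cmod[of "amplitude_sum r k y"] by (metis abs_le_square_iff abs_norm_cancel)
    then show "(Re (amplitude_sum r k y))\<^sup>2 / (real (q - 1) * (real (q ^ m))\<^sup>2) \<le> ?N (A k)"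
      unfolding N by (rule divide_right_mono) simp
  qed
  also have "\<dots> = (\<Sum>B \<in> A ` {..<q - 1}. ?N B)" by (simp only: sum.reindex[OF inj] o_def)
  also have "\<dots> \<le> weight r (vector_bits q y)"
    unfolding weight_def by (rule sum_mono2) (use A(1) in auto)
  finally show ?thesis .
qed

text \<open>With the scaled vector the phase becomes \<open>(k + 1)\<close> times the difference
  between the answered symbol and the Hadamard symbol of \<open>y\<close>. The sum over
  \<open>k\<close> then weighs an answer with \<open>q - 1\<close> if the difference is 0 modulo
  \<open>q\<close>, and with \<open>-1\<close> otherwise.\<close>

lemma sum_amplitudes:
  assumes r: "r \<in> indices C1" and y: "y \<in> digit_vectors q m"
  shows "real q * (\<Sum>s \<in> digit_vectors q m. (cmod (\<alpha> (r, s) (digit_bits q ((\<Sum>i<m. y ! i * s ! i) mod q))))\<^sup>2) -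
     real (q ^ m) \<le> (\<Sum>k<q - 1. Re (amplitude_sum r k y))"
proof -
  have "q \<ge> 1" using q by simp
  let ?y = "\<lambda>s. \<Sum>i<m. y ! i * s ! i"
  let ?t = "\<lambda>s T. int (bits_val T) - int (?y s)"
  let ?hit = "\<lambda>s T. int q dvd ?t s T"
  let ?p = "\<lambda>s T. (cmod (\<alpha> (r, s) T))\<^sup>2"
  have phase: "cis (2 * pi * (real ((k + 1) * bits_val T + (\<Sum>i<m. scaled k y ! i * s ! i)) / real q)) =
      cis (2 * pi * (real_of_int (int (k + 1) * ?t s T) / real q))" if k: "k < q - 1" for k s T
  proof -
    have len: "length y = m" using y by (simp add: digit_vectors_def)
    have dvd: "int q dvd int (scaled k y ! i) + int (k + 1) * int (y ! i)" if "i < m" for i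
    proof -
      have "((q - 1 - k) * (y ! i) mod q + (k + 1) * y ! i) mod q = ((q - 1 - k) * y ! i + (k + 1) * y ! i) mod q"
        by (rule mod_add_left_eq)
      also have "(q - 1 - k) * y ! i + (k + 1) * y ! i = q * y ! i"
      proof -
        have "q - 1 - k + (k + 1) = q" using k by simp
        then show ?thesis by (simp only: distrib_right[symmetric])
      qed
      finally have "q dvd (q - 1 - k) * (y ! i) mod q + (k + 1) * y ! i" by (simp add: mod_eq_0_iff_dvd)
      then have "int q dvd int ((q - 1 - k) * (y ! i) mod q + (k + 1) * y ! i)"
        by (simp only: int_dvd_int_iff)
      then show ?thesis using that len by (simp add: scaled_def distrib_right)
    qed
    have "int ((k + 1) * bits_val T + (\<Sum>i<m. scaled k y ! i * s ! i)) - int (k + 1) * ?t s T =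
        (\<Sum>i<m. (int (scaled k y ! i) + int (k + 1) * int (y ! i)) * int (s ! i))"
      by (simp add: sum.distrib sum_distrib_left algebra_simps)
    moreover have "int q dvd (\<Sum>i<m. (int (scaled k y ! i) + int (k + 1) * int (y ! i)) * int (s ! i))"
      by (intro dvd_sum dvd_mult2 dvd) simp
    ultimately have "int q dvd int ((k + 1) * bits_val T + (\<Sum>i<m. scaled k y ! i * s ! i)) - int (k + 1) * ?t s T"
      by (simp only:)
    from cis_fraction_cong[OF \<open>q \<ge> 1\<close> this] show ?thesis by (simp only: of_int_of_nat_eq)
  qed
  have "(\<Sum>k<q - 1. amplitude_sum r k y) = (\<Sum>k<q - 1. \<Sum>s \<in> digit_vectors q m. \<Sum>T \<in> bitstrings w.
      ?p s T * cis (2 * pi * (real_of_int (int (k + 1) * ?t s T) / real q)))"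
    unfolding amplitude_sum_def by (intro sum.cong refl) (simp only: phase lessThan_iff)
  also have "\<dots> = (\<Sum>s \<in> digit_vectors q m. \<Sum>T \<in> bitstrings w.
      ?p s T * (\<Sum>k<q - 1. cis (2 * pi * (real_of_int (int (k + 1) * ?t s T) / real q))))"
    unfolding sum_distrib_left by (subst sum.swap, rule sum.cong[OF refl], rule sum.swap)
  also have "\<dots> = (\<Sum>s \<in> digit_vectors q m. \<Sum>T \<in> bitstrings w. of_real (?p s T * (real q * of_bool (?hit s T) - 1)))"
    unfolding sum_nontrivial_characters[OF \<open>q \<ge> 1\<close>] by (intro sum.cong refl) simp
  finally have total: "(\<Sum>k<q - 1. Re (amplitude_sum r k y)) =
      (\<Sum>s \<in> digit_vectors q m. \<Sum>T \<in> bitstrings w. ?p s T * (real q * of_bool (?hit s T) - 1))"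
    by (simp only: Re_sum[symmetric] of_real_sum[symmetric] Re_complex_of_real)
  have "real q * ?p s (digit_bits q (?y s mod q)) - 1 \<le>
      (\<Sum>T \<in> bitstrings w. ?p s T * (real q * of_bool (?hit s T) - 1))" if s: "s \<in> digit_vectors q m" for s
  proof -
    let ?T = "digit_bits q (?y s mod q)"
    have "int q dvd int (z mod q) - int z" for z
      by (simp add: of_nat_mod flip: mod_eq_dvd_iff)
    moreover have "bits_val ?T = ?y s mod q" by (rule bits_val_digit_bits) (use q in simp)
    ultimately have hit: "?hit s ?T" by (simp only:)
    \<comment> \<open>A string encoding a number not below \<open>q\<close> may also be congruent to
      the Hadamard symbol; such hits only help, whence an inequality.\<close>
    have "?p s ?T * real q = (\<Sum>T \<in> {?T}. ?p s T * (real q * of_bool (?hit s T)))"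
      using hit by simp
    also have "\<dots> \<le> (\<Sum>T \<in> bitstrings w. ?p s T * (real q * of_bool (?hit s T)))"
      by (rule sum_mono2) auto
    finally have "real q * ?p s ?T - (\<Sum>T \<in> bitstrings w. ?p s T) \<le>
        (\<Sum>T \<in> bitstrings w. ?p s T * (real q * of_bool (?hit s T))) - (\<Sum>T \<in> bitstrings w. ?p s T)"
      by (simp add: mult.commute)
    also have "\<dots> = (\<Sum>T \<in> bitstrings w. ?p s T * (real q * of_bool (?hit s T) - 1))"
      by (simp only: right_diff_distrib sum_subtractf mult_1_right)
    finally show ?thesis using alpha_norm[OF r s] by (simp only:)
  qed
  then have "(\<Sum>s \<in> digit_vectors q m. real q * ?p s (digit_bits q (?y s mod q)) - 1) \<le>
      (\<Sum>k<q - 1. Re (amplitude_sum r k y))"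
    unfolding total by (rule sum_mono)
  then show ?thesis
    by (simp only: sum_subtractf sum_distrib_left[symmetric] sum_constant card_digit_vectors mult_1_right)
qed

theorem presence_transfer:
  assumes I: "finite (indices C1)" "indices C1 \<noteq> {}"
    and x: "\<And>r. r \<in> indices C1 \<Longrightarrow> codeword C1 x r \<in> digit_vectors q m"
    and "\<epsilon> \<ge> 0" and pres: "presence C \<alpha> x \<ge> 1 / real q + \<epsilon>"
  shows "presence C1 sim_alpha x \<ge> (real q * \<epsilon> / (real q - 1))\<^sup>2"
proof -
  let ?N = "real (card (indices C1))" and ?M = "real (q ^ m)"
  let ?c = "codeword C1 x"
  let ?X = "\<lambda>r k. Re (amplitude_sum r k (?c r))"
  let ?P = "\<lambda>r. \<Sum>s \<in> digit_vectors q m. (cmod (\<alpha> (r, s) (digit_bits q ((\<Sum>i<m. ?c r ! i * s ! i) mod q))))\<^sup>2"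
  have N: "?N > 0" using I by (simp add: card_gt_0_iff)
  have M: "?M > 0" using q by simp
  have q1: "real (q - 1) > 0" "real (q - 1) = real q - 1" using q by auto
  have "presence C \<alpha> x = (\<Sum>r \<in> indices C1. ?P r) / (?N * ?M)"
  proof -
    have "(\<Sum>rs \<in> indices C. (cmod (\<alpha> rs (symbol_bits C (codeword C x rs))))\<^sup>2) =
        (\<Sum>(r, s) \<in> indices C1 \<times> digit_vectors q m.
           (cmod (\<alpha> (r, s) (digit_bits q ((\<Sum>i<m. ?c r ! i * s ! i) mod q))))\<^sup>2)"
      by (intro sum.cong) (auto simp: concatenated_code_def hadamard_code_def)
    also have "\<dots> = (\<Sum>r \<in> indices C1. ?P r)" by (rule sum.cartesian_product[symmetric])
    finally show ?thesis
      unfolding presence_def C_simps(3) by (simp add: card_cartesian_product card_digit_vectors)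
  qed
  then have "(1 / real q + \<epsilon>) * (?N * ?M) \<le> (\<Sum>r \<in> indices C1. ?P r)"
    using pres N M by (simp add: pos_le_divide_eq)
  then have "real q * ((1 / real q + \<epsilon>) * (?N * ?M)) \<le> real q * (\<Sum>r \<in> indices C1. ?P r)"
    by (rule mult_left_mono) simp
  then have "?N * ?M * (real q * \<epsilon>) \<le> real q * (\<Sum>r \<in> indices C1. ?P r) - ?N * ?M"
    using q by (simp add: distrib_right distrib_left mult_ac)
  also have "\<dots> = (\<Sum>r \<in> indices C1. real q * ?P r - ?M)"
    by (simp only: sum_subtractf sum_distrib_left sum_constant)
  also have "\<dots> \<le> (\<Sum>r \<in> indices C1. \<Sum>k<q - 1. ?X r k)"
    by (rule sum_mono) (rule sum_amplitudes[OF _ x])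
  finally have "(?N * ?M * (real q * \<epsilon>))\<^sup>2 \<le> (\<Sum>r \<in> indices C1. \<Sum>k<q - 1. ?X r k)\<^sup>2"
    using N M \<open>\<epsilon> \<ge> 0\<close> by (intro power_mono) auto
  also have "\<dots> = (\<Sum>(r, k) \<in> indices C1 \<times> {..<q - 1}. ?X r k)\<^sup>2"
    by (simp add: sum.cartesian_product)
  \<comment> \<open>Cauchy-Schwarz over all pairs of an outer index and a multiplier: it turns the
    average amplitude into a bound on the total squared amplitude.\<close>
  also have "\<dots> \<le> (\<Sum>(r, k) \<in> indices C1 \<times> {..<q - 1}. (?X r k)\<^sup>2) * real (card (indices C1 \<times> {..<q - 1}))"
    using sum_squared_le_sum_of_squares[of "\<lambda>(r, k). ?X r k" "indices C1 \<times> {..<q - 1}"]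
    by (simp only: case_prod_unfold)
  also have "\<dots> = (\<Sum>r \<in> indices C1. \<Sum>k<q - 1. (?X r k)\<^sup>2) * (?N * real (q - 1))"
    by (simp add: sum.cartesian_product card_cartesian_product)
  finally have main: "(?N * ?M * (real q * \<epsilon>))\<^sup>2 \<le> (\<Sum>r \<in> indices C1. \<Sum>k<q - 1. (?X r k)\<^sup>2) * (?N * real (q - 1))" .
  have "(\<Sum>r \<in> indices C1. \<Sum>k<q - 1. (?X r k)\<^sup>2) / (real (q - 1) * ?M\<^sup>2) =
      (\<Sum>r \<in> indices C1. (\<Sum>k<q - 1. (?X r k)\<^sup>2) / (real (q - 1) * ?M\<^sup>2))"
    by (rule sum_divide_distrib)
  also have "\<dots> \<le> (\<Sum>r \<in> indices C1. weight r (vector_bits q (?c r)))"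
    by (rule sum_mono) (rule weight_lower_bound[OF _ x])
  also have "\<dots> = presence C1 sim_alpha x * ?N"
    using N by (simp add: presence_def symbols cmod_sim_alpha)
  finally have "(\<Sum>r \<in> indices C1. \<Sum>k<q - 1. (?X r k)\<^sup>2) \<le> presence C1 sim_alpha x * ?N * (real (q - 1) * ?M\<^sup>2)"
    using q1 M by (simp add: pos_divide_le_eq)
  then have "(\<Sum>r \<in> indices C1. \<Sum>k<q - 1. (?X r k)\<^sup>2) * (?N * real (q - 1)) \<le>
      presence C1 sim_alpha x * ?N * (real (q - 1) * ?M\<^sup>2) * (?N * real (q - 1))"
    using N q1 by (intro mult_right_mono) auto
  with main have "(?N * ?M * (real q * \<epsilon>))\<^sup>2 \<le> presence C1 sim_alpha x * (?N * ?M * (real q - 1))\<^sup>2"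
    unfolding q1(2) by (simp add: power2_eq_square mult_ac)
  moreover have "?N * ?M * (real q - 1) > 0" using N M q1 by simp
  ultimately have "(?N * ?M * (real q * \<epsilon>))\<^sup>2 / (?N * ?M * (real q - 1))\<^sup>2 \<le> presence C1 sim_alpha x"
    by (subst pos_divide_le_eq) (simp_all only: zero_less_power)
  moreover have "(?N * ?M * (real q * \<epsilon>))\<^sup>2 / (?N * ?M * (real q - 1))\<^sup>2 = (real q * \<epsilon> / (real q - 1))\<^sup>2"
    using N M by (simp add: power_divide[symmetric] mult.assoc)
  ultimately show ?thesis by simp
qed

end

section \<open>The decoder of the concatenated code\<close>

text \<open>Register 43 runs through the powers of two; the truncated difference in register 44
  vanishes at the first power that is at least the contents of \<open>j\<close>.\<close>

definition width_prog :: "nat \<Rightarrow> nat \<Rightarrow> program" where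
  "width_prog i j = SEQ (SEQs [SET i 0, SET 43 1, SUB 44 j 43])
     (WHILE 44 (SEQs [ADD 43 43 43, ADD i i 5, SUB 44 j 43]))"

text \<open>Repeated addition, with time linear in the second factor; \<open>setup_prog\<close>
  therefore always puts a factor bounded by \<open>X\<close> second.\<close>

definition mult_prog :: "nat \<Rightarrow> nat \<Rightarrow> nat \<Rightarrow> program" where
  "mult_prog i j k = SEQ (SEQs [SET i 0, ADD 44 k 4]) (WHILE 44 (SEQs [ADD i i j, SUB 44 44 5]))"

lemma power_less_of_less_digit_width: "i < digit_width d \<Longrightarrow> 2 ^ i < d"
  unfolding digit_width_def by (drule not_less_Least) simp

lemma digit_width_le: "digit_width d \<le> d"
  unfolding digit_width_def by (rule Least_le) (simp add: less_imp_le)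

lemma width_prog:
  assumes R: "\<And>s v. R (s(i := v)) = R s" "\<And>s v. R (s(43 := v)) = R s" "\<And>s v. R (s(44 := v)) = R s"
    and "\<And>s. R s \<Longrightarrow> s 5 = 1 \<and> s j = d" "digit_width d \<le> X"
    and "i \<notin> {5, 43, 44, j}" "j \<notin> {43, 44}"
  shows "hoare (4 + 4 * X) R (width_prog i j) [] (\<lambda>s. R s \<and> s i = digit_width d)"
  unfolding width_prog_def
proof (rule hoare_SEQ_le)
  have pow: "b < digit_width d \<Longrightarrow> d - 2 ^ b \<noteq> 0" "d - 2 ^ digit_width d = 0" for b
    using power_less_of_less_digit_width[of b d] le_power_digit_width[of d] by auto
  let ?I = "\<lambda>b s. R s \<and> s i = b \<and> s 43 = 2 ^ b \<and> s 44 = d - 2 ^ b"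
  show "hoare 3 R (SEQs [SET i 0, SET 43 1, SUB 44 j 43]) [] (?I 0)"
    by (rule hoare_basics_le) (use assms in \<open>auto simp: R\<close>)
  show "hoare (1 + 4 * X) (?I 0) (WHILE 44 (SEQs [ADD 43 43 43, ADD i i 5, SUB 44 j 43])) []
     (\<lambda>s. R s \<and> s i = digit_width d)"
  proof (rule hoare_WHILE_le[where N = "digit_width d" and X = X and T = 3 and I = ?I and gs = "\<lambda>_. []"])
    fix b assume "b < digit_width d"
    show "hoare 3 (?I b) (SEQs [ADD 43 43 43, ADD i i 5, SUB 44 j 43]) [] (?I (Suc b))"
      by (rule hoare_basics_le) (use assms in \<open>auto simp: R\<close>)
  qed (use assms(5) pow in auto)
qed auto

lemma mult_prog:
  assumes R: "\<And>s v. R (s(i := v)) = R s" "\<And>s v. R (s(44 := v)) = R s"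
    and "\<And>s. R s \<Longrightarrow> s 4 = 0 \<and> s 5 = 1 \<and> s j = x \<and> s k = y" "y \<le> X"
    and "i \<notin> {4, 5, 44, j, k}" "j \<noteq> 44" "k \<noteq> 44"
  shows "hoare (3 + 3 * X) R (mult_prog i j k) [] (\<lambda>s. R s \<and> s i = x * y)"
  unfolding mult_prog_def
proof (rule hoare_SEQ_le)
  have h: "\<And>s. R s \<Longrightarrow> s 4 = 0" "\<And>s. R s \<Longrightarrow> s 5 = Suc 0" "\<And>s. R s \<Longrightarrow> s j = x" "\<And>s. R s \<Longrightarrow> s k = y"
    using assms(3) by simp_all
  let ?I = "\<lambda>b s. R s \<and> s i = x * b \<and> s 44 = y - b"
  show "hoare 2 R (SEQs [SET i 0, ADD 44 k 4]) [] (?I 0)"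
    by (rule hoare_basics_le) (use assms(5-7) in \<open>auto simp: R h\<close>)
  show "hoare (1 + 3 * X) (?I 0) (WHILE 44 (SEQs [ADD i i j, SUB 44 44 5])) [] (\<lambda>s. R s \<and> s i = x * y)"
  proof (rule hoare_WHILE_le[where N = y and X = X and T = 2 and I = ?I and gs = "\<lambda>_. []"])
    fix b assume "b < y"
    show "hoare 2 (?I b) (SEQs [ADD i i j, SUB 44 44 5]) [] (?I (Suc b))"
      by (rule hoare_basics_le) (use assms(5-7) in \<open>auto simp: R h\<close>)
  qed (use assms(4) in auto)
qed auto

text \<open>
  The number of message blocks is recovered from \<open>n\<close> and \<open>m\<close> by repeated subtraction. The registers
  from 50 on are those of the simulated decoder.
\<close>

definition setup_prog :: program where
  "setup_prog = SEQ (SEQs [ADD 51 4 45, ADD 52 2 45, ADD 53 3 45, ADD 54 4 45, ADD 6 2 45, ADD 7 3 45,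
       ADD 46 0 45, SET 4 0, SET 5 1, SET 2 1, SUB 12 7 5])
     (SEQ (WHILE 46 (SEQs [SUB 46 46 6, ADD 50 50 5]))
     (SEQ (width_prog 8 7) (SEQ (width_prog 9 12) (SEQ (mult_prog 10 6 8)
     (SEQ (SEQs [ADD 46 8 9, ADD 46 46 5])
     (SEQ (mult_prog 47 46 7) (SEQ (mult_prog 48 47 12) (mult_prog 11 48 6))))))))"

text \<open>Register 45 is zero in the input and serves as the zero summand for copying. The
  simulated decoder expects the reciprocal of its own bias, so \<open>e'\<close> is put both after
  its message length and at the end of its parameters.\<close>

lemma setup_prog:
  fixes m q N e e' X :: nat
  defines "w \<equiv> digit_width q" and "a \<equiv> digit_width (q - 1)"
  assumes "m \<ge> 1" "N \<le> X" "m \<le> X" "q \<le> X" "w \<le> X" "a \<le> X"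
  shows "hoare (40 + 23 * X) (\<lambda>s. s = input_registers [m * N, e, m, q, e']) setup_prog []
    (\<lambda>s. sim_consts m q w a s \<and> (\<forall>i. s (i + 50) = input_registers [N, e', m, q, e'] i))"
proof -
  let ?pin = "\<lambda>s :: nat \<Rightarrow> nat. s 2 = 1 \<and> s 4 = 0 \<and> s 5 = 1 \<and> s 6 = m \<and> s 7 = q \<and> s 12 = q - 1 \<and>
     s 51 = e' \<and> s 52 = m \<and> s 53 = q \<and> s 54 = e' \<and> (\<forall>i\<ge>55. s i = 0)"
  let ?R1 = "\<lambda>s. ?pin s \<and> s 50 = N"
  let ?R2 = "\<lambda>s. ?R1 s \<and> s 8 = w"
  let ?R3 = "\<lambda>s. ?R2 s \<and> s 9 = a"
  let ?R4 = "\<lambda>s. ?R3 s \<and> s 10 = m * w"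
  let ?R5 = "\<lambda>s. ?R4 s \<and> s 46 = w + a + 1"
  let ?R6 = "\<lambda>s. ?R5 s \<and> s 47 = (w + a + 1) * q"
  let ?R7 = "\<lambda>s. ?R6 s \<and> s 48 = (w + a + 1) * q * (q - 1)"
  have 0: "hoare 11 (\<lambda>s. s = input_registers [m * N, e, m, q, e'])
    (SEQs [ADD 51 4 45, ADD 52 2 45, ADD 53 3 45, ADD 54 4 45, ADD 6 2 45, ADD 7 3 45,
       ADD 46 0 45, SET 4 0, SET 5 1, SET 2 1, SUB 12 7 5]) []
    (\<lambda>s. ?pin s \<and> s 46 = m * (N - 0) \<and> s 50 = 0)"
    by (rule hoare_basics_le) (auto simp: input_registers_def)
  have 1: "hoare (1 + X * (2 + 1)) (\<lambda>s. ?pin s \<and> s 46 = m * (N - 0) \<and> s 50 = 0)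
    (WHILE 46 (SEQs [SUB 46 46 6, ADD 50 50 5])) (concat (map (\<lambda>_. []) [0..<N])) ?R1"
  proof (rule hoare_WHILE_le[where N = N and X = X and T = 2 and gs = "\<lambda>_. []"
        and I = "\<lambda>i s. ?pin s \<and> s 46 = m * (N - i) \<and> s 50 = i"])
    fix i assume i: "i < N"
    then have "m * (N - i) - m = m * (N - Suc i)" by (simp add: diff_mult_distrib2)
    then show "hoare 2 (\<lambda>s. ?pin s \<and> s 46 = m * (N - i) \<and> s 50 = i) (SEQs [SUB 46 46 6, ADD 50 50 5]) []
       (\<lambda>s. ?pin s \<and> s 46 = m * (N - Suc i) \<and> s 50 = Suc i)"
      by (intro hoare_basics_le) auto
  qed (use assms in auto)
  have 2: "hoare (4 + 4 * X) ?R1 (width_prog 8 7) [] ?R2"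
    using width_prog[of ?R1 8 7 q X] assms by simp
  have 3: "hoare (4 + 4 * X) ?R2 (width_prog 9 12) [] ?R3"
    using width_prog[of ?R2 9 12 "q - 1" X] assms by simp
  have 4: "hoare (3 + 3 * X) ?R3 (mult_prog 10 6 8) [] ?R4"
    by (rule mult_prog[where R = ?R3 and x = m and y = w]) (simp_all add: assms(7))
  have 5: "hoare 2 ?R4 (SEQs [ADD 46 8 9, ADD 46 46 5]) [] ?R5"
    by (rule hoare_basics_le) auto
  have 6: "hoare (3 + 3 * X) ?R5 (mult_prog 47 46 7) [] ?R6"
    by (rule mult_prog[where R = ?R5 and x = "w + a + 1" and y = q]) (simp_all add: assms(6))
  have 7: "hoare (3 + 3 * X) ?R6 (mult_prog 48 47 12) [] ?R7"
    by (rule mult_prog[where R = ?R6 and x = "(w + a + 1) * q" and y = "q - 1"]) (use assms(6) in simp_all)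
  have 8: "hoare (3 + 3 * X) ?R7 (mult_prog 11 48 6) []
     (\<lambda>s. ?R7 s \<and> s 11 = (w + a + 1) * q * (q - 1) * m)"
    by (rule mult_prog[where R = ?R7 and x = "(w + a + 1) * q * (q - 1)" and y = m]) (simp_all add: assms(5))
  show ?thesis unfolding setup_prog_def
  proof (rule hoare_conseq[OF hoare_SEQ[OF 0 hoare_SEQ[OF 1 hoare_SEQ[OF 2 hoare_SEQ[OF 3 hoare_SEQ[OF 4
        hoare_SEQ[OF 5 hoare_SEQ[OF 6 hoare_SEQ[OF 7 8]]]]]]]]])
    fix s assume s: "?R7 s \<and> s 11 = (w + a + 1) * q * (q - 1) * m"
    have "s (i + 50) = input_registers [N, e', m, q, e'] i" for i
    proof -
      consider "i = 0" | "i = 1" | "i = 2" | "i = 3" | "i = 4" | "i \<ge> 5" by linarith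
      then show ?thesis using s by cases (auto simp: input_registers_def)
    qed
    then show "sim_consts m q w a s \<and> (\<forall>i. s (i + 50) = input_registers [N, e', m, q, e'] i)"
      using s by (simp add: sim_consts_def helpers_def mult_ac)
  qed auto
qed

text \<open>Finite support makes the infinite sums in \<open>measure_prob\<close> summable, which
  comparing the probabilities of two events requires. A new support point differs from an old one
  only in the bits on \<open>ws\<close>.\<close>

lemma finite_support_apply_op:
  assumes "finite {x. \<psi> x \<noteq> 0}" "distinct ws"
  shows "finite {x. apply_op U ws \<psi> x \<noteq> 0}"
proof (rule finite_subset)
  show "finite ((\<lambda>(x, y). assign_bits x ws y) ` ({x. \<psi> x \<noteq> 0} \<times> bitstrings (length ws)))"
    using assms by simp
  show "{x. apply_op U ws \<psi> x \<noteq> 0} \<subseteq> (\<lambda>(x, y). assign_bits x ws y) ` ({x. \<psi> x \<noteq> 0} \<times> bitstrings (length ws))"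
  proof
    fix x assume "x \<in> {x. apply_op U ws \<psi> x \<noteq> 0}"
    then obtain y where y: "y \<in> bitstrings (length ws)" "\<psi> (assign_bits x ws y) \<noteq> 0"
      unfolding apply_op_def by (auto elim: sum.not_neutral_contains_not_neutral)
    have "assign_bits (assign_bits x ws y) ws (map x ws) = x"
      using assign_bits_assign_bits[OF assms(2) y(1), of "map x ws" x] by simp
    then show "x \<in> (\<lambda>(x, y). assign_bits x ws y) ` ({x. \<psi> x \<noteq> 0} \<times> bitstrings (length ws))"
      using y by (intro image_eqI[of _ _ "(assign_bits x ws y, map x ws)"]) auto
  qed
qed

lemma finite_support_run_gates:
  "finite {x. \<psi> x \<noteq> 0} \<Longrightarrow> \<forall>g \<in> set gs. distinct (gate_qubits C l g) \<Longrightarrow> finite {x. run_gates C l Q gs \<psi> x \<noteq> 0}"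
  by (induction gs arbitrary: \<psi>) (auto intro: finite_support_apply_op)

lemma finite_support_initial: "finite {x. initial_state x \<noteq> 0}"
proof -
  have "{x. initial_state x \<noteq> 0} = {\<lambda>_. False}" by (auto simp: initial_state_def)
  then show ?thesis by simp
qed

lemma measure_prob_mono:
  assumes "finite {x. \<psi> x \<noteq> 0}" "A \<subseteq> B"
  shows "measure_prob \<psi> ws A \<le> measure_prob \<psi> ws B"
  unfolding measure_prob_def
proof (rule infsum_mono2)
  have "(\<lambda>x. (cmod (\<psi> x))\<^sup>2) summable_on S" for S
    by (rule finite_nonzero_values_imp_summable_on) (rule finite_subset[OF _ assms(1)], auto)
  then show "(\<lambda>x. (cmod (\<psi> x))\<^sup>2) summable_on {x. map x ws \<in> A}" "(\<lambda>x. (cmod (\<psi> x))\<^sup>2) summable_on {x. map x ws \<in> B}"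
    by blast+
qed (use assms(2) in auto)

section \<open>Running the simulated circuit\<close>

lemma map_place_sim_qubits: "map (place u v t) (sim_qubits k n) = block u k @ block v k @ block t n"
proof -
  have "place u v t (0, 0) = u" "place u v t (1, 0) = v" "place u v t (2, 0) = t"
    by (simp_all add: place_simps)
  then show ?thesis using map_block[OF shift_map_place] by (simp add: sim_qubits_def)
qed

lemma gate_qubits_inverse_gates: "g' \<in> set (inverse_gates g) \<Longrightarrow> gate_qubits C l g' = gate_qubits C l g"
  by (cases g) auto

lemma gate_kind_relocate:
  assumes "classical_gate g \<or> phase_gate g \<or> qft_gate g \<or> query_gate g" "distinct (gate_qubits C l (relocate f g))"
  shows "classical_gate (relocate f g) \<or> phase_gate (relocate f g) \<or> qft_gate (relocate f g) \<or>
    query_gate (relocate f g)"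
  using assms by (cases g) auto

text \<open>Distinctness of an outer query whose ancilla count is \<open>col_A\<close> plus
  \<open>l\<close> says that its three blocks are disjoint. So \<open>place\<close> is injective on
  the relative qubits, and gates of the query circuit stay well-formed when relocated.\<close>

lemma distinct_simulated_gates:
  fixes C :: "('x, 'i, 's) block_code" and C1 :: "('y, 'j, 't) block_code"
  assumes "q \<ge> 2" "index_width C = m * digit_width q + m * digit_width q" "symbol_width C = digit_width q"
    and "index_width C1 = m * digit_width q" "symbol_width C1 = m * digit_width q"
    and "distinct (gate_qubits C1 (col_A m q (digit_width q) (digit_width (q - 1)) + l) g)"
    and "g' \<in> set (simulated_gates m q (digit_width q) (digit_width (q - 1)) g)"
  shows "distinct (gate_qubits C l g')"
proof -
  let ?a = "digit_width (q - 1)" and ?w = "digit_width q"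
  let ?ws = "sim_qubits (m * ?w) (col_A m q ?w ?a + l)"
  have relocated: "distinct (gate_qubits C l (relocate (place u v t) h))"
    if "distinct (block u (m * ?w) @ block v (m * ?w) @ block t (col_A m q ?w ?a + l))"
      "h \<in> set (query_circuit m q ?w ?a)" for u v t h
  proof -
    have "inj_on (place u v t) (set ?ws)"
      using that(1) by (simp only: map_place_sim_qubits[symmetric] distinct_map)
    moreover have "sim_gate C l (m * ?w) (col_A m q ?w ?a + l) h"
      using sim_gate_query_circuit[OF assms(1-3) that(2)] .
    ultimately show ?thesis
      by (auto simp: gate_qubits_relocate[OF shift_map_place] distinct_map sim_gate_def intro: inj_on_subset)
  qed
  show ?thesis
  proof (cases g)
    case (Query u v t)
    have d: "distinct (block u (m * ?w) @ block v (m * ?w) @ block t (col_A m q ?w ?a + l))"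
      using assms(6) by (simp only: Query gate_qubits.simps assms(4,5))
    obtain h where "h \<in> set (query_circuit m q ?w ?a)" "g' = relocate (place u v t) h"
      using assms(7) unfolding Query by auto
    then show ?thesis using relocated[OF d] by simp
  next
    case (QueryInv u v t)
    have d: "distinct (block u (m * ?w) @ block v (m * ?w) @ block t (col_A m q ?w ?a + l))"
      using assms(6) by (simp only: QueryInv gate_qubits.simps assms(4,5))
    obtain h where "h \<in> set (query_circuit m q ?w ?a)" "g' \<in> set (inverse_gates (relocate (place u v t) h))"
      using assms(7) unfolding QueryInv by (auto simp: inverse_circuit_def)
    then show ?thesis using relocated[OF d] gate_qubits_inverse_gates by metis
  qed (use assms(6,7) in auto)
qed

context hadamard_simulation
begin

lemma run_simulated_gate:
  assumes g: "distinct (gate_qubits C1 anc g)"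
  shows "run_gates C l Q (simulated_gates m q w a g) \<psi> = apply_op (gate_op sim_op g) (gate_qubits C1 anc g) \<psi>"
proof -
  have sg: "\<forall>g \<in> set (query_circuit m q w a). set (gate_qubits C l g) \<subseteq> set ws \<and> distinct (gate_qubits C l g)"
    using sim_gates by (simp add: sim_gate_def)
  show ?thesis
  proof (cases g)
    case (Query u v t)
    have b: "gate_qubits C1 anc g = map (place u v t) ws"
      by (simp add: Query map_place_sim_qubits index_width symbols)
    have "inj_on (place u v t) (set ws)" using g unfolding b by (simp only: distinct_map)
    from run_relocated_gates[OF distinct_sim_qubits this shift_map_place sg, of Q \<psi>] show ?thesis
      unfolding b by (simp add: Query sim_op_def)
  next
    case (QueryInv u v t)
    have b: "gate_qubits C1 anc g = map (place u v t) ws"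
      by (simp add: QueryInv map_place_sim_qubits index_width symbols)
    have inj: "inj_on (place u v t) (set ws)" using g unfolding b by (simp only: distinct_map)
    have "run_gates C l Q (inverse_circuit (map (relocate (place u v t)) (query_circuit m q w a))) \<psi> =
        apply_op (adjoint_op (circuit_mat C l Q ws (query_circuit m q w a))) (map (place u v t) ws) \<psi>"
    proof (rule run_inverse_circuit[OF distinct_sim_qubits inj shift_map_place sg])
      fix h \<psi> assume h: "h \<in> set (query_circuit m q w a)"
      have "distinct (gate_qubits C l (relocate (place u v t) h))"
        using sg h inj by (auto simp: gate_qubits_relocate[OF shift_map_place] distinct_map intro: inj_on_subset)
      then have "run_gates C l Q (inverse_gates (relocate (place u v t) h)) \<psi> =
          apply_op (adjoint_op (gate_op Q (relocate (place u v t) h))) (gate_qubits C l (relocate (place u v t) h)) \<psi>"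
        using sim_gates h by (intro run_inverse_gates gate_kind_relocate) (auto simp: sim_gate_def)
      then show "run_gates C l Q (inverse_gates (relocate (place u v t) h)) \<psi> =
          apply_op (adjoint_op (gate_op Q h)) (map (place u v t) (gate_qubits C l h)) \<psi>"
        by (simp add: gate_qubits_relocate[OF shift_map_place])
    qed
    then show ?thesis unfolding b by (simp add: QueryInv sim_op_def)
  qed simp_all
qed

text \<open>With \<open>l\<close> ancillas for the given oracle, the run is that of the outer
  decoder on an oracle with \<open>anc\<close> ancillas. The outer guarantee covers every number of
  ancillas, so the emitted circuit need not know \<open>l\<close>.\<close>

lemma run_simulated_circuit:
  assumes "\<forall>g \<in> set gs. distinct (gate_qubits C1 anc g)"
  shows "run_circuit C l Q (concat (map (simulated_gates m q w a) gs)) = run_circuit C1 anc sim_op gs"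
proof -
  have "run_gates C l Q (concat (map (simulated_gates m q w a) gs)) \<psi> = run_gates C1 anc sim_op gs \<psi>" for \<psi>
    using assms
  proof (induction gs arbitrary: \<psi>)
    case (Cons g gs)
    have "run_gates C l Q (concat (map (simulated_gates m q w a) (g # gs))) \<psi> =
        run_gates C l Q (concat (map (simulated_gates m q w a) gs)) (run_gates C l Q (simulated_gates m q w a g) \<psi>)"
      by (simp only: list.map concat.simps run_gates_simps)
    also have "\<dots> = run_gates C1 anc sim_op (g # gs) \<psi>"
      using Cons run_simulated_gate[of g \<psi>] by simp
    finally show ?case .
  qed simp
  then show ?thesis by (simp add: run_circuit_def run_gates_def)
qed

end

section \<open>The concatenated code and its decoder\<close>

lemma full_grs_code_simps [simp]:
  "messages (full_grs_code q m \<theta> F) = {x. length x = grs_length q m \<theta> \<and> set x \<subseteq> carrier F}"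
  "indices (full_grs_code q m \<theta> F) = carrier F" "alphabet (full_grs_code q m \<theta> F) = carrier F"
  "index_bits (full_grs_code q m \<theta> F) = vector_bits q" "symbol_bits (full_grs_code q m \<theta> F) = vector_bits q"
  "index_width (full_grs_code q m \<theta> F) = m * digit_width q"
  "symbol_width (full_grs_code q m \<theta> F) = m * digit_width q"
  by (simp_all add: full_grs_code_def grs_code_def)

lemma codeword_full_grs_code:
  assumes "field F" "x \<in> messages (full_grs_code q m \<theta> F)" "r \<in> carrier F"
  shows "codeword (full_grs_code q m \<theta> F) x r \<in> carrier F"
proof -
  interpret field F by fact
  have "x ! i \<in> carrier F" if "i < grs_length q m \<theta>" for i
    using assms(2) that by (auto dest: nth_mem)
  then show ?thesis
    using assms(3) by (auto simp: full_grs_code_def grs_code_def intro!: finsum_closed)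
qed

lemma grs_h_code_simps [simp]:
  "messages (grs_h_code q m \<theta> F) = messages (full_grs_code q m \<theta> F)"
  "alphabet (grs_h_code q m \<theta> F) = {..<q}"
  "index_width (grs_h_code q m \<theta> F) = m * digit_width q + m * digit_width q"
  "symbol_width (grs_h_code q m \<theta> F) = digit_width q"
  "listed_messages (grs_h_code q m \<theta> F) = listed_messages (full_grs_code q m \<theta> F)"
  by (auto simp: grs_h_code_def concatenated_code_def hadamard_code_def listed_messages_def fun_eq_iff)

text \<open>A message above the threshold for the given oracle is above the outer threshold for the
  simulated one, so the success event of the outer decoder is contained in the required
  event.\<close>

lemma grs_h_decoding:
  assumes prime: "prime q" and F: "is_extension_field q m F" and "\<epsilon> \<ge> 0"
    and bias: "\<epsilon>\<^sup>2 \<ge> (1 - 1 / real q)\<^sup>2 * (1 / real (q ^ m) + \<epsilon>')"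
    and distinct: "\<And>l. \<forall>g \<in> set gs. distinct (gate_qubits (full_grs_code q m \<theta> F) l g)"
    and decoder: "\<And>l Q \<alpha> \<phi>. corrupted_codeword (full_grs_code q m \<theta> F) l Q \<alpha> \<phi> \<Longrightarrow>
       measure_prob (run_circuit (full_grs_code q m \<theta> F) l Q gs) ws
         {bs. \<forall>x \<in> messages (full_grs_code q m \<theta> F).
            presence (full_grs_code q m \<theta> F) \<alpha> x \<ge> 1 / real (card (alphabet (full_grs_code q m \<theta> F))) + \<epsilon>' \<longrightarrow>
            x \<in> listed_messages (full_grs_code q m \<theta> F) bs} \<ge> \<delta>"
    and corrupted: "corrupted_codeword (grs_h_code q m \<theta> F) l Q \<alpha> \<phi>"
  shows "measure_prob (run_circuit (grs_h_code q m \<theta> F) l Q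
      (concat (map (simulated_gates m q (digit_width q) (digit_width (q - 1))) gs))) ws
         {bs. \<forall>x \<in> messages (grs_h_code q m \<theta> F).
            presence (grs_h_code q m \<theta> F) \<alpha> x \<ge> 1 / real (card (alphabet (grs_h_code q m \<theta> F))) + \<epsilon> \<longrightarrow>
            x \<in> listed_messages (grs_h_code q m \<theta> F) bs} \<ge> \<delta>"
proof -
  let ?C1 = "full_grs_code q m \<theta> F"
  have carrier: "carrier F = digit_vectors q m" and field: "field F"
    using F by (simp_all add: is_extension_field_def)
  interpret hadamard_simulation ?C1 q m l Q \<alpha> \<phi>
    using prime corrupted by unfold_locales
      (auto simp: grs_h_code_def carrier vector_bits_in_bitstrings)
  have C: "C = grs_h_code q m \<theta> F" by (simp add: grs_h_code_def)
  have q1: "real q > 1" using q by simp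
  have nonempty: "carrier F \<noteq> {}"
    using card_digit_vectors[of q m] q by (metis card.empty carrier power_not_zero not_numeral_le_zero)
  have pres: "presence ?C1 sim_alpha x \<ge> 1 / real (card (alphabet ?C1)) + \<epsilon>'"
    if x: "x \<in> messages ?C1" and p: "presence (grs_h_code q m \<theta> F) \<alpha> x \<ge> 1 / real (card (alphabet (grs_h_code q m \<theta> F))) + \<epsilon>" for x
  proof -
    have "(real q * \<epsilon> / (real q - 1))\<^sup>2 \<le> presence ?C1 sim_alpha x"
    proof (rule presence_transfer)
      show "presence C \<alpha> x \<ge> 1 / real q + \<epsilon>" using p by (simp add: C)
    qed (use carrier nonempty codeword_full_grs_code[OF field x] \<open>\<epsilon> \<ge> 0\<close> in auto)
    moreover have "1 / real (q ^ m) + \<epsilon>' \<le> (real q * \<epsilon> / (real q - 1))\<^sup>2"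
    proof -
      have pos: "(1 - 1 / real q)\<^sup>2 > 0" using q1 by simp
      \<comment> \<open>Dividing the assumed inequality by \<open>(1 - 1 / q)\<close> squared leaves
        exactly the presence guaranteed by \<open>presence_transfer\<close>, because
        \<open>1 - 1 / q = (q - 1) / q\<close>.\<close>
      have "1 / real (q ^ m) + \<epsilon>' \<le> \<epsilon>\<^sup>2 / (1 - 1 / real q)\<^sup>2"
        using bias pos by (simp add: pos_le_divide_eq mult.commute)
      also have "\<dots> = (\<epsilon> / (1 - 1 / real q))\<^sup>2" by (simp add: power_divide)
      also have "\<epsilon> / (1 - 1 / real q) = real q * \<epsilon> / (real q - 1)" using q1 by (simp add: field_simps)
      finally show ?thesis .
    qed
    ultimately show ?thesis by (simp add: carrier card_digit_vectors)
  qed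
  have "\<delta> \<le> measure_prob (run_circuit ?C1 anc sim_op gs) ws
         {bs. \<forall>x \<in> messages ?C1. presence ?C1 sim_alpha x \<ge> 1 / real (card (alphabet ?C1)) + \<epsilon>' \<longrightarrow>
            x \<in> listed_messages ?C1 bs}"
    by (rule decoder[OF sim_corrupted])
  also have "\<dots> \<le> measure_prob (run_circuit ?C1 anc sim_op gs) ws
         {bs. \<forall>x \<in> messages (grs_h_code q m \<theta> F).
            presence (grs_h_code q m \<theta> F) \<alpha> x \<ge> 1 / real (card (alphabet (grs_h_code q m \<theta> F))) + \<epsilon> \<longrightarrow>
            x \<in> listed_messages (grs_h_code q m \<theta> F) bs}"
  proof (rule measure_prob_mono)
    show "finite {x. run_circuit ?C1 anc sim_op gs x \<noteq> 0}"
      using finite_support_run_gates[OF finite_support_initial distinct]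
      by (simp add: run_circuit_def run_gates_def)
  qed (use pres in \<open>auto simp del: full_grs_code_simps\<close>)
  finally show ?thesis
    using run_simulated_circuit[OF distinct] by (simp only: C)
qed

lemma poly_bounded_total_time: "poly_bounded (\<lambda>X. 40 + 23 * X + simulation_time X)"
  unfolding simulation_time_def query_time_def
  by (intro poly_bounded_add poly_bounded_mult poly_bounded_const poly_bounded_id)

theorem proposition8:
  fixes m q :: "nat \<Rightarrow> nat" and \<theta> \<epsilon> \<epsilon>' \<delta> :: "nat \<Rightarrow> real" and F :: "nat \<Rightarrow> nat list ring"
  assumes "\<And>n. n \<ge> 1 \<Longrightarrow> (n, m n, q n, \<theta> n) \<in> param_tuples"
    and "\<And>n. n \<ge> 1 \<Longrightarrow> prime (q n)"
    and "\<And>n. n \<ge> 1 \<Longrightarrow> \<epsilon> n \<in> {0..1} \<and> \<epsilon>' n \<in> {0..1} \<and> \<delta> n \<in> {0..1}"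
    and "\<And>n. n \<ge> 1 \<Longrightarrow>
           (\<epsilon> n)\<^sup>2 \<ge> (1 - 1 / real (q n))\<^sup>2 * (1 / real (q n ^ m n) + \<epsilon>' n)"
    and "\<And>n. n \<ge> 1 \<Longrightarrow> is_extension_field (q n) (m n) (F n)"
    and "has_poly_time_quantum_list_decoder
           (\<lambda>n. full_grs_code (q n) (m n) (\<theta> n) (F n))
           (\<lambda>n. grs_length (q n) (m n) (\<theta> n))
           (\<lambda>n. [m n, q n, nat \<lceil>1 / \<epsilon>' n\<rceil>])
           \<epsilon>' \<delta>
           (\<lambda>n. time_scale n (q n) (\<epsilon>' n) (\<delta> n) (\<theta> n))"
  shows "has_poly_time_quantum_list_decoder
           (\<lambda>n. grs_h_code (q n) (m n) (\<theta> n) (F n))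
           (\<lambda>n. n)
           (\<lambda>n. [m n, q n, nat \<lceil>1 / \<epsilon>' n\<rceil>])
           \<epsilon> \<delta>
           (\<lambda>n. time_scale n (q n) (\<epsilon>' n) (\<delta> n) (\<theta> n))"
proof -
  let ?C1 = "\<lambda>n. full_grs_code (q n) (m n) (\<theta> n) (F n)" and ?C = "\<lambda>n. grs_h_code (q n) (m n) (\<theta> n) (F n)"
  let ?N = "\<lambda>n. grs_length (q n) (m n) (\<theta> n)" and ?pars = "\<lambda>n. [m n, q n, nat \<lceil>1 / \<epsilon>' n\<rceil>]"
  let ?B = "\<lambda>n. time_scale n (q n) (\<epsilon>' n) (\<delta> n) (\<theta> n)"
  let ?sim = "\<lambda>n. simulated_gates (m n) (q n) (digit_width (q n)) (digit_width (q n - 1))"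
  \<comment> \<open>One bound for all size parameters: besides \<open>m\<close>, \<open>q\<close>
    and the widths it covers \<open>m * digit_width q\<close>, which is at most
    \<open>n * q\<close>.\<close>
  let ?X = "\<lambda>n. (n + q n)\<^sup>2"
  obtain P where P: "is_quantum_list_decoder P ?C1 ?N ?pars \<epsilon>' \<delta>"
    and P_time: "runs_in_time_poly P ?N \<epsilon>' ?pars ?B"
    using assms(6) unfolding has_poly_time_quantum_list_decoder_def by blast
  define P' where "P' = SEQ setup_prog (translate 50 simulation_prog P)"
  have run: "\<exists>r t'. exec P' (decoder_input (\<lambda>n. n) \<epsilon> ?pars n) r (concat (map (?sim n) gs)) ws t' \<and>
      t' \<le> (1 + t) * (40 + 23 * ?X n + simulation_time (?X n))"
    if n: "n \<ge> 1" and ex: "exec P (decoder_input ?N \<epsilon>' ?pars n) s gs ws t" for n s gs ws t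
  proof -
    have par: "m n \<ge> 1" "q n \<ge> 2" "real (q n ^ m n) * \<theta> n \<in> \<nat>" "real n = real (m n) * (real (q n ^ m n) * \<theta> n)"
      using assms(1)[OF n] by (auto simp: param_tuples_def)
    then obtain N where N: "real (q n ^ m n) * \<theta> n = real N" by (auto elim: Nats_cases)
    then have len: "?N n = N" by (simp add: grs_length_def)
    have nN: "n = m n * N" using par(4) unfolding N by (simp flip: of_nat_mult)
    have X: "n + q n \<le> ?X n" using par by (simp add: power2_eq_square)
    have le: "m n \<le> n" "N \<le> n" using n nN by (metis dvd_imp_le dvd_triv_left dvd_triv_right less_le_trans zero_less_one)+
    have w: "digit_width (q n) \<le> q n" "digit_width (q n - 1) \<le> q n"
      using digit_width_le[of "q n"] digit_width_le[of "q n - 1"] by linarith+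
    have mw: "m n * digit_width (q n) \<le> ?X n"
      unfolding power2_eq_square using le w by (intro mult_mono) auto
    have "hoare (40 + 23 * ?X n) (\<lambda>s. s = input_registers [m n * N, nat \<lceil>1 / \<epsilon> n\<rceil>, m n, q n, nat \<lceil>1 / \<epsilon>' n\<rceil>]) setup_prog []
      (\<lambda>s. sim_consts (m n) (q n) (digit_width (q n)) (digit_width (q n - 1)) s \<and>
        (\<forall>i. s (i + 50) = input_registers [N, nat \<lceil>1 / \<epsilon>' n\<rceil>, m n, q n, nat \<lceil>1 / \<epsilon>' n\<rceil>] i))"
      by (rule setup_prog) (use par X le w in linarith)+
    then obtain r t1 where r: "exec setup_prog (decoder_input (\<lambda>n. n) \<epsilon> ?pars n) r [] [] t1" "t1 \<le> 40 + 23 * ?X n"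
        "sim_consts (m n) (q n) (digit_width (q n)) (digit_width (q n - 1)) r"
        "\<forall>i. r (i + 50) = decoder_input ?N \<epsilon>' ?pars n i"
      by (rule hoareE) (auto simp: decoder_input_def len nN[symmetric])
    obtain r' t2 where r': "exec (translate 50 simulation_prog P) r r' (concat (map (?sim n) gs)) ws t2"
        "t2 \<le> t * simulation_time (?X n)"
      using exec_simulation[OF ex r(3,4), of "?X n"] par X le w mw by auto
    have "exec P' (decoder_input (\<lambda>n. n) \<epsilon> ?pars n) r' ([] @ concat (map (?sim n) gs)) ([] @ ws) (t1 + t2)"
      unfolding P'_def by (rule exec_SEQ[OF r(1) r'(1)])
    moreover have "t1 + t2 \<le> (1 + t) * (40 + 23 * ?X n + simulation_time (?X n))"
      using r(2) r'(2) by (simp add: algebra_simps)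
    ultimately show ?thesis by auto
  qed
  have decoder: "is_quantum_list_decoder P' ?C (\<lambda>n. n) ?pars \<epsilon> \<delta>"
    unfolding is_quantum_list_decoder_def
  proof (intro allI impI)
    fix n :: nat assume n: "n \<ge> 1"
    obtain s gs ws t where ex: "exec P (decoder_input ?N \<epsilon>' ?pars n) s gs ws t"
      and distinct: "\<And>l. \<forall>g \<in> set gs. distinct (gate_qubits (?C1 n) l g)"
      and dec: "\<And>l Q \<alpha> \<phi>. corrupted_codeword (?C1 n) l Q \<alpha> \<phi> \<Longrightarrow>
           measure_prob (run_circuit (?C1 n) l Q gs) ws
             {bs. \<forall>x \<in> messages (?C1 n).
                presence (?C1 n) \<alpha> x \<ge> 1 / real (card (alphabet (?C1 n))) + \<epsilon>' n \<longrightarrow>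
                x \<in> listed_messages (?C1 n) bs} \<ge> \<delta> n"
      using P n unfolding is_quantum_list_decoder_def by meson
    obtain r t' where r: "exec P' (decoder_input (\<lambda>n. n) \<epsilon> ?pars n) r (concat (map (?sim n) gs)) ws t'"
      using run[OF n ex] by blast
    have q: "q n \<ge> 2" using assms(2)[OF n] by (rule prime_ge_2_nat)
    have "distinct (gate_qubits (?C n) l g')" if g': "g' \<in> set (concat (map (?sim n) gs))" for l g'
    proof -
      obtain g where g: "g \<in> set gs" "g' \<in> set (?sim n g)" using g' by auto
      show ?thesis
        by (rule distinct_simulated_gates[OF q _ _ _ _ _ g(2), where ?C1.0 = "?C1 n"])
          (use g(1) distinct in auto)
    qed
    moreover have "measure_prob (run_circuit (?C n) l Q (concat (map (?sim n) gs))) ws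
             {bs. \<forall>x \<in> messages (?C n).
                presence (?C n) \<alpha> x \<ge> 1 / real (card (alphabet (?C n))) + \<epsilon> n \<longrightarrow>
                x \<in> listed_messages (?C n) bs} \<ge> \<delta> n"
      if "corrupted_codeword (?C n) l Q \<alpha> \<phi>" for l Q \<alpha> \<phi>
      by (rule grs_h_decoding[OF assms(2)[OF n] assms(5)[OF n] _ assms(4)[OF n] distinct dec that])
        (use assms(3)[OF n] in simp)
    ultimately show "\<exists>s gs ws t. exec P' (decoder_input (\<lambda>n. n) \<epsilon> ?pars n) s gs ws t \<and>
        (\<forall>l. \<forall>g \<in> set gs. distinct (gate_qubits (?C n) l g)) \<and>
        (\<forall>l Q \<alpha> \<phi>. corrupted_codeword (?C n) l Q \<alpha> \<phi> \<longrightarrow>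
           measure_prob (run_circuit (?C n) l Q gs) ws
             {bs. \<forall>x \<in> messages (?C n).
                presence (?C n) \<alpha> x \<ge> 1 / real (card (alphabet (?C n))) + \<epsilon> n \<longrightarrow>
                x \<in> listed_messages (?C n) bs} \<ge> \<delta> n)"
      using r by blast
  qed
  have "runs_in_time_poly P' (\<lambda>n. n) \<epsilon> ?pars ?B"
  proof -
    obtain c1 k1 where c1: "\<And>n s gs ws t. n \<ge> 1 \<Longrightarrow> exec P (decoder_input ?N \<epsilon>' ?pars n) s gs ws t \<Longrightarrow>
        of_nat t \<le> of_nat c1 * ?B n ^ k1"
      using P_time unfolding runs_in_time_poly_def by blast
    obtain c2 k2 where c2: "\<And>X. X \<ge> 1 \<Longrightarrow> 40 + 23 * X + simulation_time X \<le> c2 * X ^ k2"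
      using poly_bounded_total_time unfolding poly_bounded_def by blast
    have "of_nat t' \<le> of_nat ((1 + c1) * c2) * ?B n ^ (k1 + 2 * k2)"
      if n: "n \<ge> 1" and ex': "exec P' (decoder_input (\<lambda>n. n) \<epsilon> ?pars n) s' gs' ws' t'" for n s' gs' ws' t'
    proof -
      obtain s gs ws t where ex: "exec P (decoder_input ?N \<epsilon>' ?pars n) s gs ws t"
        using P n unfolding is_quantum_list_decoder_def by meson
      \<comment> \<open>The time bound concerns an arbitrary run of \<open>P'\<close>; by
        determinism it is the run constructed from \<open>P\<close>.\<close>
      have t': "t' \<le> (1 + t) * (40 + 23 * ?X n + simulation_time (?X n))"
        using run[OF n ex] exec_deterministic[OF ex'] by blast
      have "?X n \<ge> 1" using n by simp
      then have "t' \<le> (1 + t) * (c2 * ?X n ^ k2)"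
        using t' c2[of "?X n"] by (meson le_trans mult_le_mono2)
      then have "of_nat t' \<le> (of_nat ((1 + t) * (c2 * ?X n ^ k2)) :: ennreal)"
        by (rule of_nat_mono)
      also have "\<dots> = (1 + of_nat t) * (of_nat c2 * of_nat (n + q n) ^ (2 * k2))"
        by (simp only: of_nat_mult of_nat_add of_nat_1 of_nat_power power_mult)
      \<comment> \<open>The time scale dominates \<open>n + q \<ge> 1\<close>, so its powers are at
        least 1 and absorb the summand 1; the exponent \<open>2 * k2\<close> comes from the square
        in \<open>?X\<close>.\<close>
      also have "\<dots> \<le> (of_nat (1 + c1) * ?B n ^ k1) * (of_nat c2 * ?B n ^ (2 * k2))"
      proof (intro mult_mono power_mono)
        show B: "of_nat (n + q n) \<le> ?B n"
          by (simp add: time_scale_def add.assoc)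
        have "(1 :: ennreal) \<le> of_nat (n + q n)"
          using n of_nat_mono[of 1 "n + q n", where 'a = ennreal] by simp
        then have "1 \<le> ?B n ^ k1" using B by (intro one_le_power) (rule order_trans)
        then have "1 + of_nat t \<le> ?B n ^ k1 + of_nat c1 * ?B n ^ k1"
          using c1[OF n ex] by (intro add_mono)
        then show "1 + of_nat t \<le> of_nat (1 + c1) * ?B n ^ k1" by (simp add: distrib_right)
      qed auto
      also have "\<dots> = of_nat ((1 + c1) * c2) * ?B n ^ (k1 + 2 * k2)"
        by (simp only: power_add of_nat_mult mult_ac)
      finally show ?thesis .
    qed
    then show ?thesis unfolding runs_in_time_poly_def by blast
  qed
  then show ?thesis using decoder unfolding has_poly_time_quantum_list_decoder_def by blast
qed

end
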